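(* Let $\epsilon>0$, $\delta\in(0,1)$, and let $\mathcal{M}$ be a deterministic MDP with $\sigma^2$-sub-Gaussian rewards. With probability at least $1-\delta$, the sample complexity $\tau$ of EPRL combined with either the static maximum-coverage sampling rule (in which case $C_H:=1$) or the maximum-coverage sampling rule (in which case $C_H:=\log(H)+1$) is bounded by $$\tau\le 2C_H\Big(\max_{(s,a,h)\in\mathcal{E}}\log\big(g_h(s,a)\big)+1\Big)\varphi^\star(g),$$ where $g:\mathcal{E}\to[0,\infty)$ is the lower bound function $$g_h(s,a):=\frac{32\sigma^2H^2}{\max(\overline\Delta_h(s,a),\overline\Delta_{\min},\epsilon)^2}\Big(\log\Big(\frac{4N^3}{\delta}\Big)+L_h(s,a)\Big)+2,\qquad L_h(s,a):=8\log\Big(\frac{16\sigma H\log(4N^3/\delta)}{\max(\overline\Delta_h(s,a),\overline\Delta_{\min},\epsilon)}\Big).$$ Moreover, with the same probability, $$\tau\le\frac{256\sigma^2SAH^2}{\epsilon^2}\Big(\log\Big(\frac{4SAH}{\delta}\Big)+4\log\Big(\frac{512\sigma^2SAH^2\log(4SAH/\delta)}{\epsilon^2}\Big)\Big)+8SAH+2.$$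
   Context: Deterministic MDP. $\mathcal{M}=(\mathcal{S},\mathcal{A},\{f_h,\nu_h\}_{h\in[H]},s_1,H)$, $[H]=\{1,\dots,H\}$, where $\mathcal{S},\mathcal{A}$ are finite with $S=|\mathcal{S}|$, $A=|\mathcal{A}|$, $f_h:\mathcal{S}\times\mathcal{A}\to\mathcal{S}$ is the (deterministic) transition function at stage $h$, $\nu_h(s,a)$ is the reward distribution on $\mathbb{R}$ with mean $r_h(s,a)$, $s_1$ is the initial state. At stage $h$ in state $s$ only actions in $\mathcal{A}_h(s)\subseteq\mathcal{A}$ are available. $\Pi$ is the (non-empty) set of deterministic policies $\pi=(\pi_h)_{h\in[H]}$, $\pi_h:\mathcal{S}\to\mathcal{A}$, $\pi_h(s)\in\mathcal{A}_h(s)$. Playing $\pi$ gives $s_1^\pi=s_1$, $a_h^\pi=\pi_h(s_h^\pi)$, $s_{h+1}^\pi=f_h(s_h^\pi,a_h^\pi)$. $\mathcal{S}_h=\{s:\exists\pi\in\Pi,s_h^\pi=s\}$; $\mathcal{E}=\{(s,a,h):h\in[H],s\in\mathcal{S}_h,a\in\mathcal{A}_h(s)\}$, $N=|\mathcal{E}|$; $\Pi_{s,a,h}=\{\pi\in\Pi:s_h^\pi=s,a_h^\pi=a\}$. $V_1^\pi(s_1)=\sum_{h=1}^Hr_h(s_h^\pi,a_h^\pi)$, $V_1^\star(s_1)=\max_{\pi\in\Pi}V_1^\pi(s_1)$. Deterministic return gap: $\overline\Delta_h(s,a)=V_1^\star(s_1)-\max_{\pi\in\Pi_{s,a,h}}V_1^\pi(s_1)$.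 $\overline\Delta_{\min}=\min\{\overline\Delta_h(s,a):(s,a,h)\in\mathcal{E},\overline\Delta_h(s,a)>0\}$ if there is a unique optimal trajectory (all policies attaining $V_1^\star(s_1)$ have the same trajectory), and $\overline\Delta_{\min}=0$ otherwise (and also $0$ if there is no positive gap). Learning protocol. Everything except the reward distributions is known. In episode $t=1,2,\dots$ the learner selects $\pi^t\in\Pi$ from past observations (sampling rule), and observes the trajectory $(s_h^t,a_h^t)=(s_h^{\pi^t},a_h^{\pi^t})$ and independent rewards $y_h^t\sim\nu_h(s_h^t,a_h^t)$. Rewards are $\sigma^2$-sub-Gaussian with known $\sigma^2$. EPRL. Let $n_h^t(s,a)=\sum_{l=1}^t\mathbf{1}\{s_h^l=s,a_h^l=a\}$, $\hat r_h^t(s,a)=\frac{1}{n_h^t(s,a)}\sum_{l=1}^ty_h^l\mathbf{1}\{s_h^l=s,a_h^l=a\}$ ($0$ if no visit), $b_h^t(s,a)=\sqrt{\beta(n_h^t(s,a),\delta)/n_h^t(s,a)}$ ($+\infty$ if $n_h^t(s,a)=0$), with $\beta(n,\delta)=2\sigma^2\log(4n^2N/\delta)$. For $\pi\in\Pi$ let $\overline V_1^{t,\pi}(s_1)=\sum_{h=1}^H(\hat r_h^t+b_h^t)(s_h^\pi,a_h^\pi)$ and $\underline V_1^{t,\pi}(s_1)=\sum_{h=1}^H(\hat r_h^t-b_h^t)(s_h^\pi,a_h^\pi)$. Initialize $\mathcal{A}_h^0(s)=\mathcal{A}_h(s)$ for $h\in[H],s\in\mathcal{S}_h$. Let $\Pi^t=\{\pi\in\Pi:\forall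 s,h,\ \pi_h(s)\in\mathcal{A}_h^t(s)\text{ or }\mathcal{A}_h^t(s)=\emptyset\}$. In each episode $t\ge1$: (i) play $\pi^t$ given by the sampling rule; (ii) update $n_h^t,\hat r_h^t$; (iii) set $\mathcal{A}_h^t(s)=\mathcal{A}_h^{t-1}(s)\cap\{a\in\mathcal{A}:\max_{\pi\in\Pi_{s,a,h}\cap\Pi^{t-1}}\overline V_1^{t,\pi}(s_1)\ge\max_{\pi\in\Pi}\underline V_1^{t,\pi}(s_1)\}$ (if $\Pi_{s,a,h}\cap\Pi^{t-1}=\emptyset$, the action is eliminated); (iv) if $\max_{\pi\in\Pi^t}2\sum_{h=1}^Hb_h^t(s_h^\pi,a_h^\pi)\le\epsilon$, or $|\mathcal{A}_h^t(s)|\le1$ for all $h\in[H],s\in\mathcal{S}_h$, stop ($\tau=t$) and return some $\widehat\pi\in\arg\max_{\pi\in\Pi^t}\overline V_1^{t,\pi}(s_1)$. The number of episodes $\tau$ is the sample complexity. Minimum flow. A flow is $\eta:\mathcal{E}\to[0,\infty)$ with $\sum_{(s',a'):s'\in\mathcal{S}_{h-1},a'\in\mathcal{A}_{h-1}(s'),f_{h-1}(s',a')=s}\eta_{h-1}(s',a')=\sum_{a\in\mathcal{A}_h(s)}\eta_h(s,a)$ for all $h>1,s\in\mathcal{S}_h$. For $\underline c:\mathcal{E}\to[0,\infty)$, $\varphi^\star(\underline c)$ is the minimum of $\sum_{a\in\mathcal{A}_1(s_1)}\eta_1(s_1,a)$ over flows with $\eta_h(s,a)\ge\underline c_h(s,a)$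 on $\mathcal{E}$. Sampling rules. Let $k_t=\min_{h\in[H],s\in\mathcal{S}_h,a\in\mathcal{A}_h^{t-1}(s)}n_h^{t-1}(s,a)+1$ and $\bar t_k=\inf\{l\in\mathbb{N}:k_l=k\}$. Maximum-coverage: if $t$ is odd, play $\pi^t\in\arg\max_{\pi\in\Pi}\sum_{h=1}^H\mathbf{1}\{a_h^\pi\in\mathcal{A}_h^{\bar t_{k_t}-1}(s_h^\pi),\ n_h^{t-1}(s_h^\pi,a_h^\pi)<k_t\}$; if $t$ is even, play $\pi^t\in\arg\max_{\pi\in\Pi^{t-1}}\sum_{h=1}^Hb_h^{t-1}(s_h^\pi,a_h^\pi)$. Static maximum-coverage: whenever $k_t$ increases (including $t=1$), set $\underline c^{k_t}_h(s,a)=\mathbf{1}\{a\in\mathcal{A}_h^{\bar t_{k_t}-1}(s),n_h^{\bar t_{k_t}-1}(s,a)<k_t\}$, compute an integer-valued minimum flow for $\underline c^{k_t}$ and decompose it into a set $\Pi_{\mathrm{cover}}$ of $\varphi^\star(\underline c^{k_t})$ policies (a minimum policy cover: a set of policies of minimum size such that each $(s,a,h)$ with $\underline c_h^{k_t}(s,a)=1$ is visited by at least one of them); if $t$ is odd, play an arbitrary policy of $\Pi_{\mathrm{cover}}$ and remove it from $\Pi_{\mathrm{cover}}$; if $t$ is even, play $\pi^t\in\arg\max_{\pi\in\Pi^{t-1}}\sum_{h=1}^Hb_h^{t-1}(s_h^\pi,a_h^\pi)$. *)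

theory Defs
  imports "HOL-Probability.Probability"
begin

section \<open>Deterministic MDPs\<close>

record ('s, 'a) det_mdp =
  horizon :: nat
  init :: 's
  avail :: "nat \<Rightarrow> 's \<Rightarrow> 'a set"
  step :: "nat \<Rightarrow> 's \<Rightarrow> 'a \<Rightarrow> 's"
  reward :: "nat \<Rightarrow> 's \<Rightarrow> 'a \<Rightarrow> real measure"

type_synonym ('s, 'a) policy = "nat \<Rightarrow> 's \<Rightarrow> 'a"

definition stages :: "('s, 'a) det_mdp \<Rightarrow> nat set" where
  "stages M = {1..horizon M}"

text \<open>A policy is only meaningful on the stages, so it is fixed to \<open>undefined\<close> elsewhere;
  over finite state and action types this makes the set of policies finite.\<close>

definition policies :: "('s, 'a) det_mdp \<Rightarrow> ('s, 'a) policy set" where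
  "policies M = (\<Pi>\<^sub>E h\<in>stages M. {d. \<forall>s. d s \<in> avail M h s})"

text \<open>Stages are counted from 1; the value at stage 0 is a dummy.\<close>

fun state_at :: "('s, 'a) det_mdp \<Rightarrow> ('s, 'a) policy \<Rightarrow> nat \<Rightarrow> 's" where
  "state_at M \<pi> 0 = init M"
| "state_at M \<pi> (Suc 0) = init M"
| "state_at M \<pi> (Suc (Suc h)) =
     step M (Suc h) (state_at M \<pi> (Suc h)) (\<pi> (Suc h) (state_at M \<pi> (Suc h)))"

definition action_at :: "('s, 'a) det_mdp \<Rightarrow> ('s, 'a) policy \<Rightarrow> nat \<Rightarrow> 'a" where
  "action_at M \<pi> h = \<pi> h (state_at M \<pi> h)"

definition reachable :: "('s, 'a) det_mdp \<Rightarrow> nat \<Rightarrow> 's set" where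
  "reachable M h = {s. \<exists>\<pi>\<in>policies M. state_at M \<pi> h = s}"

definition triples :: "('s, 'a) det_mdp \<Rightarrow> ('s \<times> 'a \<times> nat) set" where
  "triples M = {(s, a, h). h \<in> stages M \<and> s \<in> reachable M h \<and> a \<in> avail M h s}"

definition num_triples :: "('s, 'a) det_mdp \<Rightarrow> nat" where
  "num_triples M = card (triples M)"

definition policies_through ::
    "('s, 'a) det_mdp \<Rightarrow> 's \<Rightarrow> 'a \<Rightarrow> nat \<Rightarrow> ('s, 'a) policy set" where
  "policies_through M s a h = {\<pi> \<in> policies M. state_at M \<pi> h = s \<and> action_at M \<pi> h = a}"

definition wf_det_mdp :: "('s, 'a) det_mdp \<Rightarrow> bool" where
  "wf_det_mdp M \<longleftrightarrow> horizon M \<ge> 1 \<and> policies M \<noteq> {} \<and>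
     (\<forall>(s, a, h)\<in>triples M. prob_space (reward M h s a) \<and> sets (reward M h s a) = sets borel)"

definition mean_reward :: "('s, 'a) det_mdp \<Rightarrow> nat \<Rightarrow> 's \<Rightarrow> 'a \<Rightarrow> real" where
  "mean_reward M h s a = (\<integral>x. x \<partial>reward M h s a)"

text \<open>Integrability is explicit because the Bochner integral of a non-integrable function is 0.\<close>

definition sub_gaussian :: "real \<Rightarrow> real measure \<Rightarrow> bool" where
  "sub_gaussian \<sigma> D \<longleftrightarrow> integrable D (\<lambda>x. x) \<and>
     (\<forall>l. integrable D (\<lambda>x. exp (l * (x - (\<integral>z. z \<partial>D)))) \<and>
          (\<integral>x. exp (l * (x - (\<integral>z. z \<partial>D))) \<partial>D) \<le> exp (l\<^sup>2 * \<sigma>\<^sup>2 / 2))"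

definition sub_gaussian_rewards :: "('s, 'a) det_mdp \<Rightarrow> real \<Rightarrow> bool" where
  "sub_gaussian_rewards M \<sigma> \<longleftrightarrow> (\<forall>(s, a, h)\<in>triples M. sub_gaussian \<sigma> (reward M h s a))"

definition policy_value :: "('s, 'a) det_mdp \<Rightarrow> ('s, 'a) policy \<Rightarrow> real" where
  "policy_value M \<pi> = (\<Sum>h\<in>stages M. mean_reward M h (state_at M \<pi> h) (action_at M \<pi> h))"

definition opt_value :: "('s, 'a) det_mdp \<Rightarrow> real" where
  "opt_value M = Max (policy_value M ` policies M)"

definition return_gap :: "('s, 'a) det_mdp \<Rightarrow> nat \<Rightarrow> 's \<Rightarrow> 'a \<Rightarrow> real" where
  "return_gap M h s a = opt_value M - Max (policy_value M ` policies_through M s a h)"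

definition unique_opt_trajectory :: "('s, 'a) det_mdp \<Rightarrow> bool" where
  "unique_opt_trajectory M \<longleftrightarrow>
     (\<forall>\<pi>\<in>policies M. \<forall>\<pi>'\<in>policies M.
        policy_value M \<pi> = opt_value M \<longrightarrow> policy_value M \<pi>' = opt_value M \<longrightarrow>
        (\<forall>h\<in>stages M. state_at M \<pi> h = state_at M \<pi>' h \<and> action_at M \<pi> h = action_at M \<pi>' h))"

definition positive_gaps :: "('s, 'a) det_mdp \<Rightarrow> real set" where
  "positive_gaps M =
     {return_gap M h s a | s a h. (s, a, h) \<in> triples M \<and> return_gap M h s a > 0}"

definition min_gap :: "('s, 'a) det_mdp \<Rightarrow> real" where
  "min_gap M =
     (if unique_opt_trajectory M \<and> positive_gaps M \<noteq> {} then Min (positive_gaps M) else 0)"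

section \<open>Minimum flows\<close>

definition is_flow :: "('s, 'a) det_mdp \<Rightarrow> (nat \<Rightarrow> 's \<Rightarrow> 'a \<Rightarrow> real) \<Rightarrow> bool" where
  "is_flow M \<eta> \<longleftrightarrow>
     (\<forall>(s, a, h)\<in>triples M. 0 \<le> \<eta> h s a) \<and>
     (\<forall>h\<in>stages M. 1 < h \<longrightarrow> (\<forall>s\<in>reachable M h.
        (\<Sum>(s', a') \<in> {(s', a'). s' \<in> reachable M (h - 1) \<and> a' \<in> avail M (h - 1) s' \<and>
                           step M (h - 1) s' a' = s}. \<eta> (h - 1) s' a')
        = (\<Sum>a\<in>avail M h s. \<eta> h s a)))"

definition flow_value :: "('s, 'a) det_mdp \<Rightarrow> (nat \<Rightarrow> 's \<Rightarrow> 'a \<Rightarrow> real) \<Rightarrow> real" where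
  "flow_value M \<eta> = (\<Sum>a\<in>avail M 1 (init M). \<eta> 1 (init M) a)"

definition feasible_flow ::
    "('s, 'a) det_mdp \<Rightarrow> (nat \<Rightarrow> 's \<Rightarrow> 'a \<Rightarrow> real) \<Rightarrow> (nat \<Rightarrow> 's \<Rightarrow> 'a \<Rightarrow> real) \<Rightarrow> bool" where
  "feasible_flow M c \<eta> \<longleftrightarrow> is_flow M \<eta> \<and> (\<forall>(s, a, h)\<in>triples M. c h s a \<le> \<eta> h s a)"

text \<open>The infimum of this bounded, feasible linear program is attained, so it is the minimum.\<close>

definition min_flow_value :: "('s, 'a) det_mdp \<Rightarrow> (nat \<Rightarrow> 's \<Rightarrow> 'a \<Rightarrow> real) \<Rightarrow> real" where
  "min_flow_value M c = Inf {flow_value M \<eta> | \<eta>. feasible_flow M c \<eta>}"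

definition integer_min_flow ::
    "('s, 'a) det_mdp \<Rightarrow> (nat \<Rightarrow> 's \<Rightarrow> 'a \<Rightarrow> real) \<Rightarrow> (nat \<Rightarrow> 's \<Rightarrow> 'a \<Rightarrow> real) \<Rightarrow> bool" where
  "integer_min_flow M c \<eta> \<longleftrightarrow> feasible_flow M c \<eta> \<and> flow_value M \<eta> = min_flow_value M c \<and>
     (\<forall>(s, a, h)\<in>triples M. \<eta> h s a \<in> \<int>)"

text \<open>A set of policies decomposes a flow if the flow through each triple is the number of
  policies of the set that visit it.\<close>

definition min_policy_cover ::
    "('s, 'a) det_mdp \<Rightarrow> (nat \<Rightarrow> 's \<Rightarrow> 'a \<Rightarrow> real) \<Rightarrow> ('s, 'a) policy set \<Rightarrow> bool" where
  "min_policy_cover M c X \<longleftrightarrow>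
     X \<subseteq> policies M \<and> real (card X) = min_flow_value M c \<and>
     (\<exists>\<eta>. integer_min_flow M c \<eta> \<and>
        (\<forall>(s, a, h)\<in>triples M. \<eta> h s a = real (card (X \<inter> policies_through M s a h))))"

section \<open>Learning protocol\<close>

text \<open>\<open>F t\<close> is the information available after episode \<open>t\<close> (all past observations and possibly
  internal randomization of the learner), \<open>pol t\<close> the policy of episode \<open>t\<close> and \<open>y t h\<close> the reward
  observed at its stage \<open>h\<close>. Given the past and the chosen policy, the rewards of an episode are
  independent and distributed according to the reward distributions along its trajectory.
  The protocol runs for all episodes; a stopping rule only looks at an initial segment.\<close>

definition interaction ::
    "('s, 'a) det_mdp \<Rightarrow> 'w measure \<Rightarrow> (nat \<Rightarrow> 'w measure) \<Rightarrow>
     (nat \<Rightarrow> 'w \<Rightarrow> ('s, 'a) policy) \<Rightarrow> (nat \<Rightarrow> nat \<Rightarrow> 'w \<Rightarrow> real) \<Rightarrow> bool" where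
  "interaction M P F pol y \<longleftrightarrow>
     prob_space P \<and> filtration (space P) F \<and> (\<forall>t. sets (F t) \<subseteq> sets P) \<and>
     (\<forall>t\<ge>1. pol t \<in> measurable (F (t - 1)) (count_space (policies M))) \<and>
     (\<forall>t\<ge>1. \<forall>h\<in>stages M. y t h \<in> borel_measurable (F t)) \<and>
     (\<forall>t\<ge>1. \<forall>G\<in>sets (F (t - 1)). \<forall>\<pi>\<in>policies M. \<forall>B. (\<forall>h\<in>stages M. B h \<in> sets borel) \<longrightarrow>
        measure P {\<omega> \<in> G. pol t \<omega> = \<pi> \<and> (\<forall>h\<in>stages M. y t h \<omega> \<in> B h)} =
        measure P {\<omega> \<in> G. pol t \<omega> = \<pi>} *
        (\<Prod>h\<in>stages M. measure (reward M h (state_at M \<pi> h) (action_at M \<pi> h)) (B h)))"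

section \<open>EPRL\<close>

text \<open>The quantities below belong to a single sample path: \<open>p l\<close> is the policy played in episode
  \<open>l \<ge> 1\<close> and \<open>y l h\<close> the reward observed in it at stage \<open>h\<close>.\<close>

definition visit_episodes ::
    "('s, 'a) det_mdp \<Rightarrow> (nat \<Rightarrow> ('s, 'a) policy) \<Rightarrow> nat \<Rightarrow> nat \<Rightarrow> 's \<Rightarrow> 'a \<Rightarrow> nat set" where
  "visit_episodes M p t h s a =
     {l \<in> {1..t}. state_at M (p l) h = s \<and> action_at M (p l) h = a}"

definition visits ::
    "('s, 'a) det_mdp \<Rightarrow> (nat \<Rightarrow> ('s, 'a) policy) \<Rightarrow> nat \<Rightarrow> nat \<Rightarrow> 's \<Rightarrow> 'a \<Rightarrow> nat" where
  "visits M p t h s a = card (visit_episodes M p t h s a)"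

text \<open>This is 0 without visits, because division by 0 yields 0.\<close>

definition est_reward ::
    "('s, 'a) det_mdp \<Rightarrow> (nat \<Rightarrow> ('s, 'a) policy) \<Rightarrow> (nat \<Rightarrow> nat \<Rightarrow> real) \<Rightarrow>
     nat \<Rightarrow> nat \<Rightarrow> 's \<Rightarrow> 'a \<Rightarrow> real" where
  "est_reward M p y t h s a = (\<Sum>l\<in>visit_episodes M p t h s a. y l h) / real (visits M p t h s a)"

definition threshold :: "('s, 'a) det_mdp \<Rightarrow> real \<Rightarrow> real \<Rightarrow> nat \<Rightarrow> real" where
  "threshold M \<sigma> \<delta> n = 2 * \<sigma>\<^sup>2 * ln (4 * (real n)\<^sup>2 * real (num_triples M) / \<delta>)"

definition bonus ::
    "('s, 'a) det_mdp \<Rightarrow> real \<Rightarrow> real \<Rightarrow> (nat \<Rightarrow> ('s, 'a) policy) \<Rightarrow>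
     nat \<Rightarrow> nat \<Rightarrow> 's \<Rightarrow> 'a \<Rightarrow> ereal" where
  "bonus M \<sigma> \<delta> p t h s a =
     (let n = visits M p t h s a
      in if n = 0 then \<infinity> else ereal (sqrt (threshold M \<sigma> \<delta> n / real n)))"

definition bonus_sum ::
    "('s, 'a) det_mdp \<Rightarrow> real \<Rightarrow> real \<Rightarrow> (nat \<Rightarrow> ('s, 'a) policy) \<Rightarrow>
     nat \<Rightarrow> ('s, 'a) policy \<Rightarrow> ereal" where
  "bonus_sum M \<sigma> \<delta> p t \<pi> =
     (\<Sum>h\<in>stages M. bonus M \<sigma> \<delta> p t h (state_at M \<pi> h) (action_at M \<pi> h))"

definition upper_value ::
    "('s, 'a) det_mdp \<Rightarrow> real \<Rightarrow> real \<Rightarrow> (nat \<Rightarrow> ('s, 'a) policy) \<Rightarrow> (nat \<Rightarrow> nat \<Rightarrow> real) \<Rightarrow>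
     nat \<Rightarrow> ('s, 'a) policy \<Rightarrow> ereal" where
  "upper_value M \<sigma> \<delta> p y t \<pi> =
     (\<Sum>h\<in>stages M. ereal (est_reward M p y t h (state_at M \<pi> h) (action_at M \<pi> h))
                    + bonus M \<sigma> \<delta> p t h (state_at M \<pi> h) (action_at M \<pi> h))"

definition lower_value ::
    "('s, 'a) det_mdp \<Rightarrow> real \<Rightarrow> real \<Rightarrow> (nat \<Rightarrow> ('s, 'a) policy) \<Rightarrow> (nat \<Rightarrow> nat \<Rightarrow> real) \<Rightarrow>
     nat \<Rightarrow> ('s, 'a) policy \<Rightarrow> ereal" where
  "lower_value M \<sigma> \<delta> p y t \<pi> =
     (\<Sum>h\<in>stages M. ereal (est_reward M p y t h (state_at M \<pi> h) (action_at M \<pi> h))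
                    - bonus M \<sigma> \<delta> p t h (state_at M \<pi> h) (action_at M \<pi> h))"

definition compatible_policies ::
    "('s, 'a) det_mdp \<Rightarrow> (nat \<Rightarrow> 's \<Rightarrow> 'a set) \<Rightarrow> ('s, 'a) policy set" where
  "compatible_policies M Act =
     {\<pi> \<in> policies M. \<forall>h\<in>stages M. \<forall>s. \<pi> h s \<in> Act h s \<or> Act h s = {}}"

primrec active ::
    "('s, 'a) det_mdp \<Rightarrow> real \<Rightarrow> real \<Rightarrow> (nat \<Rightarrow> ('s, 'a) policy) \<Rightarrow> (nat \<Rightarrow> nat \<Rightarrow> real) \<Rightarrow>
     nat \<Rightarrow> nat \<Rightarrow> 's \<Rightarrow> 'a set" where
  "active M \<sigma> \<delta> p y 0 = (\<lambda>h s. if s \<in> reachable M h then avail M h s else {})"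
| "active M \<sigma> \<delta> p y (Suc t) = (\<lambda>h s.
     {a \<in> active M \<sigma> \<delta> p y t h s.
        (let X = policies_through M s a h \<inter> compatible_policies M (active M \<sigma> \<delta> p y t)
         in X \<noteq> {} \<and>
            Max (upper_value M \<sigma> \<delta> p y (Suc t) ` X)
              \<ge> Max (lower_value M \<sigma> \<delta> p y (Suc t) ` policies M))})"

definition remaining_policies ::
    "('s, 'a) det_mdp \<Rightarrow> real \<Rightarrow> real \<Rightarrow> (nat \<Rightarrow> ('s, 'a) policy) \<Rightarrow> (nat \<Rightarrow> nat \<Rightarrow> real) \<Rightarrow>
     nat \<Rightarrow> ('s, 'a) policy set" where
  "remaining_policies M \<sigma> \<delta> p y t = compatible_policies M (active M \<sigma> \<delta> p y t)"

definition stop_cond ::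
    "('s, 'a) det_mdp \<Rightarrow> real \<Rightarrow> real \<Rightarrow> real \<Rightarrow> (nat \<Rightarrow> ('s, 'a) policy) \<Rightarrow>
     (nat \<Rightarrow> nat \<Rightarrow> real) \<Rightarrow> nat \<Rightarrow> bool" where
  "stop_cond M \<sigma> \<epsilon> \<delta> p y t \<longleftrightarrow>
     Max ((\<lambda>\<pi>. 2 * bonus_sum M \<sigma> \<delta> p t \<pi>) ` remaining_policies M \<sigma> \<delta> p y t) \<le> ereal \<epsilon> \<or>
     (\<forall>h\<in>stages M. \<forall>s\<in>reachable M h. card (active M \<sigma> \<delta> p y t h s) \<le> 1)"

text \<open>The value is \<open>\<infinity>\<close> if the algorithm never stops.\<close>

definition sample_complexity ::
    "('s, 'a) det_mdp \<Rightarrow> real \<Rightarrow> real \<Rightarrow> real \<Rightarrow> (nat \<Rightarrow> ('s, 'a) policy) \<Rightarrow>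
     (nat \<Rightarrow> nat \<Rightarrow> real) \<Rightarrow> enat" where
  "sample_complexity M \<sigma> \<epsilon> \<delta> p y = (INF t\<in>{t. 1 \<le> t \<and> stop_cond M \<sigma> \<epsilon> \<delta> p y t}. enat t)"

section \<open>Sampling rules\<close>

definition level ::
    "('s, 'a) det_mdp \<Rightarrow> real \<Rightarrow> real \<Rightarrow> (nat \<Rightarrow> ('s, 'a) policy) \<Rightarrow> (nat \<Rightarrow> nat \<Rightarrow> real) \<Rightarrow>
     nat \<Rightarrow> nat" where
  "level M \<sigma> \<delta> p y t =
     Min {visits M p (t - 1) h s a | h s a.
            h \<in> stages M \<and> s \<in> reachable M h \<and> a \<in> active M \<sigma> \<delta> p y (t - 1) h s} + 1"

definition level_start ::
    "('s, 'a) det_mdp \<Rightarrow> real \<Rightarrow> real \<Rightarrow> (nat \<Rightarrow> ('s, 'a) policy) \<Rightarrow> (nat \<Rightarrow> nat \<Rightarrow> real) \<Rightarrow>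
     nat \<Rightarrow> nat" where
  "level_start M \<sigma> \<delta> p y k = Inf {l. 1 \<le> l \<and> level M \<sigma> \<delta> p y l = k}"

definition max_bonus_choice ::
    "('s, 'a) det_mdp \<Rightarrow> real \<Rightarrow> real \<Rightarrow> (nat \<Rightarrow> ('s, 'a) policy) \<Rightarrow> (nat \<Rightarrow> nat \<Rightarrow> real) \<Rightarrow>
     nat \<Rightarrow> bool" where
  "max_bonus_choice M \<sigma> \<delta> p y t \<longleftrightarrow>
     is_arg_max (bonus_sum M \<sigma> \<delta> p (t - 1)) (\<lambda>\<pi>. \<pi> \<in> remaining_policies M \<sigma> \<delta> p y (t - 1)) (p t)"

text \<open>Both sampling rules constrain the played policies only up to the episode in which
  the algorithm stops. Ties and choices left open by a rule are resolved arbitrarily.\<close>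

definition max_coverage ::
    "('s, 'a) det_mdp \<Rightarrow> real \<Rightarrow> real \<Rightarrow> real \<Rightarrow> (nat \<Rightarrow> ('s, 'a) policy) \<Rightarrow>
     (nat \<Rightarrow> nat \<Rightarrow> real) \<Rightarrow> bool" where
  "max_coverage M \<sigma> \<epsilon> \<delta> p y \<longleftrightarrow>
     (\<forall>t\<ge>1. enat t \<le> sample_complexity M \<sigma> \<epsilon> \<delta> p y \<longrightarrow>
        (let k = level M \<sigma> \<delta> p y t; t0 = level_start M \<sigma> \<delta> p y k in
         (odd t \<longrightarrow>
            is_arg_max
              (\<lambda>\<pi>. \<Sum>h\<in>stages M. (of_bool
                 (action_at M \<pi> h \<in> active M \<sigma> \<delta> p y (t0 - 1) h (state_at M \<pi> h) \<and>
                  visits M p (t - 1) h (state_at M \<pi> h) (action_at M \<pi> h) < k) :: nat))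
              (\<lambda>\<pi>. \<pi> \<in> policies M) (p t)) \<and>
         (even t \<longrightarrow> max_bonus_choice M \<sigma> \<delta> p y t)))"

definition cover_demand ::
    "('s, 'a) det_mdp \<Rightarrow> real \<Rightarrow> real \<Rightarrow> (nat \<Rightarrow> ('s, 'a) policy) \<Rightarrow> (nat \<Rightarrow> nat \<Rightarrow> real) \<Rightarrow>
     nat \<Rightarrow> nat \<Rightarrow> 's \<Rightarrow> 'a \<Rightarrow> real" where
  "cover_demand M \<sigma> \<delta> p y k h s a =
     (let t0 = level_start M \<sigma> \<delta> p y k in
      of_bool (a \<in> active M \<sigma> \<delta> p y (t0 - 1) h s \<and> visits M p (t0 - 1) h s a < k))"

text \<open>\<open>cover t\<close> is the set of cover policies from which episode \<open>t\<close> may choose, that is, after a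
  possible recomputation at the beginning of episode \<open>t\<close>.\<close>

definition static_max_coverage ::
    "('s, 'a) det_mdp \<Rightarrow> real \<Rightarrow> real \<Rightarrow> real \<Rightarrow> (nat \<Rightarrow> ('s, 'a) policy) \<Rightarrow>
     (nat \<Rightarrow> nat \<Rightarrow> real) \<Rightarrow> bool" where
  "static_max_coverage M \<sigma> \<epsilon> \<delta> p y \<longleftrightarrow>
     (\<exists>cover :: nat \<Rightarrow> ('s, 'a) policy set.
        \<forall>t\<ge>1. enat t \<le> sample_complexity M \<sigma> \<epsilon> \<delta> p y \<longrightarrow>
          (if t = 1 \<or> level M \<sigma> \<delta> p y t > level M \<sigma> \<delta> p y (t - 1)
           then min_policy_cover M (cover_demand M \<sigma> \<delta> p y (level M \<sigma> \<delta> p y t)) (cover t)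
           else cover t = (if odd (t - 1) then cover (t - 1) - {p (t - 1)} else cover (t - 1))) \<and>
          (odd t \<longrightarrow> p t \<in> cover t) \<and>
          (even t \<longrightarrow> max_bonus_choice M \<sigma> \<delta> p y t))"

section \<open>The lower bound function\<close>

definition eff_gap :: "('s, 'a) det_mdp \<Rightarrow> real \<Rightarrow> nat \<Rightarrow> 's \<Rightarrow> 'a \<Rightarrow> real" where
  "eff_gap M \<epsilon> h s a = max (return_gap M h s a) (max (min_gap M) \<epsilon>)"

definition log_term ::
    "('s, 'a) det_mdp \<Rightarrow> real \<Rightarrow> real \<Rightarrow> real \<Rightarrow> nat \<Rightarrow> 's \<Rightarrow> 'a \<Rightarrow> real" where
  "log_term M \<sigma> \<epsilon> \<delta> h s a =
     8 * ln (16 * \<sigma> * real (horizon M) * ln (4 * real (num_triples M) ^ 3 / \<delta>)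
               / eff_gap M \<epsilon> h s a)"

definition lower_bound_fun ::
    "('s, 'a) det_mdp \<Rightarrow> real \<Rightarrow> real \<Rightarrow> real \<Rightarrow> nat \<Rightarrow> 's \<Rightarrow> 'a \<Rightarrow> real" where
  "lower_bound_fun M \<sigma> \<epsilon> \<delta> h s a =
     32 * \<sigma>\<^sup>2 * (real (horizon M))\<^sup>2 / (eff_gap M \<epsilon> h s a)\<^sup>2
       * (ln (4 * real (num_triples M) ^ 3 / \<delta>) + log_term M \<sigma> \<epsilon> \<delta> h s a) + 2"

end

theory Submission
  imports Defs
begin

text \<open>All confidence intervals hold simultaneously with probability at least \<open>1 - \<delta>\<close>: over the first
  \<open>n\<close> visits of a triple the exponential of the centred rewards is a supermartingale, and a union
  bound runs over \<open>n\<close> and the triples. On this event an optimal trajectory is never eliminated and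
  the policy that keeps a triple active keeps its whole trajectory active. Hence, as long as the
  algorithm runs, \<open>k - 1\<close> visits of every active triple bound the effective gap of each active
  triple by \<open>4 H\<close> times the bonus after \<open>k - 1\<close> visits, so that level \<open>k\<close> only demands triples with
  \<open>k \<le> g\<close>, and scaling a flow for \<open>g\<close> by \<open>1 / k\<close> covers its demand. The odd episodes of level \<open>k\<close> are
  thus at most \<open>C \<phi>(g) / k\<close>, where \<open>C\<close> is the loss of the greedy cover, and summing over \<open>k\<close> gives
  the logarithm.

  The worst-case bound holds on every sample path. In an even episode the bonuses along the played
  trajectory exceed \<open>\<epsilon> / 2\<close> in total, while by Cauchy-Schwarz the sum of all bonuses over \<open>n\<close>
  even episodes grows only like the square root of \<open>n\<close>, up to a logarithm.\<close>

section \<open>Trajectories\<close>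

text \<open>Each of the three parts of the effective gap is tied to one reason why the algorithm
  still runs. The return gap is controlled by comparing the witness of an active triple with an
  optimal policy: at each stage and for each of the two policies, the estimate and the bonus cost
  one radius each, whence the factor 4 H. The accuracy \<epsilon> enters through the failed width
  test, the minimum gap through the failed cardinality test, which exhibits two active actions at
  one state.

  Squaring the gap bound leaves the visit count on both sides, once inside a logarithm;
  \<open>log_term\<close> is the price of solving this implicit inequality.

  The greedy rule is compared with fractional flows and not with an optimal cover. Its prices,
  divided by a harmonic number, satisfy the dual constraint on every trajectory; since a trajectory
  has only H triples, the loss is at most ln H + 1 and does not grow with the number of triples.

  The algorithm is analysed on one fixed sample path; probability enters only through the event on
  which all intervals hold and the measurability of the sample complexity.\<close>

definition trajectory :: "('s, 'a) det_mdp \<Rightarrow> ('s, 'a) policy \<Rightarrow> ('s \<times> 'a \<times> nat) set" where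
  "trajectory M \<pi> = (\<lambda>h. (state_at M \<pi> h, action_at M \<pi> h, h)) ` stages M"

definition layer :: "('s, 'a) det_mdp \<Rightarrow> nat \<Rightarrow> ('s \<times> 'a) set" where
  "layer M h = {(s, a). s \<in> reachable M h \<and> a \<in> avail M h s}"

lemma finite_stages [simp]: "finite (stages M)"
  by (simp add: stages_def)

lemma finite_policies [simp]: "finite (policies (M :: ('s::finite, 'a::finite) det_mdp))"
  unfolding policies_def by (rule finite_PiE) auto

lemma finite_triples [simp]: "finite (triples (M :: ('s::finite, 'a::finite) det_mdp))"
proof (rule finite_subset)
  show "triples M \<subseteq> UNIV \<times> UNIV \<times> stages M" by (auto simp: triples_def)
qed auto

lemma finite_policies_through [simp]:
  "finite (policies_through (M :: ('s::finite, 'a::finite) det_mdp) s a h)"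
  by (rule finite_subset[OF _ finite_policies]) (auto simp: policies_through_def)

lemma finite_trajectory [simp]: "finite (trajectory M \<pi>)"
  by (simp add: trajectory_def)

lemma sum_trajectory:
  "(\<Sum>e\<in>trajectory M \<pi>. f e) = (\<Sum>h\<in>stages M. f (state_at M \<pi> h, action_at M \<pi> h, h))"
  unfolding trajectory_def by (subst sum.reindex) (auto simp: inj_on_def)

lemma card_trajectory: "card (trajectory M \<pi>) = horizon M"
proof -
  have "card (trajectory M \<pi>) = card (stages M)"
    unfolding trajectory_def by (rule card_image) (auto simp: inj_on_def)
  thus ?thesis by (simp add: stages_def)
qed

lemma mem_trajectory:
  "(s, a, h) \<in> trajectory M \<pi> \<longleftrightarrow> h \<in> stages M \<and> state_at M \<pi> h = s \<and> action_at M \<pi> h = a"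
  by (auto simp: trajectory_def)

lemma trajectory_eqD:
  assumes "trajectory M \<pi>' = trajectory M \<pi>" "h \<in> stages M"
  shows "state_at M \<pi>' h = state_at M \<pi> h" "action_at M \<pi>' h = action_at M \<pi> h"
proof -
  have "(state_at M \<pi> h, action_at M \<pi> h, h) \<in> trajectory M \<pi>'"
    using assms by (simp add: mem_trajectory)
  thus "state_at M \<pi>' h = state_at M \<pi> h" "action_at M \<pi>' h = action_at M \<pi> h"
    by (auto simp: mem_trajectory)
qed

lemma policy_avail: "\<pi> \<in> policies M \<Longrightarrow> h \<in> stages M \<Longrightarrow> \<pi> h s \<in> avail M h s"
  by (auto simp: policies_def)

lemma trajectory_subset_triples: "\<pi> \<in> policies M \<Longrightarrow> trajectory M \<pi> \<subseteq> triples M"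
  by (auto simp: trajectory_def triples_def reachable_def action_at_def policy_avail)

lemma policies_through_eq:
  "h \<in> stages M \<Longrightarrow> policies_through M s a h = {\<pi> \<in> policies M. (s, a, h) \<in> trajectory M \<pi>}"
  by (auto simp: policies_through_def mem_trajectory)

lemma state_at_Suc:
  "1 \<le> h \<Longrightarrow> state_at M \<pi> (Suc h) = step M h (state_at M \<pi> h) (action_at M \<pi> h)"
  by (cases h) (auto simp: action_at_def)

lemma state_at_cong:
  assumes "\<And>h'. 1 \<le> h' \<Longrightarrow> h' < h \<Longrightarrow> \<pi> h' (state_at M \<pi> h') = \<pi>' h' (state_at M \<pi> h')"
  shows "state_at M \<pi>' h = state_at M \<pi> h"
  using assms
proof (induction h)
  case (Suc h)
  show ?case
  proof (cases "h = 0")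
    case False
    have "state_at M \<pi>' h = state_at M \<pi> h" using Suc by auto
    thus ?thesis using False Suc.prems[of h] by (simp add: state_at_Suc action_at_def)
  qed simp
qed simp

text \<open>One table entry is overwritten, at stage \<open>h\<close> and the state reached there,
  so the path up to \<open>h\<close> is untouched while nothing is claimed about later stages. This
  exchange puts every triple on some trajectory and drives the dynamic programming on flows.\<close>

lemma deviate:
  assumes "\<pi> \<in> policies M" "h \<in> stages M" "a \<in> avail M h (state_at M \<pi> h)"
  obtains \<pi>' where "\<pi>' \<in> policies M" "\<And>h'. h' \<le> h \<Longrightarrow> state_at M \<pi>' h' = state_at M \<pi> h'"
    "\<And>h'. h' < h \<Longrightarrow> h' \<in> stages M \<Longrightarrow> action_at M \<pi>' h' = action_at M \<pi> h'"
    "action_at M \<pi>' h = a"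
proof -
  define \<pi>' where "\<pi>' = \<pi>(h := (\<pi> h)(state_at M \<pi> h := a))"
  have mem: "\<pi>' \<in> policies M"
    using assms unfolding policies_def \<pi>'_def by (auto simp: PiE_def Pi_def extensional_def)
  have st: "state_at M \<pi>' h' = state_at M \<pi> h'" if "h' \<le> h" for h'
    by (rule state_at_cong) (use that in \<open>auto simp: \<pi>'_def\<close>)
  show ?thesis
    by (rule that[OF mem]) (use st in \<open>auto simp: action_at_def \<pi>'_def\<close>)
qed

lemma policies_through_nonempty:
  assumes "(s, a, h) \<in> triples M" shows "policies_through M s a h \<noteq> {}"
proof -
  obtain \<pi> where p: "\<pi> \<in> policies M" "state_at M \<pi> h = s"
    and h: "h \<in> stages M" "a \<in> avail M h (state_at M \<pi> h)"
    using assms by (auto simp: triples_def reachable_def)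
  obtain \<pi>' where "\<pi>' \<in> policies M" "state_at M \<pi>' h = state_at M \<pi> h" "action_at M \<pi>' h = a"
    using deviate[OF p(1) h] by (metis order_refl)
  hence "\<pi>' \<in> policies_through M s a h" using p by (simp add: policies_through_def)
  thus ?thesis by blast
qed

text \<open>Wherever the given action has been eliminated it is exchanged for an arbitrary surviving
  one. Agreement on the surviving entries lets a policy whose own trajectory is active enter the
  remaining set without changing that trajectory.\<close>

lemma compatible_policy_exists:
  assumes "\<pi> \<in> policies M" "\<And>h s. h \<in> stages M \<Longrightarrow> Act h s \<subseteq> avail M h s"
  obtains \<pi>' where "\<pi>' \<in> compatible_policies M Act"
    "\<And>h s. h \<in> stages M \<Longrightarrow> \<pi> h s \<in> Act h s \<Longrightarrow> \<pi>' h s = \<pi> h s"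
proof -
  define \<pi>' where "\<pi>' = (\<lambda>h. if h \<in> stages M then (\<lambda>s. if \<pi> h s \<in> Act h s \<or> Act h s = {} then \<pi> h s
     else SOME a. a \<in> Act h s) else \<pi> h)"
  have some: "(SOME a. a \<in> Act h s) \<in> Act h s" if "Act h s \<noteq> {}" for h s
    using that by (simp add: some_in_eq)
  have "\<pi>' h s \<in> avail M h s" if "h \<in> stages M" for h s
    using that policy_avail[OF assms(1) that] some[of h s] assms(2)[OF that, of s] by (auto simp: \<pi>'_def)
  moreover have "\<pi>' h = undefined" if "h \<notin> stages M" for h
    using that assms(1) by (auto simp: \<pi>'_def policies_def PiE_def extensional_def)
  ultimately have "\<pi>' \<in> policies M"
    unfolding policies_def by (intro PiE_I) auto
  moreover have "\<forall>h\<in>stages M. \<forall>s. \<pi>' h s \<in> Act h s \<or> Act h s = {}"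
    using some by (auto simp: \<pi>'_def)
  ultimately have "\<pi>' \<in> compatible_policies M Act" by (simp add: compatible_policies_def)
  thus ?thesis by (rule that) (simp add: \<pi>'_def)
qed

lemma trajectory_cong:
  assumes "\<And>h. h \<in> stages M \<Longrightarrow> \<pi>' h (state_at M \<pi> h) = \<pi> h (state_at M \<pi> h)"
  shows "trajectory M \<pi>' = trajectory M \<pi>"
proof -
  have st: "state_at M \<pi>' h = state_at M \<pi> h" if "h \<in> stages M" for h
    by (rule state_at_cong) (use that assms in \<open>auto simp: stages_def\<close>)
  show ?thesis
    unfolding trajectory_def by (rule image_cong) (use st assms in \<open>auto simp: action_at_def\<close>)
qed

section \<open>Visit counts and the number of triples\<close>

lemma visit_episodes_eq:
  "h \<in> stages M \<Longrightarrow> visit_episodes M p t h s a = {l \<in> {1..t}. (s, a, h) \<in> trajectory M (p l)}"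
  by (simp add: visit_episodes_def mem_trajectory)

lemma visits_Suc:
  assumes "h \<in> stages M"
  shows "visits M p (Suc t) h s a = visits M p t h s a + of_bool ((s, a, h) \<in> trajectory M (p (Suc t)))"
proof -
  have "visit_episodes M p (Suc t) h s a = (if (s, a, h) \<in> trajectory M (p (Suc t))
     then insert (Suc t) (visit_episodes M p t h s a) else visit_episodes M p t h s a)"
    using assms by (auto simp: visit_episodes_eq le_Suc_eq)
  moreover have "Suc t \<notin> visit_episodes M p t h s a" "finite (visit_episodes M p t h s a)"
    by (auto simp: visit_episodes_def)
  ultimately show ?thesis by (simp add: visits_def)
qed

lemma visits_mono: "t \<le> t' \<Longrightarrow> visits M p t h s a \<le> visits M p t' h s a"
  unfolding visits_def by (rule card_mono) (auto simp: visit_episodes_def)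

lemma visits_le: "visits M p t h s a \<le> t"
proof -
  have "card (visit_episodes M p t h s a) \<le> card {1..t}"
    by (rule card_mono) (auto simp: visit_episodes_def)
  thus ?thesis by (simp add: visits_def)
qed

lemma sum_triples:
  fixes M :: "('s::finite, 'a::finite) det_mdp"
  shows "(\<Sum>(s, a, h)\<in>triples M. f s a h) = (\<Sum>h\<in>stages M. \<Sum>(s, a)\<in>layer M h. f s a h)"
proof -
  have "(\<Sum>h\<in>stages M. \<Sum>(s, a)\<in>layer M h. f s a h)
      = (\<Sum>(h, s, a)\<in>Sigma (stages M) (layer M). f s a h)"
    by (subst sum.Sigma) auto
  also have "\<dots> = (\<Sum>(s, a, h)\<in>triples M. f s a h)"
    by (rule sum.reindex_bij_witness[of _ "\<lambda>(s, a, h). (h, s, a)" "\<lambda>(h, s, a). (s, a, h)"])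
      (auto simp: triples_def layer_def)
  finally show ?thesis by simp
qed

lemma card_triples_le:
  fixes M :: "('s::finite, 'a::finite) det_mdp"
  shows "num_triples M \<le> CARD('s) * CARD('a) * horizon M"
proof -
  have "card (triples M) \<le> card ((UNIV :: 's set) \<times> (UNIV :: 'a set) \<times> stages M)"
    by (rule card_mono) (auto simp: triples_def)
  thus ?thesis by (simp add: num_triples_def card_cartesian_product stages_def)
qed

lemma num_triples_pos:
  fixes M :: "('s::finite, 'a::finite) det_mdp"
  assumes "wf_det_mdp M" shows "1 \<le> num_triples M"
proof -
  obtain \<pi> where "\<pi> \<in> policies M" using assms by (auto simp: wf_det_mdp_def)
  hence "card (trajectory M \<pi>) \<le> card (triples M)"
    by (intro card_mono trajectory_subset_triples finite_triples)
  moreover have "1 \<le> horizon M" using assms by (simp add: wf_det_mdp_def)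
  ultimately show ?thesis by (simp add: num_triples_def card_trajectory)
qed

section \<open>Flows\<close>

lemma finite_layer [simp]: "finite (layer (M :: ('s::finite, 'a::finite) det_mdp) h)"
  by (rule finite)

lemma init_reachable: "wf_det_mdp M \<Longrightarrow> s \<in> reachable M 1 \<longleftrightarrow> s = init M"
  by (auto simp: wf_det_mdp_def reachable_def)

lemma step_reachable:
  assumes "h \<in> stages M" "s \<in> reachable M h" "a \<in> avail M h s"
  shows "step M h s a \<in> reachable M (Suc h)"
proof -
  have "(s, a, h) \<in> triples M" using assms by (simp add: triples_def)
  from policies_through_nonempty[OF this] obtain \<pi> where "\<pi> \<in> policies_through M s a h" by auto
  hence "\<pi> \<in> policies M" "state_at M \<pi> (Suc h) = step M h s a"
    using assms by (auto simp: state_at_Suc stages_def policies_through_def)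
  thus ?thesis by (auto simp: reachable_def)
qed

lemma flow_value_layer:
  fixes M :: "('s::finite, 'a::finite) det_mdp"
  assumes "wf_det_mdp M"
  shows "flow_value M \<eta> = (\<Sum>(s, a)\<in>layer M 1. \<eta> 1 s a)"
proof -
  have "layer M 1 = {init M} \<times> avail M 1 (init M)" using init_reachable[OF assms] by (auto simp: layer_def)
  thus ?thesis by (simp add: flow_value_def flip: sum.cartesian_product)
qed

text \<open>Conservation tested against a function \<open>v\<close> of the state: the arcs of stage
  \<open>h\<close> are grouped by the state they enter. With \<open>v\<close> constantly 1 the mass
  is the same at all stages; with a value function it is one step of a potential argument.\<close>

lemma flow_shift:
  fixes M :: "('s::finite, 'a::finite) det_mdp" and v :: "'s \<Rightarrow> real"
  assumes "is_flow M \<eta>" "1 \<le> h" "Suc h \<in> stages M"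
  shows "(\<Sum>(s, a)\<in>layer M (Suc h). \<eta> (Suc h) s a * v s)
       = (\<Sum>(s, a)\<in>layer M h. \<eta> h s a * v (step M h s a))"
proof -
  let ?R = "reachable M (Suc h)"
  have hs: "h \<in> stages M" using assms by (auto simp: stages_def)
  have "(\<Sum>(s, a)\<in>layer M (Suc h). \<eta> (Suc h) s a * v s)
      = (\<Sum>s\<in>?R. \<Sum>a\<in>avail M (Suc h) s. \<eta> (Suc h) s a * v s)"
    by (subst sum.Sigma) (auto simp: layer_def Sigma_def intro!: sum.cong)
  also have "\<dots> = (\<Sum>s\<in>?R. (\<Sum>a\<in>avail M (Suc h) s. \<eta> (Suc h) s a) * v s)"
    by (simp add: sum_distrib_right)
  also have "\<dots> = (\<Sum>s\<in>?R. (\<Sum>(s', a')\<in>{x \<in> layer M h. step M h (fst x) (snd x) = s}.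
       \<eta> h s' a') * v s)"
  proof (rule sum.cong[OF refl])
    fix s assume s: "s \<in> ?R"
    have "{x \<in> layer M h. step M h (fst x) (snd x) = s} = {(s', a'). s' \<in> reachable M h \<and>
        a' \<in> avail M h s' \<and> step M h s' a' = s}" by (auto simp: layer_def)
    thus "(\<Sum>a\<in>avail M (Suc h) s. \<eta> (Suc h) s a) * v s =
       (\<Sum>(s', a')\<in>{x \<in> layer M h. step M h (fst x) (snd x) = s}. \<eta> h s' a') * v s"
      using assms s unfolding is_flow_def by (auto dest!: bspec[of _ _ "Suc h"])
  qed
  also have "\<dots> = (\<Sum>s\<in>?R. \<Sum>x\<in>{x \<in> layer M h. step M h (fst x) (snd x) = s}.
       \<eta> h (fst x) (snd x) * v (step M h (fst x) (snd x)))"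
    by (auto simp: sum_distrib_right case_prod_unfold intro!: sum.cong)
  also have "\<dots> = (\<Sum>x\<in>layer M h. \<eta> h (fst x) (snd x) * v (step M h (fst x) (snd x)))"
    by (rule sum.group) (use step_reachable[OF hs] in \<open>auto simp: layer_def\<close>)
  finally show ?thesis by (simp add: case_prod_unfold)
qed

text \<open>The easy half of LP duality for minimum flows. The forward value \<open>W h s\<close> is the largest weight
  collected before stage \<open>h\<close> by a policy that reaches \<open>s\<close>.\<close>

lemma flow_weight_le:
  fixes M :: "('s::finite, 'a::finite) det_mdp" and x :: "nat \<Rightarrow> 's \<Rightarrow> 'a \<Rightarrow> real"
  assumes wf: "wf_det_mdp M" and flow: "is_flow M \<eta>"
    and K: "\<And>\<pi>. \<pi> \<in> policies M \<Longrightarrow> (\<Sum>h\<in>stages M. x h (state_at M \<pi> h) (action_at M \<pi> h)) \<le> K"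
  shows "(\<Sum>(s, a, h)\<in>triples M. x h s a * \<eta> h s a) \<le> K * flow_value M \<eta>"
proof -
  \<comment> \<open>The sum stops before stage \<open>h\<close>, so \<open>w\<close> is the weight
    on arrival and the triple chosen at \<open>h\<close> is not yet counted.\<close>
  define w where "w \<pi> h = (\<Sum>h'\<in>{1..<h}. x h' (state_at M \<pi> h') (action_at M \<pi> h'))" for \<pi> h
  define R where "R h s = {\<pi> \<in> policies M. state_at M \<pi> h = s}" for h s
  define W where "W h s = Max ((\<lambda>\<pi>. w \<pi> h) ` R h s)" for h s
  have finR: "finite (R h s)" for h s by (simp add: R_def)
  have nonneg: "0 \<le> \<eta> h s a" if "h \<in> stages M" "(s, a) \<in> layer M h" for h s a
    using flow that by (auto simp: is_flow_def layer_def triples_def)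
  have W_step: "W h s + x h s a \<le> w \<pi>' (Suc h) \<and> \<pi>' \<in> R (Suc h) (step M h s a)"
    if "h \<in> stages M" "(s, a) \<in> layer M h" "\<pi> \<in> R h s" "w \<pi> h = W h s"
      "\<pi>' \<in> policies M" "\<And>h'. h' \<le> h \<Longrightarrow> state_at M \<pi>' h' = state_at M \<pi> h'"
      "\<And>h'. h' < h \<Longrightarrow> h' \<in> stages M \<Longrightarrow> action_at M \<pi>' h' = action_at M \<pi> h'"
      "action_at M \<pi>' h = a" for h s a \<pi> \<pi>'
  proof -
    have h: "1 \<le> h" using that by (auto simp: stages_def)
    have "w \<pi>' h = w \<pi> h" unfolding w_def
      by (rule sum.cong) (use that in \<open>auto simp: stages_def\<close>)
    moreover have "w \<pi>' (Suc h) = w \<pi>' h + x h s a"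
      using h that by (simp add: w_def R_def)
    ultimately show ?thesis using that h by (auto simp: R_def state_at_Suc)
  qed
  \<comment> \<open>A best arrival at \<open>s\<close> followed by \<open>a\<close> is realised by
    one policy, because \<open>deviate\<close> sets the action at \<open>h\<close> without
    disturbing the prefix.\<close>
  have best: "\<exists>\<pi>'. \<pi>' \<in> R (Suc h) (step M h s a) \<and> W h s + x h s a \<le> w \<pi>' (Suc h)"
    if hs: "h \<in> stages M" "(s, a) \<in> layer M h" for h s a
  proof -
    have ne: "R h s \<noteq> {}" using that by (auto simp: layer_def reachable_def R_def)
    have "W h s \<in> (\<lambda>\<pi>. w \<pi> h) ` R h s" unfolding W_def
      by (rule Max_in) (use ne finR in auto)
    then obtain \<pi> where p: "\<pi> \<in> R h s" "w \<pi> h = W h s" by auto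
    have "\<pi> \<in> policies M" "a \<in> avail M h (state_at M \<pi> h)"
      using p that by (auto simp: R_def layer_def)
    from deviate[OF this(1) hs(1) this(2)] obtain \<pi>' where
      "\<pi>' \<in> policies M" "\<And>h'. h' \<le> h \<Longrightarrow> state_at M \<pi>' h' = state_at M \<pi> h'"
      "\<And>h'. h' < h \<Longrightarrow> h' \<in> stages M \<Longrightarrow> action_at M \<pi>' h' = action_at M \<pi> h'"
      "action_at M \<pi>' h = a" by metis
    from W_step[OF hs p this] show ?thesis by blast
  qed
  have step: "W h s + x h s a \<le> W (Suc h) (step M h s a)"
    if "h \<in> stages M" "(s, a) \<in> layer M h" for h s a
  proof -
    from best[OF that] obtain \<pi>' where p: "\<pi>' \<in> R (Suc h) (step M h s a)" "W h s + x h s a \<le> w \<pi>' (Suc h)"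
      by auto
    have "w \<pi>' (Suc h) \<le> W (Suc h) (step M h s a)" unfolding W_def
      by (rule Max_ge) (use finR p in auto)
    with p show ?thesis by simp
  qed
  define L where "L h = (\<Sum>(s, a)\<in>layer M h. x h s a * \<eta> h s a)" for h
  have H: "1 \<le> horizon M" using wf by (simp add: wf_det_mdp_def)
  have total: "h \<in> stages M \<Longrightarrow> (\<Sum>(s, a)\<in>layer M h. \<eta> h s a) = flow_value M \<eta>" for h
  proof (induction h)
    case (Suc h)
    show ?case
    proof (cases "h = 0")
      case False
      hence "h \<in> stages M" using Suc.prems by (auto simp: stages_def)
      then show ?thesis using flow_shift[OF flow, of h "\<lambda>_. 1"] Suc False by simp
    qed (simp add: flow_value_layer[OF wf])
  qed (simp add: stages_def)
  \<comment> \<open>Potential argument: the sum of \<open>W\<close> at stage \<open>h\<close>,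
    weighted by the flow, dominates all weight carried by the flow before \<open>h\<close>. The
    layer weight \<open>L h\<close> is paid by the growth of \<open>W\<close> along each
    arc.\<close>
  have main: "h \<in> stages M \<Longrightarrow>
      (\<Sum>h'\<in>{1..<h}. L h') \<le> (\<Sum>(s, a)\<in>layer M h. \<eta> h s a * W h s)" for h
  proof (induction h)
    case (Suc h)
    show ?case
    proof (cases "h = 0")
      case True
      have "W (Suc 0) s = 0" if "s \<in> reachable M (Suc 0)" for s
      proof -
        have "(\<lambda>\<pi>. w \<pi> (Suc 0)) ` R (Suc 0) s = {0}"
          using that by (auto simp: w_def R_def reachable_def)
        thus ?thesis by (simp add: W_def)
      qed
      hence "(\<Sum>(s, a)\<in>layer M (Suc 0). \<eta> (Suc 0) s a * W (Suc 0) s) = 0"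
        by (intro sum.neutral) (auto simp: layer_def)
      thus ?thesis using True by simp
    next
      case False
      hence h: "h \<in> stages M" using Suc.prems by (auto simp: stages_def)
      have "(\<Sum>h'\<in>{1..<Suc h}. L h') = (\<Sum>h'\<in>{1..<h}. L h') + L h" using False by simp
      also have "\<dots> \<le> (\<Sum>(s, a)\<in>layer M h. \<eta> h s a * W h s) + L h" using Suc.IH[OF h] by simp
      also have "\<dots> = (\<Sum>(s, a)\<in>layer M h. \<eta> h s a * (W h s + x h s a))"
        unfolding L_def sum.distrib[symmetric] by (intro sum.cong) (auto simp: algebra_simps)
      also have "\<dots> \<le> (\<Sum>(s, a)\<in>layer M h. \<eta> h s a * W (Suc h) (step M h s a))"
        by (intro sum_mono) (auto intro!: mult_left_mono step h nonneg)
      also have "\<dots> = (\<Sum>(s, a)\<in>layer M (Suc h). \<eta> (Suc h) s a * W (Suc h) s)"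
        using flow_shift[OF flow, of h "W (Suc h)"] False Suc.prems by simp
      finally show ?thesis .
    qed
  qed (simp add: stages_def)
  let ?H = "horizon M"
  have Hs: "?H \<in> stages M" using H by (simp add: stages_def)
  have "(\<Sum>(s, a, h)\<in>triples M. x h s a * \<eta> h s a) = (\<Sum>h\<in>stages M. L h)"
    unfolding sum_triples L_def ..
  also have "stages M = {1..<Suc ?H}" by (auto simp: stages_def)
  also have "(\<Sum>h\<in>{1..<Suc ?H}. L h) = (\<Sum>h'\<in>{1..<?H}. L h') + L ?H" using H by simp
  also have "\<dots> \<le> (\<Sum>(s, a)\<in>layer M ?H. \<eta> ?H s a * W ?H s) + L ?H" using main[OF Hs] by simp
  also have "\<dots> = (\<Sum>(s, a)\<in>layer M ?H. \<eta> ?H s a * (W ?H s + x ?H s a))"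
    unfolding L_def sum.distrib[symmetric] by (intro sum.cong) (auto simp: algebra_simps)
  also have "\<dots> \<le> (\<Sum>(s, a)\<in>layer M ?H. \<eta> ?H s a * K)"
  proof (rule sum_mono, clarify)
    fix s a assume sa: "(s, a) \<in> layer M ?H"
    \<comment> \<open>At the last stage the prefix extended by \<open>a\<close> is a complete
      policy, so its weight falls under the hypothesis on \<open>K\<close>. The state at
      \<open>Suc ?H\<close> is merely the formal successor.\<close>
    from best[OF Hs sa] obtain \<pi>' where p: "\<pi>' \<in> policies M" "W ?H s + x ?H s a \<le> w \<pi>' (Suc ?H)"
      by (auto simp: R_def)
    have "w \<pi>' (Suc ?H) = (\<Sum>h\<in>stages M. x h (state_at M \<pi>' h) (action_at M \<pi>' h))"
      unfolding w_def by (rule sum.cong) (auto simp: stages_def)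
    with K[OF p(1)] p(2) have "W ?H s + x ?H s a \<le> K" by simp
    thus "\<eta> ?H s a * (W ?H s + x ?H s a) \<le> \<eta> ?H s a * K"
      by (intro mult_left_mono nonneg Hs sa)
  qed
  also have "\<dots> = K * flow_value M \<eta>"
    by (simp add: total[OF Hs, symmetric] sum_distrib_left case_prod_unfold mult.commute)
  finally show ?thesis .
qed

lemma flow_value_nonneg:
  assumes "wf_det_mdp M" "is_flow M \<eta>" shows "0 \<le> flow_value M \<eta>"
  unfolding flow_value_def using assms init_reachable[OF assms(1)]
  by (intro sum_nonneg) (auto simp: is_flow_def triples_def stages_def wf_det_mdp_def)

text \<open>Every policy carries \<open>K\<close> units, the total absolute demand, and every triple
  lies on some trajectory. Feasibility gives the infimum in \<open>min_flow_value\<close> a meaning,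
  as it is then taken over a nonempty set.\<close>

lemma feasible_flow_exists:
  fixes M :: "('s::finite, 'a::finite) det_mdp"
  assumes "wf_det_mdp M"
  shows "\<exists>\<eta>. feasible_flow M c \<eta>"
proof -
  define K where "K = (\<Sum>(s, a, h)\<in>triples M. \<bar>c h s a\<bar>)"
  define \<eta> where "\<eta> h s a = (\<Sum>\<pi>\<in>policies M. K * of_bool (state_at M \<pi> h = s \<and> action_at M \<pi> h = a))"
    for h s a
  have K0: "0 \<le> K" by (auto simp: K_def intro!: sum_nonneg)
  have "is_flow M \<eta>"
    unfolding is_flow_def
  proof (intro conjI ballI impI, goal_cases)
    case (1 e) thus ?case using K0 by (auto simp: \<eta>_def intro!: sum_nonneg)
  next
    case (2 h s)
    let ?Q = "{(s', a'). s' \<in> reachable M (h - 1) \<and> a' \<in> avail M (h - 1) s' \<and> step M (h - 1) s' a' = s}"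
    have h: "h - 1 \<in> stages M" "1 \<le> h - 1" "h = Suc (h - 1)" using 2 by (auto simp: stages_def)
    have "(\<Sum>(s', a')\<in>?Q. \<eta> (h - 1) s' a') = (\<Sum>\<pi>\<in>policies M. \<Sum>(s', a')\<in>?Q.
        K * of_bool (state_at M \<pi> (h - 1) = s' \<and> action_at M \<pi> (h - 1) = a'))"
      unfolding \<eta>_def case_prod_unfold by (rule sum.swap)
    \<comment> \<open>Conservation holds policy by policy: both the inflow and the outflow of
      \<open>s\<close> receive \<open>K\<close> from \<pi> exactly when \<pi> is in \<open>s\<close>
      at stage \<open>h\<close>.\<close>
    also have "\<dots> = (\<Sum>\<pi>\<in>policies M. K * of_bool (state_at M \<pi> h = s))"
    proof (rule sum.cong[OF refl])
      fix \<pi> assume p: "\<pi> \<in> policies M"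
      let ?z = "(state_at M \<pi> (h - 1), action_at M \<pi> (h - 1))"
      have "?z \<in> ?Q \<longleftrightarrow> state_at M \<pi> h = s"
        using p h(1) state_at_Suc[OF h(2), of M \<pi>] h(3)
        by (auto simp: reachable_def action_at_def policy_avail)
      moreover have "(\<Sum>(s', a')\<in>?Q. K * of_bool (state_at M \<pi> (h - 1) = s' \<and> action_at M \<pi> (h - 1) = a'))
         = (\<Sum>z\<in>?Q. if ?z = z then K else 0)"
        by (rule sum.cong) auto
      ultimately show "(\<Sum>(s', a')\<in>?Q. K * of_bool (state_at M \<pi> (h - 1) = s' \<and>
          action_at M \<pi> (h - 1) = a')) = K * of_bool (state_at M \<pi> h = s)"
        by (simp add: sum.delta')
    qed
    also have "\<dots> = (\<Sum>\<pi>\<in>policies M. \<Sum>a\<in>avail M h s.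
        K * of_bool (state_at M \<pi> h = s \<and> action_at M \<pi> h = a))"
    proof (rule sum.cong[OF refl])
      fix \<pi> assume p: "\<pi> \<in> policies M"
      have "(\<Sum>a\<in>avail M h s. K * of_bool (state_at M \<pi> h = s \<and> action_at M \<pi> h = a))
          = (\<Sum>a\<in>avail M h s. if action_at M \<pi> h = a then K * of_bool (state_at M \<pi> h = s) else 0)"
        by (rule sum.cong) auto
      also have "\<dots> = K * of_bool (state_at M \<pi> h = s)"
        using p 2(1) by (subst sum.delta') (auto simp: action_at_def policy_avail)
      finally show "K * of_bool (state_at M \<pi> h = s) = (\<Sum>a\<in>avail M h s.
        K * of_bool (state_at M \<pi> h = s \<and> action_at M \<pi> h = a))" by (rule sym)
    qed
    also have "\<dots> = (\<Sum>a\<in>avail M h s. \<eta> h s a)"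
      unfolding \<eta>_def by (rule sum.swap)
    finally show ?case .
  qed
  moreover have "c h s a \<le> \<eta> h s a" if e: "(s, a, h) \<in> triples M" for s a h
  proof -
    obtain \<pi> where p: "\<pi> \<in> policies_through M s a h" using policies_through_nonempty[OF e] by auto
    have "c h s a \<le> \<bar>c h s a\<bar>" by simp
    also have "\<dots> \<le> K"
      unfolding K_def using member_le_sum[OF e, of "\<lambda>(s, a, h). \<bar>c h s a\<bar>"] by auto
    also have "\<dots> = K * of_bool (state_at M \<pi> h = s \<and> action_at M \<pi> h = a)"
      using p by (simp add: policies_through_def)
    also have "\<dots> \<le> \<eta> h s a" unfolding \<eta>_def
      by (rule member_le_sum) (use p K0 in \<open>auto simp: policies_through_def\<close>)
    finally show ?thesis .
  qed
  ultimately show ?thesis by (auto simp: feasible_flow_def)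
qed

lemma min_flow_value_le:
  assumes "wf_det_mdp M" "feasible_flow M c \<eta>"
  shows "min_flow_value M c \<le> flow_value M \<eta>"
  unfolding min_flow_value_def
  by (rule cInf_lower) (use assms flow_value_nonneg[OF assms(1)] in
      \<open>auto simp: bdd_below_def feasible_flow_def intro!: exI[of _ 0]\<close>)

lemma min_flow_value_greatest:
  fixes M :: "('s::finite, 'a::finite) det_mdp"
  assumes "wf_det_mdp M" "\<And>\<eta>. feasible_flow M c \<eta> \<Longrightarrow> b \<le> flow_value M \<eta>"
  shows "b \<le> min_flow_value M c"
  unfolding min_flow_value_def
  by (rule cInf_greatest) (use assms feasible_flow_exists[OF assms(1), of c] in auto)

lemma min_flow_value_nonneg:
  fixes M :: "('s::finite, 'a::finite) det_mdp"
  assumes "wf_det_mdp M" shows "0 \<le> min_flow_value M c"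
  by (rule min_flow_value_greatest[OF assms]) (simp add: feasible_flow_def flow_value_nonneg[OF assms])

lemma min_flow_value_scale:
  fixes M :: "('s::finite, 'a::finite) det_mdp"
  assumes wf: "wf_det_mdp M" and k: "0 < k"
    and le: "\<And>s a h. (s, a, h) \<in> triples M \<Longrightarrow> k * c h s a \<le> d h s a"
  shows "min_flow_value M c \<le> min_flow_value M d / k"
proof -
  have "k * min_flow_value M c \<le> min_flow_value M d"
  proof (rule min_flow_value_greatest[OF wf])
    fix \<eta> assume f: "feasible_flow M d \<eta>"
    define \<eta>' where "\<eta>' h s a = \<eta> h s a / k" for h s a
    have "is_flow M \<eta>'"
      using f k unfolding is_flow_def feasible_flow_def \<eta>'_def
      by (auto simp: sum_divide_distrib[symmetric] case_prod_unfold)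
    moreover have "c h s a \<le> \<eta>' h s a" if "(s, a, h) \<in> triples M" for s a h
    proof -
      have "d h s a \<le> \<eta> h s a" using f that by (auto simp: feasible_flow_def)
      with le[OF that] show ?thesis using k by (simp add: \<eta>'_def pos_le_divide_eq mult.commute)
    qed
    ultimately have "feasible_flow M c \<eta>'" by (auto simp: feasible_flow_def)
    from min_flow_value_le[OF wf this] show "k * min_flow_value M c \<le> flow_value M \<eta>"
      using k by (simp add: flow_value_def \<eta>'_def sum_divide_distrib[symmetric] pos_le_divide_eq mult.commute)
  qed
  thus ?thesis using k by (simp add: pos_le_divide_eq mult.commute)
qed

section \<open>Real inequalities\<close>

text \<open>The tangent to the logarithm at \<open>z\<close>. Choosing \<open>z\<close> proportional
  to the coefficient of the logarithm turns it into a fixed fraction of the unknown, which can be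
  absorbed.\<close>

lemma ln_le_scaled: "0 < x \<Longrightarrow> 0 < z \<Longrightarrow> ln x \<le> x / z + ln z - (1::real)"
  using ln_le_minus_one[of "x / z"] by (simp add: ln_div)

lemma ln_ge_one_minus_inverse: "0 < x \<Longrightarrow> 1 - 1 / x \<le> ln (x::real)"
  using ln_le_minus_one[of "1 / x"] by (simp add: ln_div)

lemma ln4_gt_1: "1 < ln (4::real)"
proof -
  have "exp 1 < (4::real)" using e_less_272 by simp
  thus ?thesis by (metis exp_gt_zero ln_exp ln_less_cancel_iff zero_less_numeral)
qed

text \<open>The hypothesis \<open>ln 4 \<le> a\<close> is exactly the step from 1 to 2; from 2 on
  the increment of the logarithm is at most \<open>1 / real n\<close>, and
  \<open>a + 2 * ln (real n)\<close> exceeds 2. This makes the confidence radius decrease with the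
  visits although the threshold grows.\<close>

lemma log_square_over_antimono:
  fixes a :: real
  assumes a: "ln 4 \<le> a" and mn: "1 \<le> m" "m \<le> n"
  shows "(a + 2 * ln (real n)) / real n \<le> (a + 2 * ln (real m)) / real m"
  using mn(2)
proof (induction n rule: dec_induct)
  case (step n)
  have n: "1 \<le> n" using step mn by simp
  have "real n * (a + 2 * ln (real (Suc n))) \<le> real (Suc n) * (a + 2 * ln (real n))"
  proof (cases "n = 1")
    case True
    have "ln (4::real) = 2 * ln 2" using ln_realpow[of 2 2] by simp
    thus ?thesis using True a by simp
  next
    case False
    hence n2: "2 \<le> n" using n by simp
    have "ln (real (Suc n)) - ln (real n) = ln (1 + 1 / real n)"
    proof -
      have "1 + 1 / real n = real (Suc n) / real n" using n by (simp add: field_simps)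
      thus ?thesis using n by (simp add: ln_div)
    qed
    also have "\<dots> \<le> 1 / real n" by (rule ln_add_one_self_le_self) simp
    finally have "real n * (ln (real (Suc n)) - ln (real n)) \<le> 1"
      using n by (simp add: field_simps)
    moreover have "ln 2 \<le> ln (real n)" using n2 by simp
    moreover have "ln (4::real) = 2 * ln 2" using ln_realpow[of 2 2] by simp
    ultimately show ?thesis using a ln4_gt_1 by (simp add: algebra_simps)
  qed
  hence "(a + 2 * ln (real (Suc n))) / real (Suc n) \<le> (a + 2 * ln (real n)) / real n"
    using n by (simp add: field_simps)
  with step.IH show ?case by linarith
qed simp

text \<open>Two passes: the tangent at \<open>4 * X\<close> yields the crude polynomial bound
  \<open>(8 * X * l\<^sup>2) ^ 2\<close> on \<open>m\<close>, which is then put back into the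
  logarithm. The square explains why the coefficient of the logarithm doubles from 2 to 4.\<close>

lemma level_inversion:
  fixes X a l :: real
  assumes m: "1 \<le> m" and X: "0 < X" and a: "ln 4 \<le> a" "a \<le> l"
    and le: "real m \<le> X * (a + 2 * ln (real m))"
  shows "real m \<le> X * (l + 4 * ln (8 * X * l\<^sup>2))"
proof -
  have l: "1 < l" using a ln4_gt_1 by simp
  \<comment> \<open>Comparing with count 1 shows that \<open>X * l\<close> is at least 1, so that
    this factor can later be inserted to make the bound homogeneous in \<open>X\<close>.\<close>
  have "1 \<le> X * ((a + 2 * ln (real m)) / real m)" using le m by (simp add: field_simps)
  also have "\<dots> \<le> X * a"
    using log_square_over_antimono[OF a(1), of 1 m] m X by (intro mult_left_mono) auto
  also have "\<dots> \<le> X * l" using X a by simp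
  finally have Xl: "1 \<le> X * l" .
  \<comment> \<open>The hypothesis is doubled, so that the tangent costs exactly one of the two
    copies of \<open>m\<close>.\<close>
  have "2 * X * (2 * ln (real m)) \<le> 4 * X * (real m / (4 * X) + ln (4 * X) - 1)"
    using ln_le_scaled[of "real m" "4 * X"] m X by simp
  also have "\<dots> = real m + 4 * X * (ln (4 * X) - 1)" using X by (simp add: field_simps)
  finally have "real m \<le> 2 * X * (a + 2 * (ln (4 * X) - 1))" using le by (simp add: algebra_simps)
  also have "\<dots> \<le> 2 * X * (l + 2 * (4 * X))"
    using X a ln_le_minus_one[of "4 * X"] by (intro mult_left_mono) auto
  also have "\<dots> \<le> 2 * X * (X * l * l + 8 * X)"
    using X mult_right_mono[OF Xl, of l] l by (intro mult_left_mono) auto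
  also have "\<dots> \<le> 64 * X\<^sup>2 * l ^ 4"
  proof -
    have "l\<^sup>2 \<le> l ^ 4" "1 \<le> l ^ 4" using l by (auto intro!: power_increasing one_le_power)
    hence "l\<^sup>2 + 8 \<le> 32 * l ^ 4" by linarith
    hence "2 * X\<^sup>2 * (l\<^sup>2 + 8) \<le> 2 * X\<^sup>2 * (32 * l ^ 4)" by (intro mult_left_mono) auto
    thus ?thesis by (simp add: algebra_simps power2_eq_square)
  qed
  also have "\<dots> = (8 * X * l\<^sup>2) ^ 2" by (simp add: power_mult_distrib flip: power_mult)
  finally have "ln (real m) \<le> ln ((8 * X * l\<^sup>2) ^ 2)"
    by (rule ln_mono) (use m in auto)
  also have "\<dots> = 2 * ln (8 * X * l\<^sup>2)" using X l by (subst ln_realpow) auto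
  finally have "X * (a + 2 * ln (real m)) \<le> X * (l + 4 * ln (8 * X * l\<^sup>2))"
    using a X by (intro mult_left_mono) auto
  with le show ?thesis by simp
qed

text \<open>For a large gap \<open>X\<close> is small and the logarithm may be negative. Bounding it
  below by one minus the inverse of its argument leaves a loss \<open>1 / (2 * l\<^sup>2)\<close>
  free of \<open>X\<close>, so the summand 2 in \<open>lower_bound_fun\<close> keeps that function
  at least 1.\<close>

lemma log_correction_ge:
  fixes X l :: real
  assumes "0 < X" "1 < l"
  shows "- 1 \<le> X * (l + 4 * ln (8 * X * l\<^sup>2))"
proof -
  have l2: "1 < l\<^sup>2" using assms by (simp add: one_less_power)
  have "1 - 1 / (8 * X * l\<^sup>2) \<le> ln (8 * X * l\<^sup>2)"
    by (rule ln_ge_one_minus_inverse) (use assms in auto)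
  hence "X * (4 * (1 - 1 / (8 * X * l\<^sup>2))) \<le> X * (4 * ln (8 * X * l\<^sup>2))"
    using assms by (intro mult_left_mono) auto
  moreover have "X * (4 * (1 - 1 / (8 * X * l\<^sup>2))) = 4 * X - 1 / (2 * l\<^sup>2)"
    using assms by (simp add: field_simps)
  moreover have "1 / (2 * l\<^sup>2) \<le> 1" using l2 by (subst divide_le_eq_1_pos) linarith+
  moreover have "0 \<le> X * l" using assms by simp
  ultimately show ?thesis unfolding distrib_left using assms(1) by linarith
qed

text \<open>The tangent at \<open>4 * Y\<close> alone suffices, because the conclusion has twice the
  coefficient that it leaves. If \<open>Y\<close> is small, \<open>ln (4 * Y)\<close> is negative;
  the resulting loss is the constant 3 and is absorbed by \<open>4 * B\<close>.\<close>

lemma episode_inversion: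
  fixes Y B T a :: real
  assumes T: "1 \<le> T" and Y: "0 < Y" and B: "1 \<le> B" and a: "ln 4 \<le> a"
    and le: "T \<le> Y * (a + 2 * ln T) + 2 * B + 1"
  shows "T \<le> 4 * Y * (a + 4 * ln (8 * Y * a)) + 8 * B + 2"
proof -
  have a1: "1 < a" using a ln4_gt_1 by simp
  have "2 * Y * (2 * ln T) \<le> 4 * Y * (T / (4 * Y) + ln (4 * Y) - 1)"
    using ln_le_scaled[of T "4 * Y"] T Y by simp
  also have "\<dots> = T + 4 * Y * (ln (4 * Y) - 1)" using Y by (simp add: field_simps)
  finally have "T \<le> 2 * Y * (a + 2 * (ln (4 * Y) - 1)) + 4 * B + 2"
    using le by (simp add: algebra_simps)
  moreover have "2 * Y * (a + 2 * (ln (4 * Y) - 1)) \<le> 4 * Y * (a + 4 * ln (8 * Y * a)) + 4 * B"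
  proof -
    have "ln (2 * a) \<ge> ln 2" using a1 by simp
    hence "ln (2 * a) \<ge> 0" by (smt (verit) ln_ge_zero)
    moreover have "ln (8 * Y * a) = ln (4 * Y) + ln (2 * a)"
      using Y a1 ln_mult[of "4 * Y" "2 * a"] by (simp add: mult.assoc mult.left_commute)
    moreover have "1 - 1 / (4 * Y) \<le> ln (4 * Y)" by (rule ln_ge_one_minus_inverse) (use Y in auto)
    moreover have "3 / (2 * Y) = 6 * (1 / (4 * Y))" by simp
    ultimately have "a + 2 * (ln (4 * Y) - 1) \<le> 2 * (a + 4 * ln (8 * Y * a)) + 3 / (2 * Y)"
      using a1 unfolding distrib_left right_diff_distrib by linarith
    hence "2 * Y * (a + 2 * (ln (4 * Y) - 1)) \<le> 2 * Y * (2 * (a + 4 * ln (8 * Y * a)) + 3 / (2 * Y))"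
      using Y by (intro mult_left_mono) auto
    also have "\<dots> = 4 * Y * (a + 4 * ln (8 * Y * a)) + 3" using Y by (simp add: field_simps)
    finally show ?thesis using B by simp
  qed
  ultimately show ?thesis by simp
qed

section \<open>The greedy cover\<close>

text \<open>The \<open>d\<close> reciprocals that separate the two harmonic numbers belong to
  indices at most \<open>q\<close>, so each is at least \<open>1 / real q\<close>.\<close>

lemma diff_harm_ge:
  assumes "d \<le> q" shows "real d / real q \<le> harm q - harm (q - d)"
proof -
  have "real d / real q = (\<Sum>i\<in>{Suc (q - d)..q}. 1 / real q)" using assms by simp
  also have "\<dots> \<le> (\<Sum>i\<in>{Suc (q - d)..q}. inverse (real i))"
    by (rule sum_mono) (auto simp: field_simps)
  also have "\<dots> = (\<Sum>i\<in>{1..q} - {1..q - d}. inverse (real i))" by (rule sum.cong) auto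
  also have "\<dots> = harm q - harm (q - d)" unfolding harm_def by (subst sum_diff) auto
  finally show ?thesis .
qed

text \<open>Dual fitting: a greedy step that covers \<open>d\<close> new elements charges \<open>1 / d\<close> to each of them.\<close>

definition greedy_price :: "nat set \<Rightarrow> (nat \<Rightarrow> 'e set) \<Rightarrow> (nat \<Rightarrow> 'e set) \<Rightarrow> 'e \<Rightarrow> real" where
  "greedy_price I R X e = (\<Sum>t\<in>I. of_bool (e \<in> X t \<inter> R t) / real (card (X t \<inter> R t)))"

lemma sum_greedy_price:
  "finite Q \<Longrightarrow> sum (greedy_price I R X) Q
    = (\<Sum>t\<in>I. real (card (Q \<inter> (X t \<inter> R t))) / real (card (X t \<inter> R t)))"
  unfolding greedy_price_def
  by (subst sum.swap) (simp add: sum_divide_distrib[symmetric] Int_def)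

text \<open>A step that covers something new spends a total price of exactly one.\<close>

lemma greedy_price_total:
  assumes "finite E" "\<And>t. t \<in> I \<Longrightarrow> R t \<subseteq> E" "\<And>t. t \<in> I \<Longrightarrow> X t \<inter> R t \<noteq> {}"
  shows "sum (greedy_price I R X) E = real (card I)"
proof -
  have "real (card (E \<inter> (X t \<inter> R t))) / real (card (X t \<inter> R t)) = 1" if "t \<in> I" for t
  proof -
    have "E \<inter> (X t \<inter> R t) = X t \<inter> R t" "finite (X t \<inter> R t)"
      using assms that by (auto intro: finite_subset)
    thus ?thesis using assms(3)[OF that] by simp
  qed
  hence "sum (greedy_price I R X) E = (\<Sum>t\<in>I. 1)"
    unfolding sum_greedy_price[OF assms(1)] by (rule sum.cong[OF refl])
  thus ?thesis by simp
qed

text \<open>Let \<open>q\<close> elements of \<open>Q\<close> be uncovered when a step covers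
  \<open>d\<close> of them. Greediness makes each price at most the inverse of \<open>q\<close>, so
  they cost at most \<open>d / q\<close>, which \<open>diff_harm_ge\<close> turns into a telescoping
  sum. This is feasibility of the prices, up to the factor \<open>harm n\<close>, for the dual of
  the covering problem.\<close>

lemma greedy_price_set_le:
  assumes "finite I" "finite Q" "card Q \<le> n"
    and "\<And>t. t \<in> I \<Longrightarrow> finite (R t)"
    and "\<And>t. t \<in> I \<Longrightarrow> card (Q \<inter> R t) \<le> card (X t \<inter> R t)"
    and "\<And>t t'. t \<in> I \<Longrightarrow> t' \<in> I \<Longrightarrow> t < t' \<Longrightarrow> R t' \<subseteq> R t - X t"
  shows "sum (greedy_price I R X) Q \<le> harm n"
proof -
  \<comment> \<open>In the induction over the earliest step the bound \<open>n\<close> refers to the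
    part of \<open>Q\<close> still uncovered, which is what shrinks from one step to the
    next.\<close>
  have "(\<Sum>t\<in>I. real (card (Q \<inter> (X t \<inter> R t))) / real (card (X t \<inter> R t))) \<le> harm n"
    if "\<And>t. t \<in> I \<Longrightarrow> card (Q \<inter> R t) \<le> n" for n
    using assms(1) that assms(4-6)
  proof (induction I arbitrary: n rule: finite_linorder_min_induct)
    case empty
    show ?case by (simp add: harm_nonneg)
  next
    case (insert b I)
    define q d where "q = card (Q \<inter> R b)" and "d = card (Q \<inter> (X b \<inter> R b))"
    have dq: "d \<le> q" unfolding d_def q_def using assms(2) by (intro card_mono) auto
    have "card (Q \<inter> R t) \<le> q - d" if "t \<in> I" for t
    proof -
      have "R t \<subseteq> R b - X b" using insert that by auto
      hence "card (Q \<inter> R t) \<le> card ((Q \<inter> R b) - (Q \<inter> (X b \<inter> R b)))"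
        using assms(2) by (intro card_mono) auto
      also have "\<dots> = q - d" unfolding q_def d_def
        by (rule card_Diff_subset) (use assms(2) in auto)
      finally show ?thesis .
    qed
    hence "(\<Sum>t\<in>I. real (card (Q \<inter> (X t \<inter> R t))) / real (card (X t \<inter> R t))) \<le> harm (q - d)"
      using insert by auto
    moreover have "real d / real (card (X b \<inter> R b)) \<le> real d / real q"
    proof (cases "q = 0")
      case False
      have "q \<le> card (X b \<inter> R b)" using insert.prems by (auto simp: q_def)
      thus ?thesis using False by (intro divide_left_mono) auto
    qed (use dq in auto)
    moreover have "real d / real q \<le> harm q - harm (q - d)" by (rule diff_harm_ge[OF dq])
    moreover have "harm q \<le> (harm n :: real)"
      using insert.prems(1)[of b] unfolding harm_def q_def by (intro sum_mono2) auto
    ultimately show ?case using insert.hyps by (auto simp: d_def)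
  qed
  moreover have "card (Q \<inter> R t) \<le> n" for t
    using assms(2,3) by (meson card_mono inf_le1 order_trans)
  ultimately show ?thesis by (simp add: sum_greedy_price[OF assms(2)])
qed

lemma greedy_price_outside: "e \<notin> (\<Union>t\<in>I. R t) \<Longrightarrow> greedy_price I R X e = 0"
  unfolding greedy_price_def by (rule sum.neutral) auto

lemma greedy_price_nonneg: "0 \<le> greedy_price I R X e"
  unfolding greedy_price_def by (intro sum_nonneg) auto

section \<open>Elimination along a sample path\<close>

lemma two_times_ereal: "2 * ereal x = ereal (2 * x)"
  by (metis numeral_eq_ereal times_ereal.simps(1))

text \<open>One arbitrary sample path: neither a sampling rule nor a law of the rewards is assumed,
  so whatever is shown here can be applied outcome by outcome.\<close>

locale eprl_path =
  fixes M :: "('s::finite, 'a::finite) det_mdp" and \<sigma> \<delta> :: real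
    and p :: "nat \<Rightarrow> ('s, 'a) policy" and y :: "nat \<Rightarrow> nat \<Rightarrow> real"
  assumes wf: "wf_det_mdp M"
    and \<sigma>: "0 < \<sigma>" and \<delta>: "0 < \<delta>" "\<delta> < 1"
    and played: "\<And>t. 1 \<le> t \<Longrightarrow> p t \<in> policies M"
begin

abbreviation act :: "nat \<Rightarrow> nat \<Rightarrow> 's \<Rightarrow> 'a set" where "act \<equiv> active M \<sigma> \<delta> p y"
abbreviation vis :: "nat \<Rightarrow> nat \<Rightarrow> 's \<Rightarrow> 'a \<Rightarrow> nat" where "vis \<equiv> visits M p"
abbreviation remaining :: "nat \<Rightarrow> ('s, 'a) policy set" where "remaining \<equiv> remaining_policies M \<sigma> \<delta> p y"
abbreviation lev :: "nat \<Rightarrow> nat" where "lev \<equiv> level M \<sigma> \<delta> p y"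
abbreviation N :: real where "N \<equiv> real (num_triples M)"
abbreviation H :: real where "H \<equiv> real (horizon M)"

definition active_triples :: "nat \<Rightarrow> ('s \<times> 'a \<times> nat) set" where
  "active_triples t = {(s, a, h). h \<in> stages M \<and> a \<in> act t h s}"

text \<open>The real-valued radius behind \<open>bonus\<close>. At count 0 it is 0 by the convention
  for division while \<open>bonus\<close> is infinite, so positive counts are required wherever the
  two are exchanged.\<close>

definition rate :: "nat \<Rightarrow> real" where
  "rate n = sqrt (threshold M \<sigma> \<delta> n / real n)"

lemma N_ge_1: "1 \<le> N" using num_triples_pos[OF wf] by simp
lemma H_ge_1: "1 \<le> H" using wf by (simp add: wf_det_mdp_def)

lemma log_N_ge: "ln 4 \<le> ln (4 * N / \<delta>)"
proof -
  have "\<delta> * 1 \<le> 1 * N" using N_ge_1 \<delta> by (intro mult_mono) auto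
  thus ?thesis using N_ge_1 \<delta> by (simp add: field_simps)
qed

lemma threshold_eq: "1 \<le> n \<Longrightarrow> threshold M \<sigma> \<delta> n = 2 * \<sigma>\<^sup>2 * (ln (4 * N / \<delta>) + 2 * ln (real n))"
proof -
  assume n: "1 \<le> n"
  have "4 * (real n)\<^sup>2 * N / \<delta> = (4 * N / \<delta>) * (real n)\<^sup>2" by simp
  moreover have "ln ((4 * N / \<delta>) * (real n)\<^sup>2) = ln (4 * N / \<delta>) + 2 * ln (real n)"
    using n N_ge_1 \<delta> by (subst ln_mult) (auto simp: ln_realpow)
  ultimately show ?thesis by (simp only: threshold_def)
qed

lemma threshold_nonneg: "0 \<le> threshold M \<sigma> \<delta> n"
proof (cases "n = 0")
  case False
  hence "0 \<le> ln (real n)" by simp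
  thus ?thesis using False log_N_ge ln4_gt_1 by (simp add: threshold_eq)
qed (simp add: threshold_def)

lemma rate_nonneg: "0 \<le> rate n"
  by (simp add: rate_def threshold_nonneg)

lemma rate_antimono: "1 \<le> m \<Longrightarrow> m \<le> n \<Longrightarrow> rate n \<le> rate m"
proof -
  assume mn: "1 \<le> m" "m \<le> n"
  have "2 * \<sigma>\<^sup>2 * ((ln (4 * N / \<delta>) + 2 * ln (real n)) / real n)
      \<le> 2 * \<sigma>\<^sup>2 * ((ln (4 * N / \<delta>) + 2 * ln (real m)) / real m)"
    by (intro mult_left_mono log_square_over_antimono log_N_ge mn) simp
  thus ?thesis using mn by (simp add: rate_def threshold_eq)
qed

lemma bonus_pos: "0 < vis t h s a \<Longrightarrow> bonus M \<sigma> \<delta> p t h s a = ereal (rate (vis t h s a))"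
  by (simp add: bonus_def rate_def Let_def)

lemma bonus_0: "vis t h s a = 0 \<Longrightarrow> bonus M \<sigma> \<delta> p t h s a = \<infinity>"
  by (simp add: bonus_def)

lemma active_Suc_subset: "act (Suc t) h s \<subseteq> act t h s"
  by auto

lemma active_antimono: "t \<le> t' \<Longrightarrow> act t' h s \<subseteq> act t h s"
  by (induction t' rule: dec_induct) (use active_Suc_subset in \<open>blast+\<close>)

lemma active_avail: "a \<in> act t h s \<Longrightarrow> s \<in> reachable M h \<and> a \<in> avail M h s"
  using active_antimono[of 0 t h s] by (auto split: if_splits)

lemma active_triples_subset: "active_triples t \<subseteq> triples M"
  using active_avail by (auto simp: active_triples_def triples_def)

lemma finite_active_triples [simp]: "finite (active_triples t)"
  by (rule finite_subset[OF active_triples_subset]) simp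

lemma active_triples_antimono: "t \<le> t' \<Longrightarrow> active_triples t' \<subseteq> active_triples t"
  using active_antimono by (fastforce simp: active_triples_def)

lemma active_triples_0: "active_triples 0 = triples M"
  by (auto simp: active_triples_def triples_def)

lemma remaining_subset: "remaining t \<subseteq> policies M"
  by (auto simp: remaining_policies_def compatible_policies_def)

lemma remaining_nonempty: "remaining t \<noteq> {}"
proof -
  obtain \<pi> where \<pi>: "\<pi> \<in> policies M" using wf by (auto simp: wf_det_mdp_def)
  have "act t h s \<subseteq> avail M h s" for h s using active_avail by blast
  from compatible_policy_exists[OF \<pi> this] obtain \<pi>' where "\<pi>' \<in> compatible_policies M (act t)"
    by metis
  thus ?thesis by (auto simp: remaining_policies_def)
qed

lemma finite_remaining [simp]: "finite (remaining t)"
  by (rule finite_subset[OF remaining_subset]) simp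

text \<open>Comparing two maxima amounts to naming one policy through the triple whose upper value
  beats every lower value. That policy is the witness in all survival arguments, and the finite
  quantifiers make the active sets measurable.\<close>

lemma active_Suc_iff:
  "a \<in> act (Suc t) h s \<longleftrightarrow> a \<in> act t h s \<and>
     (\<exists>\<pi>\<in>policies_through M s a h \<inter> remaining t. \<forall>\<pi>'\<in>policies M.
        lower_value M \<sigma> \<delta> p y (Suc t) \<pi>' \<le> upper_value M \<sigma> \<delta> p y (Suc t) \<pi>)"
proof -
  let ?X = "policies_through M s a h \<inter> remaining t"
  let ?u = "upper_value M \<sigma> \<delta> p y (Suc t)" and ?l = "lower_value M \<sigma> \<delta> p y (Suc t)"
  have ne: "policies M \<noteq> {}" using wf by (auto simp: wf_det_mdp_def)
  have "(?X \<noteq> {} \<and> Max (?l ` policies M) \<le> Max (?u ` ?X)) \<longleftrightarrow> (\<exists>\<pi>\<in>?X. \<forall>\<pi>'\<in>policies M. ?l \<pi>' \<le> ?u \<pi>)"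
  proof (cases "?X = {}")
    case False
    have "Max (?l ` policies M) \<le> Max (?u ` ?X) \<longleftrightarrow> (\<exists>\<pi>\<in>?X. Max (?l ` policies M) \<le> ?u \<pi>)"
      by (subst Max_ge_iff) (use False in auto)
    also have "\<dots> \<longleftrightarrow> (\<exists>\<pi>\<in>?X. \<forall>\<pi>'\<in>policies M. ?l \<pi>' \<le> ?u \<pi>)"
      using ne by (simp add: Max_le_iff)
    finally show ?thesis using False by blast
  qed blast
  thus ?thesis by (simp add: remaining_policies_def Let_def)
qed

lemma stop_cond_iff:
  "stop_cond M \<sigma> \<epsilon> \<delta> p y t \<longleftrightarrow>
     (\<forall>\<pi>\<in>remaining t. 2 * bonus_sum M \<sigma> \<delta> p t \<pi> \<le> ereal \<epsilon>) \<or>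
     (\<forall>h\<in>stages M. \<forall>s\<in>reachable M h. card (act t h s) \<le> 1)"
  unfolding stop_cond_def using remaining_nonempty by (subst Max_le_iff) auto

lemma policy_value_le_opt: "\<pi> \<in> policies M \<Longrightarrow> policy_value M \<pi> \<le> opt_value M"
  unfolding opt_value_def by (rule Max_ge) auto

lemma optimal_policy_exists: obtains \<pi> where "\<pi> \<in> policies M" "policy_value M \<pi> = opt_value M"
proof -
  have "opt_value M \<in> policy_value M ` policies M"
    unfolding opt_value_def by (rule Max_in) (use wf in \<open>auto simp: wf_det_mdp_def\<close>)
  thus ?thesis using that by auto
qed

lemma return_gap_le:
  "\<pi> \<in> policies_through M s a h \<Longrightarrow> return_gap M h s a \<le> opt_value M - policy_value M \<pi>"
  unfolding return_gap_def using Max_ge[of "policy_value M ` policies_through M s a h" "policy_value M \<pi>"]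
  by simp

lemma return_gap_attained:
  assumes "(s, a, h) \<in> triples M"
  obtains \<pi> where "\<pi> \<in> policies_through M s a h" "return_gap M h s a = opt_value M - policy_value M \<pi>"
proof -
  have "Max (policy_value M ` policies_through M s a h) \<in> policy_value M ` policies_through M s a h"
    by (rule Max_in) (use policies_through_nonempty[OF assms] in auto)
  thus ?thesis using that by (auto simp: return_gap_def)
qed

text \<open>With a unique optimal trajectory two distinct actions at the same state and stage cannot
  both have gap 0, since the gaps are attained by policies that would both be optimal and disagree
  there. In the other cases \<open>min_gap\<close> is 0, and gaps are nonnegative.\<close>

lemma min_gap_le:
  assumes "h \<in> stages M" "s \<in> reachable M h" "a1 \<in> avail M h s" "a2 \<in> avail M h s" "a1 \<noteq> a2"
  shows "min_gap M \<le> max (return_gap M h s a1) (return_gap M h s a2)"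
proof -
  have trip: "(s, a1, h) \<in> triples M" "(s, a2, h) \<in> triples M" using assms by (auto simp: triples_def)
  obtain \<pi>1 where 1: "\<pi>1 \<in> policies_through M s a1 h" "return_gap M h s a1 = opt_value M - policy_value M \<pi>1"
    by (rule return_gap_attained[OF trip(1)])
  obtain \<pi>2 where 2: "\<pi>2 \<in> policies_through M s a2 h" "return_gap M h s a2 = opt_value M - policy_value M \<pi>2"
    by (rule return_gap_attained[OF trip(2)])
  have mem: "\<pi>1 \<in> policies M" "\<pi>2 \<in> policies M" "action_at M \<pi>1 h = a1" "action_at M \<pi>2 h = a2"
    using 1 2 by (auto simp: policies_through_def)
  have g0: "0 \<le> return_gap M h s a1" "0 \<le> return_gap M h s a2"
    using 1 2 mem policy_value_le_opt by auto
  show ?thesis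
  proof (cases "unique_opt_trajectory M \<and> positive_gaps M \<noteq> {}")
    case True
    have "\<not> (return_gap M h s a1 = 0 \<and> return_gap M h s a2 = 0)"
    proof
      assume "return_gap M h s a1 = 0 \<and> return_gap M h s a2 = 0"
      hence "policy_value M \<pi>1 = opt_value M" "policy_value M \<pi>2 = opt_value M" using 1 2 by auto
      hence "action_at M \<pi>1 h = action_at M \<pi>2 h"
        using True mem assms(1) unfolding unique_opt_trajectory_def by blast
      thus False using mem assms by simp
    qed
    then obtain a where a: "a \<in> {a1, a2}" "0 < return_gap M h s a" using g0 by fastforce
    have fin: "finite (positive_gaps M)"
      by (rule finite_subset[of _ "(\<lambda>(s, a, h). return_gap M h s a) ` triples M"])
        (auto simp: positive_gaps_def intro!: rev_image_eqI)
    have "return_gap M h s a \<in> positive_gaps M" using a trip by (auto simp: positive_gaps_def)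
    hence "min_gap M \<le> return_gap M h s a" using True fin by (simp add: min_gap_def)
    thus ?thesis using a by auto
  qed (use g0 in \<open>auto simp: min_gap_def\<close>)
qed

end

section \<open>Elimination on the event that all confidence intervals hold\<close>

locale concentrated_path = eprl_path M \<sigma> \<delta> p y
  for M :: "('s::finite, 'a::finite) det_mdp" and \<sigma> \<delta> p y +
  assumes concentrated: "\<And>t s a h. (s, a, h) \<in> triples M \<Longrightarrow> 0 < vis t h s a \<Longrightarrow>
    \<bar>est_reward M p y t h s a - mean_reward M h s a\<bar> \<le> rate (vis t h s a)"
begin

text \<open>Stage by stage: a visited triple has its mean in the interval, and an unvisited one has
  an infinite bonus.\<close>

lemma policy_value_le_upper:
  assumes "\<pi> \<in> policies M"
  shows "ereal (policy_value M \<pi>) \<le> upper_value M \<sigma> \<delta> p y t \<pi>"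
  unfolding policy_value_def upper_value_def sum_ereal[symmetric]
proof (rule sum_mono)
  fix h assume h: "h \<in> stages M"
  let ?s = "state_at M \<pi> h" and ?a = "action_at M \<pi> h"
  have tr: "(?s, ?a, h) \<in> triples M"
    using trajectory_subset_triples[OF assms] h by (auto simp: mem_trajectory)
  show "ereal (mean_reward M h ?s ?a) \<le> ereal (est_reward M p y t h ?s ?a) + bonus M \<sigma> \<delta> p t h ?s ?a"
    using concentrated[OF tr, of t] by (cases "vis t h ?s ?a = 0") (auto simp: bonus_0 bonus_pos)
qed

lemma lower_le_policy_value:
  assumes "\<pi> \<in> policies M"
  shows "lower_value M \<sigma> \<delta> p y t \<pi> \<le> ereal (policy_value M \<pi>)"
  unfolding policy_value_def lower_value_def sum_ereal[symmetric]
proof (rule sum_mono)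
  fix h assume h: "h \<in> stages M"
  let ?s = "state_at M \<pi> h" and ?a = "action_at M \<pi> h"
  have tr: "(?s, ?a, h) \<in> triples M"
    using trajectory_subset_triples[OF assms] h by (auto simp: mem_trajectory)
  show "ereal (est_reward M p y t h ?s ?a) - bonus M \<sigma> \<delta> p t h ?s ?a \<le> ereal (mean_reward M h ?s ?a)"
    using concentrated[OF tr, of t] by (cases "vis t h ?s ?a = 0") (auto simp: bonus_0 bonus_pos)
qed

lemma lower_le_opt: "\<pi> \<in> policies M \<Longrightarrow> lower_value M \<sigma> \<delta> p y t \<pi> \<le> ereal (opt_value M)"
  using lower_le_policy_value[of \<pi> t] policy_value_le_opt[of \<pi>] by (meson ereal_less_eq(3) order_trans)

lemma stage_sum_const: "(\<Sum>h\<in>stages M. c) = H * (c::real)"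
  by (simp add: stages_def)

context
  fixes t m \<pi>
  assumes m: "1 \<le> m" and \<pi>: "\<pi> \<in> policies M"
    and visited: "\<And>s a h. (s, a, h) \<in> trajectory M \<pi> \<Longrightarrow> m \<le> vis t h s a"
begin

lemma visited_stage:
  assumes "h \<in> stages M"
  shows "m \<le> vis t h (state_at M \<pi> h) (action_at M \<pi> h)"
    "(state_at M \<pi> h, action_at M \<pi> h, h) \<in> triples M"
    "bonus M \<sigma> \<delta> p t h (state_at M \<pi> h) (action_at M \<pi> h)
      = ereal (rate (vis t h (state_at M \<pi> h) (action_at M \<pi> h)))"
    "rate (vis t h (state_at M \<pi> h) (action_at M \<pi> h)) \<le> rate m"
proof -
  show v: "m \<le> vis t h (state_at M \<pi> h) (action_at M \<pi> h)"
    using visited assms by (simp add: mem_trajectory)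
  show "(state_at M \<pi> h, action_at M \<pi> h, h) \<in> triples M"
    using trajectory_subset_triples[OF \<pi>] assms by (auto simp: mem_trajectory)
  show "bonus M \<sigma> \<delta> p t h (state_at M \<pi> h) (action_at M \<pi> h)
      = ereal (rate (vis t h (state_at M \<pi> h) (action_at M \<pi> h)))"
    using v m by (intro bonus_pos) simp
  show "rate (vis t h (state_at M \<pi> h) (action_at M \<pi> h)) \<le> rate m"
    using v m by (rule rate_antimono[rotated])
qed

lemma bonus_sum_le: "bonus_sum M \<sigma> \<delta> p t \<pi> \<le> ereal (H * rate m)"
  unfolding bonus_sum_def stage_sum_const[symmetric] sum_ereal[symmetric]
  by (rule sum_mono) (simp add: visited_stage)

text \<open>Each stage costs two radii: the estimate may exceed the mean by one, and the bonus adds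
  another. Antitonicity of \<open>rate\<close> replaces the individual counts by their common lower
  bound \<open>m\<close>.\<close>

lemma upper_le: "upper_value M \<sigma> \<delta> p y t \<pi> \<le> ereal (policy_value M \<pi> + 2 * H * rate m)"
proof -
  have "upper_value M \<sigma> \<delta> p y t \<pi>
      \<le> (\<Sum>h\<in>stages M. ereal (mean_reward M h (state_at M \<pi> h) (action_at M \<pi> h) + 2 * rate m))"
    unfolding upper_value_def
  proof (rule sum_mono)
    fix h assume h: "h \<in> stages M"
    show "ereal (est_reward M p y t h (state_at M \<pi> h) (action_at M \<pi> h))
       + bonus M \<sigma> \<delta> p t h (state_at M \<pi> h) (action_at M \<pi> h)
       \<le> ereal (mean_reward M h (state_at M \<pi> h) (action_at M \<pi> h) + 2 * rate m)"
      using concentrated[OF visited_stage(2)[OF h], of t] visited_stage(1,3,4)[OF h] m by auto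
  qed
  also have "\<dots> = ereal (policy_value M \<pi> + 2 * H * rate m)"
    unfolding sum_ereal sum.distrib policy_value_def by (simp add: stage_sum_const del: sum_constant)
  finally show ?thesis .
qed

lemma lower_ge: "ereal (policy_value M \<pi> - 2 * H * rate m) \<le> lower_value M \<sigma> \<delta> p y t \<pi>"
proof -
  have "ereal (policy_value M \<pi> - 2 * H * rate m)
     = (\<Sum>h\<in>stages M. ereal (mean_reward M h (state_at M \<pi> h) (action_at M \<pi> h) - 2 * rate m))"
    unfolding sum_ereal sum_subtractf policy_value_def by (simp add: stage_sum_const del: sum_constant)
  also have "\<dots> \<le> lower_value M \<sigma> \<delta> p y t \<pi>"
    unfolding lower_value_def
  proof (rule sum_mono)
    fix h assume h: "h \<in> stages M"
    show "ereal (mean_reward M h (state_at M \<pi> h) (action_at M \<pi> h) - 2 * rate m)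
       \<le> ereal (est_reward M p y t h (state_at M \<pi> h) (action_at M \<pi> h))
       - bonus M \<sigma> \<delta> p t h (state_at M \<pi> h) (action_at M \<pi> h)"
      using concentrated[OF visited_stage(2)[OF h], of t] visited_stage(1,3,4)[OF h] m by auto
  qed
  finally show ?thesis .
qed

end

lemma upper_value_trajectory:
  assumes "trajectory M \<pi>' = trajectory M \<pi>"
  shows "upper_value M \<sigma> \<delta> p y t \<pi>' = upper_value M \<sigma> \<delta> p y t \<pi>"
  unfolding upper_value_def by (rule sum.cong) (simp_all add: trajectory_eqD[OF assms])

text \<open>The same policy is a witness for every triple it visits, so the triples of its
  trajectory survive the round together.\<close>

lemma active_triples_Suc_I:
  assumes "trajectory M \<pi> \<subseteq> active_triples t" "\<pi> \<in> remaining t"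
    and "\<And>\<pi>'. \<pi>' \<in> policies M \<Longrightarrow>
      lower_value M \<sigma> \<delta> p y (Suc t) \<pi>' \<le> upper_value M \<sigma> \<delta> p y (Suc t) \<pi>"
  shows "trajectory M \<pi> \<subseteq> active_triples (Suc t)"
proof clarify
  fix s a h assume e: "(s, a, h) \<in> trajectory M \<pi>"
  hence h: "h \<in> stages M" by (simp add: mem_trajectory)
  have "\<pi> \<in> policies_through M s a h"
    using e assms(2) remaining_subset by (auto simp: policies_through_eq[OF h])
  moreover have "a \<in> act t h s" using e assms(1) by (auto simp: active_triples_def)
  ultimately have "a \<in> act (Suc t) h s" unfolding active_Suc_iff using assms(2,3) by blast
  thus "(s, a, h) \<in> active_triples (Suc t)" using h by (simp add: active_triples_def del: active.simps)
qed

text \<open>An optimal policy may prescribe eliminated actions at states off its own path and thus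
  leave the remaining set. It is replaced by a compatible policy with the same trajectory, hence the
  same upper value, which is at least the optimum and so at least every lower value.\<close>

lemma optimal_active:
  assumes "\<pi> \<in> policies M" "policy_value M \<pi> = opt_value M"
  shows "trajectory M \<pi> \<subseteq> active_triples t"
proof (induction t)
  case 0
  show ?case using trajectory_subset_triples[OF assms(1)] by (simp add: active_triples_0)
next
  case (Suc t)
  have "act t h s \<subseteq> avail M h s" for h s using active_avail by blast
  from compatible_policy_exists[OF assms(1) this] obtain \<pi>' where \<pi>': "\<pi>' \<in> remaining t"
    "\<And>h s. h \<in> stages M \<Longrightarrow> \<pi> h s \<in> act t h s \<Longrightarrow> \<pi>' h s = \<pi> h s"
    unfolding remaining_policies_def by metis
  have tr: "trajectory M \<pi>' = trajectory M \<pi>"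
  proof (rule trajectory_cong)
    fix h assume h: "h \<in> stages M"
    hence "(state_at M \<pi> h, action_at M \<pi> h, h) \<in> active_triples t"
      using Suc by (auto simp: mem_trajectory)
    thus "\<pi>' h (state_at M \<pi> h) = \<pi> h (state_at M \<pi> h)"
      by (intro \<pi>'(2) h) (simp add: active_triples_def action_at_def)
  qed
  have "lower_value M \<sigma> \<delta> p y (Suc t) \<pi>'' \<le> upper_value M \<sigma> \<delta> p y (Suc t) \<pi>'" if "\<pi>'' \<in> policies M" for \<pi>''
    using order_trans[OF lower_le_opt[OF that] policy_value_le_upper[OF assms(1), unfolded assms(2)]]
    by (simp add: upper_value_trajectory[OF tr])
  from active_triples_Suc_I[OF _ \<pi>'(1) this] show ?case using Suc tr by simp
qed

lemma active_triples_nonempty: "active_triples t \<noteq> {}"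
proof -
  obtain \<pi> where "\<pi> \<in> policies M" "policy_value M \<pi> = opt_value M" by (rule optimal_policy_exists)
  from optimal_active[OF this, of t] show ?thesis
    using H_ge_1 card_trajectory[of M \<pi>] by auto
qed

text \<open>The witness that keeps a triple active keeps its whole trajectory active, so an active triple
  always leads to a state with active actions.\<close>

lemma remaining_active:
  "\<pi> \<in> remaining t \<Longrightarrow> trajectory M \<pi> \<subseteq> active_triples t"
proof (induction t arbitrary: \<pi>)
  case 0
  thus ?case using trajectory_subset_triples remaining_subset by (auto simp: active_triples_0)
next
  case (Suc t)
  have succ: "\<exists>\<pi>'. trajectory M \<pi>' \<subseteq> active_triples (Suc t) \<and> (s, a, h) \<in> trajectory M \<pi>'"
    if "(s, a, h) \<in> active_triples (Suc t)" for s a h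
  proof -
    have h: "h \<in> stages M" using that by (simp add: active_triples_def)
    have "a \<in> act (Suc t) h s" using that by (simp add: active_triples_def del: active.simps)
    then obtain \<pi>' where "\<pi>' \<in> policies_through M s a h" "\<pi>' \<in> remaining t"
      "\<And>\<pi>''. \<pi>'' \<in> policies M \<Longrightarrow>
        lower_value M \<sigma> \<delta> p y (Suc t) \<pi>'' \<le> upper_value M \<sigma> \<delta> p y (Suc t) \<pi>'"
      unfolding active_Suc_iff by blast
    from active_triples_Suc_I[OF Suc.IH[OF this(2)] this(2,3)] this(1) show ?thesis
      using h by (auto simp: policies_through_eq)
  qed
  have compat: "\<pi> h s \<in> act (Suc t) h s" if "h \<in> stages M" "act (Suc t) h s \<noteq> {}" for h s
    using Suc.prems that by (auto simp: remaining_policies_def compatible_policies_def simp del: active.simps)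
  \<comment> \<open>A remaining policy takes an active action wherever one exists, so it suffices
    that the state reached has one. At the first stage an optimal trajectory supplies it; later the
    witness of the preceding triple passes through the same state.\<close>
  have "(state_at M \<pi> h, action_at M \<pi> h, h) \<in> active_triples (Suc t)" if "h \<in> stages M" for h
    using that
  proof (induction h)
    case (Suc h)
    have "act (Suc t) (Suc h) (state_at M \<pi> (Suc h)) \<noteq> {}"
    proof (cases "h = 0")
      case True
      obtain \<pi>' where "\<pi>' \<in> policies M" "policy_value M \<pi>' = opt_value M" by (rule optimal_policy_exists)
      from optimal_active[OF this, of "Suc t"] show ?thesis
        using Suc.prems True by (auto simp: trajectory_def active_triples_def simp del: active.simps)
    next
      case False
      hence h: "h \<in> stages M" "1 \<le> h" using Suc.prems by (auto simp: stages_def)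
      from succ[OF Suc.IH[OF h(1)]] obtain \<pi>' where \<pi>': "trajectory M \<pi>' \<subseteq> active_triples (Suc t)"
        "state_at M \<pi>' h = state_at M \<pi> h" "action_at M \<pi>' h = action_at M \<pi> h"
        by (auto simp: mem_trajectory)
      hence "state_at M \<pi>' (Suc h) = state_at M \<pi> (Suc h)" using h by (simp add: state_at_Suc)
      moreover have "(state_at M \<pi>' (Suc h), action_at M \<pi>' (Suc h), Suc h) \<in> active_triples (Suc t)"
        using \<pi>'(1) Suc.prems by (auto simp: mem_trajectory)
      ultimately show ?thesis by (auto simp: active_triples_def simp del: active.simps)
    qed
    thus ?case using compat[OF Suc.prems] Suc.prems
      by (simp add: active_triples_def action_at_def del: active.simps)
  qed (simp add: stages_def)
  thus ?case by (auto simp: trajectory_def)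
qed

lemma active_witness:
  assumes "1 \<le> t" "(s, a, h) \<in> active_triples t"
  obtains \<pi> where "\<pi> \<in> policies_through M s a h" "\<pi> \<in> policies M" "trajectory M \<pi> \<subseteq> active_triples t"
    "\<And>\<pi>'. \<pi>' \<in> policies M \<Longrightarrow> lower_value M \<sigma> \<delta> p y t \<pi>' \<le> upper_value M \<sigma> \<delta> p y t \<pi>"
proof -
  obtain t' where t: "t = Suc t'" using assms(1) by (cases t) auto
  have "a \<in> act (Suc t') h s" using assms(2) t by (simp add: active_triples_def del: active.simps)
  then obtain \<pi> where \<pi>: "\<pi> \<in> policies_through M s a h" "\<pi> \<in> remaining t'"
    "\<And>\<pi>'. \<pi>' \<in> policies M \<Longrightarrow> lower_value M \<sigma> \<delta> p y t \<pi>' \<le> upper_value M \<sigma> \<delta> p y t \<pi>"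
    unfolding active_Suc_iff t by blast
  have "trajectory M \<pi> \<subseteq> active_triples t"
    using active_triples_Suc_I[OF remaining_active[OF \<pi>(2)] \<pi>(2)] \<pi>(3) t by simp
  moreover have "\<pi> \<in> policies M" using \<pi>(2) remaining_subset by auto
  ultimately show ?thesis using \<pi>(1,3) by (intro that)
qed

text \<open>The lower value of an optimal policy is at most the upper value of the witness, and each
  lies within \<open>2 * H * rate m\<close> of the true value, since both trajectories are active
  and hence visited at least \<open>m\<close> times.\<close>

lemma return_gap_le_rate:
  assumes "1 \<le> t" "(s, a, h) \<in> active_triples t" "1 \<le> m"
    and m: "\<And>s a h. (s, a, h) \<in> active_triples t \<Longrightarrow> m \<le> vis t h s a"
  shows "return_gap M h s a \<le> 4 * H * rate m"
proof -
  obtain \<pi> where \<pi>: "\<pi> \<in> policies_through M s a h" "\<pi> \<in> policies M" "trajectory M \<pi> \<subseteq> active_triples t"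
    "\<And>\<pi>'. \<pi>' \<in> policies M \<Longrightarrow> lower_value M \<sigma> \<delta> p y t \<pi>' \<le> upper_value M \<sigma> \<delta> p y t \<pi>"
    using active_witness[OF assms(1,2)] by metis
  obtain \<pi>' where \<pi>': "\<pi>' \<in> policies M" "policy_value M \<pi>' = opt_value M" by (rule optimal_policy_exists)
  have "ereal (policy_value M \<pi>' - 2 * H * rate m) \<le> lower_value M \<sigma> \<delta> p y t \<pi>'"
    by (rule lower_ge[OF assms(3) \<pi>'(1)]) (use optimal_active[OF \<pi>', of t] m in blast)
  also have "\<dots> \<le> upper_value M \<sigma> \<delta> p y t \<pi>" by (rule \<pi>(4)[OF \<pi>'(1)])
  also have "\<dots> \<le> ereal (policy_value M \<pi> + 2 * H * rate m)"
    by (rule upper_le[OF assms(3) \<pi>(2)]) (use \<pi>(3) m in blast)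
  finally have "opt_value M - policy_value M \<pi> \<le> 4 * H * rate m" using \<pi>'(2) by simp
  with return_gap_le[OF \<pi>(1)] show ?thesis by simp
qed

text \<open>A run that continues has failed both stopping tests. The width test bounds \<epsilon>,
  since remaining policies have active trajectories; the cardinality test yields a state with two
  active actions, and \<open>min_gap\<close> is at most the larger of their two gaps.\<close>

lemma eff_gap_le_rate:
  assumes t: "1 \<le> t" and e: "(s, a, h) \<in> active_triples t" and m1: "1 \<le> m"
    and m: "\<And>s a h. (s, a, h) \<in> active_triples t \<Longrightarrow> m \<le> vis t h s a"
    and ns: "\<not> stop_cond M \<sigma> \<epsilon> \<delta> p y t"
  shows "eff_gap M \<epsilon> h s a \<le> 4 * H * rate m"
proof -
  note gap = return_gap_le_rate[OF t _ m1 m]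
  obtain \<pi> where \<pi>: "\<pi> \<in> remaining t" "ereal \<epsilon> < 2 * bonus_sum M \<sigma> \<delta> p t \<pi>"
    using ns by (auto simp: stop_cond_iff not_le)
  have "\<pi> \<in> policies M" using \<pi>(1) remaining_subset by auto
  hence b: "bonus_sum M \<sigma> \<delta> p t \<pi> \<le> ereal (H * rate m)"
    by (rule bonus_sum_le[OF m1]) (use remaining_active[OF \<pi>(1)] m in blast)
  have "2 * bonus_sum M \<sigma> \<delta> p t \<pi> \<le> 2 * ereal (H * rate m)"
    by (rule ereal_mult_left_mono[OF b]) simp
  hence "ereal \<epsilon> < 2 * ereal (H * rate m)" using \<pi>(2) by (rule less_le_trans[rotated])
  also have "\<dots> = ereal (2 * (H * rate m))" by (rule two_times_ereal)
  finally have "\<epsilon> \<le> 2 * (H * rate m)" by simp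
  moreover have "0 \<le> H * rate m" by (simp add: rate_nonneg)
  ultimately have eps: "\<epsilon> \<le> 4 * H * rate m" by simp
  obtain h' s' where hs: "h' \<in> stages M" "s' \<in> reachable M h'" "\<not> card (act t h' s') \<le> 1"
    using ns by (auto simp: stop_cond_iff)
  then obtain a1 a2 where a: "a1 \<in> act t h' s'" "a2 \<in> act t h' s'" "a1 \<noteq> a2"
    by (metis card_le_Suc0_iff_eq One_nat_def finite)
  have "min_gap M \<le> max (return_gap M h' s' a1) (return_gap M h' s' a2)"
    by (rule min_gap_le) (use hs a active_avail in auto)
  also have "\<dots> \<le> 4 * H * rate m"
    using gap[of s' a1 h'] gap[of s' a2 h'] a hs by (auto simp: active_triples_def)
  finally show ?thesis using gap[OF e] eps by (simp add: eff_gap_def)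
qed

section \<open>Levels and their bound by the lower bound function\<close>

lemma level_eq: "lev t = Min ((\<lambda>(s, a, h). vis (t - 1) h s a) ` active_triples (t - 1)) + 1"
proof -
  have eq: "active_triples (t - 1) = {(s, a, h). h \<in> stages M \<and> s \<in> reachable M h \<and> a \<in> act (t - 1) h s}"
    using active_avail[of _ "t - 1"] by (auto simp: active_triples_def)
  have "{vis (t - 1) h s a | h s a. h \<in> stages M \<and> s \<in> reachable M h \<and> a \<in> act (t - 1) h s}
      = (\<lambda>(s, a, h). vis (t - 1) h s a) ` active_triples (t - 1)"
    unfolding eq by (force simp: image_iff)
  thus ?thesis by (simp add: level_def)
qed

lemma level_le: "(s, a, h) \<in> active_triples (t - 1) \<Longrightarrow> lev t \<le> vis (t - 1) h s a + 1"
  unfolding level_eq add_le_cancel_right by (rule Min_le) (auto intro: rev_image_eqI)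

lemma level_attained:
  obtains s a h where "(s, a, h) \<in> active_triples (t - 1)" "lev t = vis (t - 1) h s a + 1"
proof -
  have "Min ((\<lambda>(s, a, h). vis (t - 1) h s a) ` active_triples (t - 1))
      \<in> (\<lambda>(s, a, h). vis (t - 1) h s a) ` active_triples (t - 1)"
    by (rule Min_in) (auto simp: active_triples_nonempty)
  thus ?thesis using that by (auto simp: level_eq)
qed

text \<open>The active set shrinks and the counts grow, so the minimum of the counts can only
  rise.\<close>

lemma level_mono: "t \<le> t' \<Longrightarrow> lev t \<le> lev t'"
proof -
  assume tt: "t \<le> t'"
  obtain s a h where e: "(s, a, h) \<in> active_triples (t' - 1)" "lev t' = vis (t' - 1) h s a + 1"
    by (rule level_attained)
  have "(s, a, h) \<in> active_triples (t - 1)"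
    using active_triples_antimono[OF diff_le_mono[OF tt, of 1]] e(1) by blast
  from level_le[OF this] show ?thesis
    using visits_mono[OF diff_le_mono[OF tt, of 1], of M p h s a] e(2) by simp
qed

lemma level_pos: "1 \<le> lev t"
  by (simp add: level_def)

lemma log_N3:
  shows "1 < ln (4 * N ^ 3 / \<delta>)" "ln (4 * N / \<delta>) \<le> ln (4 * N ^ 3 / \<delta>)"
proof -
  have "N ^ 1 \<le> N ^ 3" by (rule power_increasing) (use N_ge_1 in auto)
  hence "4 * N / \<delta> \<le> 4 * N ^ 3 / \<delta>" using \<delta> by (intro divide_right_mono) auto
  thus "ln (4 * N / \<delta>) \<le> ln (4 * N ^ 3 / \<delta>)"
    by (rule ln_mono) (use N_ge_1 \<delta> in simp)
  thus "1 < ln (4 * N ^ 3 / \<delta>)" using log_N_ge ln4_gt_1 by simp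
qed

text \<open>Eight logarithms become four logarithms of a square, which is the shape produced by
  \<open>level_inversion\<close>; the constants match because 8 times 32 is the square of
  16.\<close>

lemma lower_bound_fun_eq:
  fixes h s a
  assumes "0 < \<epsilon>"
  defines "X \<equiv> 32 * \<sigma>\<^sup>2 * H\<^sup>2 / (eff_gap M \<epsilon> h s a)\<^sup>2"
  shows "lower_bound_fun M \<sigma> \<epsilon> \<delta> h s a
    = X * (ln (4 * N ^ 3 / \<delta>) + 4 * ln (8 * X * (ln (4 * N ^ 3 / \<delta>))\<^sup>2)) + 2" "0 < X"
proof -
  let ?l = "ln (4 * N ^ 3 / \<delta>)" and ?g = "eff_gap M \<epsilon> h s a"
  have g: "0 < ?g" using assms(1) by (simp add: eff_gap_def)
  have pos: "0 < 16 * \<sigma> * H * ?l / ?g"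
    using g \<sigma> H_ge_1 log_N3 by simp
  have "8 * X * ?l\<^sup>2 = (16 * \<sigma> * H * ?l / ?g)\<^sup>2"
    by (simp add: X_def power_mult_distrib power_divide)
  hence "4 * ln (8 * X * ?l\<^sup>2) = 8 * ln (16 * \<sigma> * H * ?l / ?g)"
    using pos by (simp only: ln_realpow)
  thus "lower_bound_fun M \<sigma> \<epsilon> \<delta> h s a = X * (?l + 4 * ln (8 * X * ?l\<^sup>2)) + 2"
    by (simp add: lower_bound_fun_def log_term_def X_def)
  show "0 < X" using g \<sigma> H_ge_1 by (simp add: X_def)
qed

lemma lower_bound_fun_ge_1:
  assumes "0 < \<epsilon>" shows "1 \<le> lower_bound_fun M \<sigma> \<epsilon> \<delta> h s a"
  using log_correction_ge[OF lower_bound_fun_eq(2)[OF assms, of h s a] log_N3(1)]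
  unfolding lower_bound_fun_eq(1)[OF assms] by linarith

text \<open>With \<open>m = lev t - 1\<close> every active triple has at least \<open>m\<close>
  visits after episode \<open>t - 1\<close>. Squaring the gap bound gives
  \<open>16 * H\<^sup>2\<close> times \<open>2 * \<sigma>\<^sup>2\<close>, the origin of the
  constant 32; the level itself is \<open>m + 1\<close>, which the additive constant of
  \<open>lower_bound_fun\<close> covers.\<close>

lemma level_le_lower_bound_fun:
  assumes \<epsilon>: "0 < \<epsilon>" and t: "1 \<le> t" "t = 1 \<or> \<not> stop_cond M \<sigma> \<epsilon> \<delta> p y (t - 1)"
    and e: "(s, a, h) \<in> active_triples (t - 1)"
  shows "real (lev t) \<le> lower_bound_fun M \<sigma> \<epsilon> \<delta> h s a"
proof (cases "lev t \<le> 1")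
  case True
  thus ?thesis using lower_bound_fun_ge_1[OF \<epsilon>, of h s a] by simp
next
  case False
  define m where "m = lev t - 1"
  have m: "1 \<le> m" "lev t = m + 1" using False by (auto simp: m_def)
  have vis: "m \<le> vis (t - 1) h s a" if "(s, a, h) \<in> active_triples (t - 1)" for s a h
    using level_le[OF that] m by simp
  have t1: "1 \<le> t - 1"
  proof (rule ccontr)
    assume "\<not> 1 \<le> t - 1"
    hence "vis (t - 1) h s a = 0" using visits_le[of M p "t - 1"] by simp
    thus False using vis[OF e] m by simp
  qed
  let ?g = "eff_gap M \<epsilon> h s a"
  have g: "0 < ?g" using \<epsilon> by (simp add: eff_gap_def)
  have "?g \<le> 4 * H * rate m"
    by (rule eff_gap_le_rate[OF t1 e m(1) vis]) (use t t1 in auto)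
  hence "?g\<^sup>2 \<le> (4 * H * rate m)\<^sup>2" using g by (intro power_mono) auto
  also have "\<dots> = 16 * H\<^sup>2 * (threshold M \<sigma> \<delta> m / real m)"
    by (simp add: power_mult_distrib rate_def threshold_nonneg)
  also have "\<dots> = 32 * \<sigma>\<^sup>2 * H\<^sup>2 * (ln (4 * N / \<delta>) + 2 * ln (real m)) / real m"
    using m by (simp add: threshold_eq)
  finally have "real m \<le> 32 * \<sigma>\<^sup>2 * H\<^sup>2 / ?g\<^sup>2 * (ln (4 * N / \<delta>) + 2 * ln (real m))"
    using g m by (simp add: field_simps)
  from level_inversion[OF m(1) lower_bound_fun_eq(2)[OF \<epsilon>] log_N_ge log_N3(2) this]
  show ?thesis unfolding lower_bound_fun_eq(1)[OF \<epsilon>] using m by simp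
qed

end

section \<open>Counting episodes\<close>

text \<open>The difference between the harmonic number and the logarithm decreases and equals 1 at
  \<open>n = 1\<close>.\<close>

lemma harm_le_ln: "1 \<le> n \<Longrightarrow> harm n \<le> ln (real n) + 1"
  using decseqD[OF decseq_harm_diff_ln, of 0 "n - 1"] by (simp add: harm_expand)

lemma inj_on_nat_less:
  assumes "\<And>i j :: nat. i \<in> A \<Longrightarrow> j \<in> A \<Longrightarrow> i < j \<Longrightarrow> f i \<noteq> f j"
  shows "inj_on f A"
  using assms by (metis inj_onI linorder_neqE_nat)

lemma card_odd: "card {t \<in> {1..T}. odd t} = (T + 1) div 2"
proof (induction T)
  case (Suc T)
  have "{t \<in> {1..Suc T}. odd t} = (if odd (Suc T) then insert (Suc T) {t \<in> {1..T}. odd t} else {t \<in> {1..T}. odd t})"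
    by (auto simp: le_Suc_eq)
  thus ?case using Suc by (auto elim: oddE)
qed simp

lemma card_even: "card {t \<in> {1..T}. even t} = T div 2"
proof (induction T)
  case (Suc T)
  have "{t \<in> {1..Suc T}. even t} = (if even (Suc T) then insert (Suc T) {t \<in> {1..T}. even t} else {t \<in> {1..T}. even t})"
    by (auto simp: le_Suc_eq)
  thus ?case using Suc by (auto elim: oddE)
qed simp

text \<open>The largest of finitely many positive integers is at least their number, so the sum is
  no larger than over an initial segment, where square roots telescope. It serves for the counts met
  by successive episodes through one triple, which are distinct.\<close>

lemma sum_inverse_sqrt_set_le:
  assumes "finite A" "0 \<notin> A"
  shows "(\<Sum>n\<in>A. 1 / sqrt (real n)) \<le> 2 * sqrt (real (card A))"
  using assms
proof (induction A rule: finite_linorder_max_induct)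
  case (insert b A)
  have "A \<subseteq> {1..<b}" using insert by (auto simp: Suc_le_eq intro!: Nat.gr0I)
  hence "card A \<le> card {1..<b}" by (intro card_mono) auto
  hence b: "Suc (card A) \<le> b" using insert.prems by (cases b) auto
  let ?x = "sqrt (real (card A))" and ?y = "sqrt (real (Suc (card A)))"
  have y: "0 < ?y" "?x \<le> ?y" "0 \<le> ?x" by auto
  have "1 = (?y - ?x) * (?y + ?x)"
    by (simp add: algebra_simps flip: power2_eq_square)
  also have "\<dots> \<le> (?y - ?x) * (2 * ?y)" using y by (intro mult_left_mono) auto
  finally have "1 / ?y \<le> 2 * (?y - ?x)" using y by (simp add: field_simps)
  moreover have "1 / sqrt (real b) \<le> 1 / ?y" using b by (intro divide_left_mono) auto
  moreover have "b \<notin> A" using insert.hyps by auto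
  ultimately show ?case using insert by simp
qed simp

text \<open>Episode \<open>T\<close> belongs to the run iff no earlier episode stopped; stopping at
  \<open>T\<close> itself is allowed. This form also covers runs that never stop.\<close>

lemma le_sample_complexity_iff:
  "enat T \<le> sample_complexity M \<sigma> \<epsilon> \<delta> p y \<longleftrightarrow> (\<forall>t. 1 \<le> t \<and> t < T \<longrightarrow> \<not> stop_cond M \<sigma> \<epsilon> \<delta> p y t)"
  unfolding sample_complexity_def le_INF_iff by (auto simp: not_less[symmetric])

context eprl_path
begin

lemma threshold_mono: "1 \<le> m \<Longrightarrow> m \<le> n \<Longrightarrow> threshold M \<sigma> \<delta> m \<le> threshold M \<sigma> \<delta> n"
  by (simp add: threshold_eq mult_left_mono)

lemma visits_played:
  assumes "1 \<le> t" "(s, a, h) \<in> trajectory M (p t)" "t < t'"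
  shows "vis (t - 1) h s a < vis (t' - 1) h s a"
proof -
  have "vis (Suc (t - 1)) h s a = vis (t - 1) h s a + 1"
    using assms by (subst visits_Suc) (auto simp: mem_trajectory)
  moreover have "vis (Suc (t - 1)) h s a \<le> vis (t' - 1) h s a"
    by (rule visits_mono) (use assms in auto)
  ultimately show ?thesis by simp
qed

section \<open>Even episodes: the total confidence width\<close>

context
  fixes T :: nat and \<epsilon> :: real
  assumes T: "1 \<le> T" and \<epsilon>: "0 < \<epsilon>"
    and running: "\<And>t. 1 \<le> t \<Longrightarrow> t < T \<Longrightarrow> \<not> stop_cond M \<sigma> \<epsilon> \<delta> p y t"
    and greedy_bonus: "\<And>t. 1 \<le> t \<Longrightarrow> t \<le> T \<Longrightarrow> even t \<Longrightarrow> max_bonus_choice M \<sigma> \<delta> p y t"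
begin

text \<open>Even episodes whose bonus sum is infinite. They are kept apart from
  \<open>shrinking\<close> because only finite radii can be summed.\<close>

definition exploring :: "nat set" where
  "exploring = {t \<in> {1..T}. even t \<and> (\<exists>(s, a, h)\<in>trajectory M (p t). vis (t - 1) h s a = 0)}"

definition shrinking :: "nat set" where
  "shrinking = {t \<in> {1..T}. even t \<and> (\<forall>(s, a, h)\<in>trajectory M (p t). 1 \<le> vis (t - 1) h s a)}"

text \<open>Each such episode is charged to a triple that it visits for the first time, and a first
  visit happens only once.\<close>

lemma card_exploring: "real (card exploring) \<le> N"
proof -
  have "\<forall>t\<in>exploring. \<exists>e. e \<in> trajectory M (p t) \<and> (case e of (s, a, h) \<Rightarrow> vis (t - 1) h s a = 0)"
    by (auto simp: exploring_def)
  then obtain e where e: "\<And>t. t \<in> exploring \<Longrightarrow> e t \<in> trajectory M (p t)"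
    "\<And>t. t \<in> exploring \<Longrightarrow> (case e t of (s, a, h) \<Rightarrow> vis (t - 1) h s a = 0)" by metis
  have "e t \<noteq> e t'" if "t \<in> exploring" "t' \<in> exploring" "t < t'" for t t'
  proof
    assume eq: "e t = e t'"
    obtain s a h where "e t = (s, a, h)" by (metis prod_cases3)
    with visits_played[of t s a h t'] e[OF that(1)] e[OF that(2)] eq that
    show False by (auto simp: exploring_def)
  qed
  hence "inj_on e exploring" by (rule inj_on_nat_less)
  moreover have "e t \<in> triples M" if "t \<in> exploring" for t
  proof -
    have "1 \<le> t" using that by (simp add: exploring_def)
    from trajectory_subset_triples[OF played[OF this]] e(1)[OF that] show ?thesis by auto
  qed
  ultimately have "card exploring \<le> card (triples M)"
    by (intro card_inj_on_le[of e]) auto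
  thus ?thesis by (simp add: num_triples_def)
qed

text \<open>The failed width test provides a remaining policy with bonus sum above
  \<open>\<epsilon> / 2\<close>, and the played policy maximises the bonus sum over the remaining
  ones. Replacing every threshold by the one at \<open>T\<close> leaves only inverse square roots of
  counts to be summed.\<close>

lemma shrinking_bonus:
  assumes t: "t \<in> shrinking"
  shows "\<epsilon> \<le> 2 * sqrt (threshold M \<sigma> \<delta> T) * (\<Sum>(s, a, h)\<in>trajectory M (p t). 1 / sqrt (real (vis (t - 1) h s a)))"
proof -
  let ?v = "\<lambda>h. vis (t - 1) h (state_at M (p t) h) (action_at M (p t) h)"
  have t1: "1 \<le> t - 1" "t - 1 < T" "1 \<le> t" "t \<le> T" "even t"
    using t unfolding shrinking_def by (auto elim!: evenE)
  have v1: "1 \<le> ?v h" if "h \<in> stages M" for h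
  proof -
    have "(state_at M (p t) h, action_at M (p t) h, h) \<in> trajectory M (p t)"
      using that by (simp add: mem_trajectory)
    with t show ?thesis unfolding shrinking_def by blast
  qed
  have "\<not> stop_cond M \<sigma> \<epsilon> \<delta> p y (t - 1)" by (rule running[OF t1(1,2)])
  hence "\<not> (\<forall>\<pi>\<in>remaining (t - 1). 2 * bonus_sum M \<sigma> \<delta> p (t - 1) \<pi> \<le> ereal \<epsilon>)"
    unfolding stop_cond_iff by (rule contrapos_nn) (rule disjI1)
  then obtain \<pi> where \<pi>: "\<pi> \<in> remaining (t - 1)" "ereal \<epsilon> < 2 * bonus_sum M \<sigma> \<delta> p (t - 1) \<pi>"
    unfolding not_le[symmetric] by blast
  have "bonus_sum M \<sigma> \<delta> p (t - 1) \<pi> \<le> bonus_sum M \<sigma> \<delta> p (t - 1) (p t)"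
    using greedy_bonus[OF t1(3,4,5)] \<pi>(1) unfolding max_bonus_choice_def is_arg_max_linorder by blast
  hence "2 * bonus_sum M \<sigma> \<delta> p (t - 1) \<pi> \<le> 2 * bonus_sum M \<sigma> \<delta> p (t - 1) (p t)"
    by (rule ereal_mult_left_mono) simp
  with \<pi>(2) have "ereal \<epsilon> < 2 * bonus_sum M \<sigma> \<delta> p (t - 1) (p t)" by (rule less_le_trans)
  also have "bonus_sum M \<sigma> \<delta> p (t - 1) (p t) = ereal (\<Sum>h\<in>stages M. rate (?v h))"
    unfolding bonus_sum_def sum_ereal[symmetric]
  proof (rule sum.cong[OF refl])
    fix h assume "h \<in> stages M"
    from v1[OF this] show "bonus M \<sigma> \<delta> p (t - 1) h (state_at M (p t) h) (action_at M (p t) h) = ereal (rate (?v h))"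
      by (intro bonus_pos) simp
  qed
  also have "2 * ereal (\<Sum>h\<in>stages M. rate (?v h)) = ereal (2 * (\<Sum>h\<in>stages M. rate (?v h)))"
    by (rule two_times_ereal)
  finally have "\<epsilon> < 2 * (\<Sum>h\<in>stages M. rate (?v h))" by simp
  also have "\<dots> \<le> 2 * (\<Sum>h\<in>stages M. sqrt (threshold M \<sigma> \<delta> T) * (1 / sqrt (real (?v h))))"
  proof (intro mult_left_mono sum_mono)
    fix h assume h: "h \<in> stages M"
    have "?v h \<le> t - 1" by (rule visits_le)
    hence "?v h \<le> T" using t1(2) by simp
    hence "threshold M \<sigma> \<delta> (?v h) \<le> threshold M \<sigma> \<delta> T" by (rule threshold_mono[OF v1[OF h]])
    hence "sqrt (threshold M \<sigma> \<delta> (?v h)) / sqrt (real (?v h)) \<le> sqrt (threshold M \<sigma> \<delta> T) / sqrt (real (?v h))"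
      by (intro divide_right_mono) simp_all
    thus "rate (?v h) \<le> sqrt (threshold M \<sigma> \<delta> T) * (1 / sqrt (real (?v h)))"
      by (simp add: rate_def real_sqrt_divide)
  qed simp
  also have "\<dots> = 2 * sqrt (threshold M \<sigma> \<delta> T) * (\<Sum>(s, a, h)\<in>trajectory M (p t). 1 / sqrt (real (vis (t - 1) h s a)))"
    by (simp add: sum_trajectory sum_distrib_left mult.assoc)
  finally show ?thesis by simp
qed

lemma finite_shrinking [simp]: "finite shrinking"
  by (simp add: shrinking_def)

text \<open>Double counting: episodes and the triples they visit form
  \<open>card shrinking * H\<close> pairs, so Cauchy-Schwarz bounds the sum of square roots over the
  triples by the root of \<open>card shrinking * H * N\<close>. After squaring, one factor
  \<open>card shrinking\<close> cancels.\<close>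

lemma card_shrinking: "real (card shrinking) \<le> 16 * threshold M \<sigma> \<delta> T * N * H / \<epsilon>\<^sup>2"
proof -
  let ?q = "sqrt (threshold M \<sigma> \<delta> T)" and ?n = "real (card shrinking)"
  define E where "E e = {t \<in> shrinking. e \<in> trajectory M (p t)}" for e
  define f where "f t e = 1 / sqrt (real (case e of (s, a, h) \<Rightarrow> vis (t - 1) h s a))" for t and e :: "'s \<times> 'a \<times> nat"
  have finE: "finite (E e)" for e by (simp add: E_def)
  have sub: "trajectory M (p t) \<subseteq> triples M" if "t \<in> shrinking" for t
  proof -
    have "1 \<le> t" using that by (simp add: shrinking_def)
    from trajectory_subset_triples[OF played[OF this]] show ?thesis .
  qed
  have swap: "(\<Sum>t\<in>shrinking. \<Sum>e\<in>trajectory M (p t). g t e) = (\<Sum>e\<in>triples M. \<Sum>t\<in>E e. g t e)"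
    for g :: "nat \<Rightarrow> 's \<times> 'a \<times> nat \<Rightarrow> real"
  proof -
    have "(\<Sum>t\<in>shrinking. \<Sum>e\<in>trajectory M (p t). g t e)
      = (\<Sum>t\<in>shrinking. \<Sum>e\<in>triples M. if e \<in> trajectory M (p t) then g t e else 0)"
    proof (rule sum.cong[OF refl])
      fix t assume t: "t \<in> shrinking"
      show "(\<Sum>e\<in>trajectory M (p t). g t e)
        = (\<Sum>e\<in>triples M. if e \<in> trajectory M (p t) then g t e else 0)"
        by (rule sum.mono_neutral_cong_left) (use sub[OF t] in simp_all)
    qed
    also have "\<dots> = (\<Sum>e\<in>triples M. \<Sum>t\<in>shrinking. if e \<in> trajectory M (p t) then g t e else 0)"
      by (rule sum.swap)
    also have "\<dots> = (\<Sum>e\<in>triples M. \<Sum>t\<in>E e. g t e)"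
      unfolding E_def by (simp add: sum.inter_filter)
    finally show ?thesis .
  qed
  have "(\<Sum>e\<in>triples M. real (card (E e))) = (\<Sum>t\<in>shrinking. real (card (trajectory M (p t))))"
    using swap[of "\<lambda>_ _. 1"] by simp
  hence total: "(\<Sum>e\<in>triples M. real (card (E e))) = ?n * H" by (simp add: card_trajectory)
  have each: "(\<Sum>t\<in>E e. f t e) \<le> 2 * sqrt (real (card (E e)))" for e
  proof -
    obtain s a h where e: "e = (s, a, h)" by (metis prod_cases3)
    let ?v = "\<lambda>t. vis (t - 1) h s a"
    \<comment> \<open>Every episode through \<open>e\<close> raises its count, so the counts found
      by these episodes are distinct and the sum becomes one over a set of positive
      integers.\<close>
    have lt: "?v t < ?v t'" if "t \<in> E e" "t' \<in> E e" "t < t'" for t t'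
      by (rule visits_played) (use that in \<open>auto simp: E_def shrinking_def e\<close>)
    have inj: "inj_on ?v (E e)" by (rule inj_on_nat_less) (use lt in \<open>simp add: less_imp_neq\<close>)
    have "(\<Sum>t\<in>E e. f t e) = (\<Sum>n\<in>?v ` E e. 1 / sqrt (real n))"
      by (subst sum.reindex[OF inj]) (simp add: f_def e)
    also have "\<dots> \<le> 2 * sqrt (real (card (?v ` E e)))"
      by (rule sum_inverse_sqrt_set_le) (use finE in \<open>auto simp: E_def shrinking_def e\<close>)
    finally show ?thesis by (simp only: card_image[OF inj])
  qed
  have "(\<Sum>e\<in>triples M. sqrt (real (card (E e))) * 1)\<^sup>2
      \<le> (\<Sum>e\<in>triples M. (sqrt (real (card (E e))))\<^sup>2) * (\<Sum>e\<in>triples M. 1\<^sup>2)"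
    by (rule Cauchy_Schwarz_ineq_sum)
  hence cs: "(\<Sum>e\<in>triples M. sqrt (real (card (E e))))\<^sup>2 \<le> ?n * H * N"
    by (simp add: total num_triples_def)
  have "?n * \<epsilon> = (\<Sum>t\<in>shrinking. \<epsilon>)" by simp
  also have "\<dots> \<le> (\<Sum>t\<in>shrinking. 2 * ?q * (\<Sum>e\<in>trajectory M (p t). f t e))"
    using shrinking_bonus by (intro sum_mono) (simp add: f_def case_prod_unfold)
  also have "\<dots> = 2 * ?q * (\<Sum>e\<in>triples M. \<Sum>t\<in>E e. f t e)"
    by (simp add: swap flip: sum_distrib_left)
  also have "\<dots> \<le> 2 * ?q * (\<Sum>e\<in>triples M. 2 * sqrt (real (card (E e))))"
    by (intro mult_left_mono sum_mono each) (simp add: threshold_nonneg)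
  finally have "?n * \<epsilon> \<le> 4 * ?q * (\<Sum>e\<in>triples M. sqrt (real (card (E e))))"
    by (simp add: sum_distrib_left[symmetric])
  hence "(?n * \<epsilon>)\<^sup>2 \<le> (4 * ?q * (\<Sum>e\<in>triples M. sqrt (real (card (E e)))))\<^sup>2"
    using \<epsilon> by (intro power_mono) auto
  also have "\<dots> = 16 * threshold M \<sigma> \<delta> T * (\<Sum>e\<in>triples M. sqrt (real (card (E e))))\<^sup>2"
    by (simp add: power_mult_distrib threshold_nonneg)
  also have "\<dots> \<le> 16 * threshold M \<sigma> \<delta> T * (?n * H * N)"
    by (intro mult_left_mono cs) (simp add: threshold_nonneg)
  finally have "?n * (?n * \<epsilon>\<^sup>2) \<le> ?n * (16 * threshold M \<sigma> \<delta> T * N * H)"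
    by (simp add: power2_eq_square algebra_simps)
  hence "?n * \<epsilon>\<^sup>2 \<le> 16 * threshold M \<sigma> \<delta> T * N * H"
    using threshold_nonneg[of T] by (cases "?n = 0") auto
  thus ?thesis using \<epsilon> by (simp add: pos_le_divide_eq)
qed

lemma episodes_le_worst_case:
  defines "B \<equiv> real CARD('s) * real CARD('a) * H"
  shows "real T \<le> 256 * \<sigma>\<^sup>2 * B * H / \<epsilon>\<^sup>2
     * (ln (4 * B / \<delta>) + 4 * ln (512 * \<sigma>\<^sup>2 * B * H * ln (4 * B / \<delta>) / \<epsilon>\<^sup>2)) + 8 * B + 2"
proof -
  \<comment> \<open>The factor 16 times the 2 in \<open>threshold\<close> contributes 32, and the
    even episodes are about half of all, whence 64. \<open>episode_inversion\<close> multiplies by 4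
    and by 8, which gives 256 and 512.\<close>
  define Y where "Y = 64 * \<sigma>\<^sup>2 * B * H / \<epsilon>\<^sup>2"
  have NB: "N \<le> B" using card_triples_le[of M] unfolding B_def by (simp flip: of_nat_mult)
  have B: "1 \<le> B" using NB N_ge_1 by simp
  have Y: "0 < Y" using B \<sigma> H_ge_1 \<epsilon> by (simp add: Y_def)
  have logs: "ln (4 * N / \<delta>) \<le> ln (4 * B / \<delta>)"
    using NB N_ge_1 \<delta> by (intro ln_mono divide_right_mono) auto
  have "{t \<in> {1..T}. even t} = exploring \<union> shrinking"
    by (fastforce simp: exploring_def shrinking_def Suc_le_eq)
  hence "T div 2 \<le> card exploring + card shrinking"
    using card_Un_le[of exploring shrinking] by (simp add: card_even[symmetric])
  hence "2 * (T div 2) + 1 \<le> 2 * (card exploring + card shrinking) + 1"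
    by (intro add_right_mono mult_le_mono2)
  moreover have "T \<le> 2 * (T div 2) + 1" by presburger
  ultimately have "T \<le> 2 * (card exploring + card shrinking) + 1" by (rule order_trans[rotated])
  hence "real T \<le> real (2 * (card exploring + card shrinking) + 1)" by (rule of_nat_mono)
  hence "real T \<le> 2 * (real (card exploring) + real (card shrinking)) + 1" by simp
  also have "\<dots> \<le> 2 * (N + 16 * threshold M \<sigma> \<delta> T * N * H / \<epsilon>\<^sup>2) + 1"
    using card_exploring card_shrinking by simp
  also have "16 * threshold M \<sigma> \<delta> T * N * H / \<epsilon>\<^sup>2
      = (32 * \<sigma>\<^sup>2 * H / \<epsilon>\<^sup>2) * (N * (ln (4 * N / \<delta>) + 2 * ln (real T)))"
    using T by (simp add: threshold_eq)
  also have "\<dots> \<le> (32 * \<sigma>\<^sup>2 * H / \<epsilon>\<^sup>2) * (B * (ln (4 * B / \<delta>) + 2 * ln (real T)))"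
    using NB logs T log_N_ge ln4_gt_1 B by (intro mult_left_mono mult_mono) auto
  also have "\<dots> = Y * (ln (4 * B / \<delta>) + 2 * ln (real T)) / 2" by (simp add: Y_def)
  finally have "real T \<le> Y * (ln (4 * B / \<delta>) + 2 * ln (real T)) + 2 * B + 1"
    using NB by simp
  from episode_inversion[OF _ Y B order_trans[OF log_N_ge logs] this] T
  show ?thesis by (simp add: Y_def mult.assoc)
qed

end

end

section \<open>Odd episodes: covering the demand of each level\<close>

context concentrated_path
begin

abbreviation start :: "nat \<Rightarrow> nat" where "start \<equiv> level_start M \<sigma> \<delta> p y"
abbreviation demand :: "nat \<Rightarrow> nat \<Rightarrow> 's \<Rightarrow> 'a \<Rightarrow> real" where "demand \<equiv> cover_demand M \<sigma> \<delta> p y"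

lemma start_props:
  assumes "1 \<le> t" "lev t = k"
  shows "1 \<le> start k" "start k \<le> t" "lev (start k) = k" "\<And>l. 1 \<le> l \<Longrightarrow> lev l = k \<Longrightarrow> start k \<le> l"
proof -
  let ?K = "{l. 1 \<le> l \<and> lev l = k}"
  have "?K \<noteq> {}" using assms by blast
  hence "Inf ?K \<in> ?K" by (rule Inf_nat_def1)
  thus "1 \<le> start k" "lev (start k) = k" by (auto simp: level_start_def)
  show le: "start k \<le> l" if "1 \<le> l" "lev l = k" for l
    unfolding level_start_def by (rule cInf_lower) (use that in auto)
  show "start k \<le> t" by (rule le[OF assms])
qed

lemma demand_le_1: "demand k h s a \<in> {0, 1}"
  by (simp add: cover_demand_def Let_def)

context
  fixes T :: nat and \<epsilon> :: real
  assumes T: "1 \<le> T" and \<epsilon>: "0 < \<epsilon>"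
    and running: "\<And>t. 1 \<le> t \<Longrightarrow> t < T \<Longrightarrow> \<not> stop_cond M \<sigma> \<epsilon> \<delta> p y t"
begin

definition phase :: "nat \<Rightarrow> nat set" where
  "phase k = {t \<in> {1..T}. odd t \<and> lev t = k}"

lemma not_stopped_before:
  assumes "1 \<le> t" "t \<le> T" shows "t = 1 \<or> \<not> stop_cond M \<sigma> \<epsilon> \<delta> p y (t - 1)"
proof (cases "t = 1")
  case False
  hence "1 \<le> t - 1" "t - 1 < T" using assms by linarith+
  from running[OF this] show ?thesis by simp
qed simp

lemma finite_phase [simp]: "finite (phase k)"
  by (simp add: phase_def)

lemma phaseD:
  assumes "u \<in> phase k"
  shows "start k \<le> u" "1 \<le> u" "u \<le> T" "odd u" "lev u = k"
proof -
  show u: "1 \<le> u" "u \<le> T" "odd u" "lev u = k" using assms by (simp_all add: phase_def)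
  show "start k \<le> u" by (rule start_props(2)[OF u(1,4)])
qed

text \<open>The demand of level \<open>k\<close> is frozen at the first episode of that level, so
  the bound of the level by \<open>lower_bound_fun\<close> is used there. That episode is no later
  than \<open>t\<close> and therefore lies within the run.\<close>

lemma min_flow_demand_le:
  assumes "1 \<le> t" "t \<le> T" "lev t = k"
  shows "min_flow_value M (demand k) \<le> min_flow_value M (lower_bound_fun M \<sigma> \<epsilon> \<delta>) / real k"
proof (rule min_flow_value_scale[OF wf])
  show "0 < real k" using level_pos[of t] assms by simp
  fix s a h assume e: "(s, a, h) \<in> triples M"
  note st = start_props[OF assms(1,3)]
  show "real k * demand k h s a \<le> lower_bound_fun M \<sigma> \<epsilon> \<delta> h s a"
  proof (cases "a \<in> act (start k - 1) h s")
    case True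
    hence "(s, a, h) \<in> active_triples (start k - 1)" using e by (simp add: active_triples_def triples_def)
    moreover have "start k = 1 \<or> \<not> stop_cond M \<sigma> \<epsilon> \<delta> p y (start k - 1)"
      by (rule not_stopped_before) (use st assms in linarith)+
    ultimately have "real k \<le> lower_bound_fun M \<sigma> \<epsilon> \<delta> h s a"
      using level_le_lower_bound_fun[OF \<epsilon> st(1)] st(3) by simp
    moreover have "real k * demand k h s a \<le> real k * 1"
      using demand_le_1[of k h s a] by (intro mult_left_mono) auto
    ultimately show ?thesis by simp
  next
    case False
    hence "demand k h s a = 0" by (simp add: cover_demand_def Let_def)
    thus ?thesis using lower_bound_fun_ge_1[OF \<epsilon>, of h s a] by simp
  qed
qed

text \<open>Summing the costs over the levels up to \<open>lev T\<close> gives a harmonic number,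
  hence a logarithm of the last level, which is at most \<open>lower_bound_fun\<close> at an active
  triple. The factor 2 appears because at least half of the first \<open>T\<close> episodes are
  odd.\<close>

lemma episodes_le_flow:
  assumes C: "0 \<le> C"
    and cover: "\<And>k t. 1 \<le> t \<Longrightarrow> t \<le> T \<Longrightarrow> lev t = k \<Longrightarrow> real (card (phase k)) \<le> C * min_flow_value M (demand k)"
  shows "real T \<le> 2 * C * (Max ((\<lambda>(s, a, h). ln (lower_bound_fun M \<sigma> \<epsilon> \<delta> h s a)) ` triples M) + 1)
    * min_flow_value M (lower_bound_fun M \<sigma> \<epsilon> \<delta>)"
proof -
  let ?g = "lower_bound_fun M \<sigma> \<epsilon> \<delta>" and ?K = "lev T"
  let ?\<phi> = "min_flow_value M ?g"
  have phase_le: "real (card (phase k)) \<le> C * ?\<phi> * inverse (real k)" for k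
  proof (cases "phase k = {}")
    case True
    thus ?thesis using C min_flow_value_nonneg[OF wf] by simp
  next
    case False
    then obtain t where t: "1 \<le> t" "t \<le> T" "lev t = k" by (auto simp: phase_def)
    have "real (card (phase k)) \<le> C * min_flow_value M (demand k)" by (rule cover[OF t])
    also have "\<dots> \<le> C * (?\<phi> / real k)" by (intro mult_left_mono min_flow_demand_le[OF t] C)
    finally show ?thesis by (simp add: divide_inverse)
  qed
  have "{t \<in> {1..T}. odd t} = (\<Union>k\<in>{1..?K}. phase k)"
    using level_mono level_pos by (auto simp: phase_def)
  hence "real (card {t \<in> {1..T}. odd t}) = real (card (\<Union>k\<in>{1..?K}. phase k))" by simp
  also have "\<dots> \<le> (\<Sum>k\<in>{1..?K}. real (card (phase k)))"
    unfolding of_nat_sum[symmetric] of_nat_le_iff by (rule card_UN_le) simp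
  also have "\<dots> \<le> (\<Sum>k\<in>{1..?K}. C * ?\<phi> * inverse (real k))" by (rule sum_mono) (rule phase_le)
  also have "\<dots> = C * ?\<phi> * harm ?K" by (simp add: harm_def sum_distrib_left)
  also have "\<dots> \<le> C * ?\<phi> * (ln (real ?K) + 1)"
    using C min_flow_value_nonneg[OF wf] level_pos by (intro mult_left_mono harm_le_ln) auto
  also have "\<dots> \<le> C * ?\<phi> * (Max ((\<lambda>(s, a, h). ln (?g h s a)) ` triples M) + 1)"
  proof (intro mult_left_mono add_right_mono)
    obtain s a h where e: "(s, a, h) \<in> active_triples (T - 1)" by (rule level_attained)
    have "T = 1 \<or> \<not> stop_cond M \<sigma> \<epsilon> \<delta> p y (T - 1)" by (rule not_stopped_before[OF T order_refl])
    from level_le_lower_bound_fun[OF \<epsilon> T this e] have "ln (real ?K) \<le> ln (?g h s a)"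
      by (rule ln_mono) (use level_pos[of T] in simp)
    also have "\<dots> \<le> Max ((\<lambda>(s, a, h). ln (?g h s a)) ` triples M)"
      using subsetD[OF active_triples_subset e] by (intro Max_ge) (auto intro: rev_image_eqI)
    finally show "ln (real ?K) \<le> Max ((\<lambda>(s, a, h). ln (?g h s a)) ` triples M)" .
    show "0 \<le> C * ?\<phi>" using C min_flow_value_nonneg[OF wf] by simp
  qed
  finally have "real (card {t \<in> {1..T}. odd t}) \<le> C * ?\<phi> * (Max ((\<lambda>(s, a, h). ln (?g h s a)) ` triples M) + 1)" .
  moreover have "T \<le> 2 * card {t \<in> {1..T}. odd t}" unfolding card_odd by presburger
  hence "real T \<le> real (2 * card {t \<in> {1..T}. odd t})" by (rule of_nat_mono)
  ultimately show ?thesis by (simp add: algebra_simps)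
qed

text \<open>Odd episodes of one level use up the cover: a played policy is removed and does not
  return, so the phase injects into the cover computed at its beginning, whose size is the minimum
  flow value.\<close>

lemma static_phase_le:
  assumes static: "static_max_coverage M \<sigma> \<epsilon> \<delta> p y" and t: "1 \<le> t" "t \<le> T" "lev t = k"
  shows "real (card (phase k)) \<le> min_flow_value M (demand k)"
proof -
  have le: "enat t \<le> sample_complexity M \<sigma> \<epsilon> \<delta> p y" if "t \<le> T" for t
    unfolding le_sample_complexity_iff using running that by simp
  obtain cover where cov: "\<forall>t\<ge>1. enat t \<le> sample_complexity M \<sigma> \<epsilon> \<delta> p y \<longrightarrow>
      (if t = 1 \<or> lev t > lev (t - 1) then min_policy_cover M (demand (lev t)) (cover t)
       else cover t = (if odd (t - 1) then cover (t - 1) - {p (t - 1)} else cover (t - 1))) \<and>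
      (odd t \<longrightarrow> p t \<in> cover t) \<and> (even t \<longrightarrow> max_bonus_choice M \<sigma> \<delta> p y t)"
    using static unfolding static_max_coverage_def by (rule exE)
  have cover: "if t = 1 \<or> lev t > lev (t - 1) then min_policy_cover M (demand (lev t)) (cover t)
       else cover t = (if odd (t - 1) then cover (t - 1) - {p (t - 1)} else cover (t - 1))"
    if "1 \<le> t" "t \<le> T" for t
    using cov[rule_format, OF that(1) le[OF that(2)]] by (rule conjunct1)
  have chosen: "p t \<in> cover t" if "1 \<le> t" "t \<le> T" "odd t" for t
    using cov[rule_format, OF that(1) le[OF that(2)]] that(3) by (elim conjE) (rule mp)
  note st = start_props[OF t(1,3)]
  \<comment> \<open>Minimality of \<open>start k\<close> means that the level has just risen, or
    that this is the first episode; in both cases the rule recomputes the cover.\<close>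
  have fresh: "start k = 1 \<or> lev (start k) > lev (start k - 1)"
  proof (cases "start k = 1")
    case False
    hence "1 \<le> start k - 1" "\<not> start k \<le> start k - 1" using st(1) by linarith+
    with st(4)[of "start k - 1"] have "lev (start k - 1) \<noteq> k" by blast
    moreover have "lev (start k - 1) \<le> lev (start k)" by (rule level_mono) simp
    ultimately show ?thesis using st(3) by simp
  qed simp
  have "min_policy_cover M (demand k) (cover (start k))"
  proof -
    have "start k \<le> T" using st(2) t(2) by (rule order_trans)
    from iffD1[OF if_P[OF fresh] cover[OF st(1) this]] show ?thesis unfolding st(3) .
  qed
  hence X: "real (card (cover (start k))) = min_flow_value M (demand k)" "finite (cover (start k))"
    by (auto simp: min_policy_cover_def intro: finite_subset[OF _ finite_policies])
  \<comment> \<open>Even episodes leave the cover alone, and within one level no recomputation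
    occurs.\<close>
  have rest: "cover u = cover (start k) - p ` {v \<in> {start k..<u}. odd v}"
    if "start k \<le> u" "u \<le> T" "lev u = k" for u
    using that
  proof (induction u rule: dec_induct)
    case (step u)
    have u1: "1 \<le> u" using st(1) step by simp
    have lu: "lev u = k" using level_mono[of "start k" u] level_mono[of u "Suc u"] step st(3) by simp
    have "cover (Suc u) = (if odd u then cover u - {p u} else cover u)"
      using cover[of "Suc u"] step.prems lu u1 by simp
    moreover have "{v \<in> {start k..<Suc u}. odd v} = (if odd u then insert u {v \<in> {start k..<u}. odd v} else {v \<in> {start k..<u}. odd v})"
      using step.hyps by (auto simp: less_Suc_eq)
    moreover have "cover u = cover (start k) - p ` {v \<in> {start k..<u}. odd v}"
      by (rule step.IH) (use step.prems lu in simp_all)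
    ultimately show ?case by auto
  qed simp
  note in_phase = phaseD[of _ k]
  have "p u \<noteq> p v" if "u \<in> phase k" "v \<in> phase k" "u < v" for u v
  proof -
    note v = in_phase[OF that(2)]
    have "p u \<in> p ` {w \<in> {start k..<v}. odd w}"
      by (rule imageI) (use in_phase(1,4)[OF that(1)] that(3) in simp)
    moreover have "p v \<notin> p ` {w \<in> {start k..<v}. odd w}"
      using chosen[OF v(2,3,4)] unfolding rest[OF v(1,3,5)] by (elim DiffE)
    ultimately show ?thesis by metis
  qed
  hence "inj_on p (phase k)" by (rule inj_on_nat_less)
  moreover have "p ` phase k \<subseteq> cover (start k)"
  proof clarify
    fix u assume "u \<in> phase k"
    note u = in_phase[OF this]
    show "p u \<in> cover (start k)" using chosen[OF u(2,3,4)] unfolding rest[OF u(1,3,5)] by (rule DiffD1)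
  qed
  ultimately have "card (phase k) \<le> card (cover (start k))" using X(2) by (rule card_inj_on_le)
  thus ?thesis using X(1) by simp
qed

text \<open>\<open>R u\<close> is the part of the demand still open before episode \<open>u\<close>,
  and \<open>X u\<close> the trajectory played. The rule is greedy set cover on these sets; the
  comparison with any feasible flow is weak duality, with the greedy prices as dual weights.\<close>

lemma greedy_phase_le:
  assumes greedy: "max_coverage M \<sigma> \<epsilon> \<delta> p y" and t: "1 \<le> t" "t \<le> T" "lev t = k"
  shows "real (card (phase k)) \<le> (ln H + 1) * min_flow_value M (demand k)"
proof -
  note st = start_props[OF t(1,3)]
  define R where "R u = {(s, a, h) \<in> active_triples (start k - 1). vis (u - 1) h s a < k}" for u
  define X where "X u = trajectory M (p u)" for u
  note in_phase = phaseD[of _ k]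
  have R_sub: "R u \<subseteq> triples M" for u using active_triples_subset by (auto simp: R_def)
  have finR: "finite (R u)" for u by (rule finite_subset[OF R_sub]) simp
  have gain: "(\<Sum>h\<in>stages M. (of_bool (action_at M \<pi> h \<in> act (start k - 1) h (state_at M \<pi> h) \<and>
       vis (u - 1) h (state_at M \<pi> h) (action_at M \<pi> h) < k) :: nat)) = card (trajectory M \<pi> \<inter> R u)" for \<pi> u
  proof -
    have "card (trajectory M \<pi> \<inter> R u) = (\<Sum>e\<in>trajectory M \<pi>. of_bool (e \<in> R u))"
      by (simp add: Int_def)
    also have "\<dots> = (\<Sum>h\<in>stages M. of_bool ((state_at M \<pi> h, action_at M \<pi> h, h) \<in> R u))"
      by (rule sum_trajectory)
    finally show ?thesis by (simp add: R_def active_triples_def cong: sum.cong)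
  qed
  have best: "card (trajectory M \<pi> \<inter> R u) \<le> card (X u \<inter> R u)" if "u \<in> phase k" "\<pi> \<in> policies M" for u \<pi>
  proof -
    have u: "1 \<le> u" "odd u" "lev u = k" "enat u \<le> sample_complexity M \<sigma> \<epsilon> \<delta> p y"
      using in_phase[OF that(1)] running by (auto simp: le_sample_complexity_iff)
    with greedy have "is_arg_max (\<lambda>\<pi>. \<Sum>h\<in>stages M. (of_bool
        (action_at M \<pi> h \<in> act (start k - 1) h (state_at M \<pi> h) \<and>
         vis (u - 1) h (state_at M \<pi> h) (action_at M \<pi> h) < k) :: nat)) (\<lambda>\<pi>. \<pi> \<in> policies M) (p u)"
      by (auto simp: max_coverage_def Let_def)
    thus ?thesis using that(2) unfolding gain X_def by (simp add: is_arg_max_linorder)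
  qed
  \<comment> \<open>A triple that attains the minimum in the definition of the level is still open,
    so the greedy choice covers something.\<close>
  have nonempty: "X u \<inter> R u \<noteq> {}" if u: "u \<in> phase k" for u
  proof -
    obtain s a h where e: "(s, a, h) \<in> active_triples (u - 1)" "lev u = vis (u - 1) h s a + 1"
      by (rule level_attained)
    have "(s, a, h) \<in> active_triples (start k - 1)"
      using active_triples_antimono[OF diff_le_mono[of "start k" u 1]] in_phase[OF u] e(1) by blast
    hence eR: "(s, a, h) \<in> R u" using e(2) in_phase[OF u] by (simp add: R_def)
    hence "(s, a, h) \<in> triples M" "h \<in> stages M" using R_sub by (auto simp: triples_def)
    then obtain \<pi> where \<pi>: "\<pi> \<in> policies M" "(s, a, h) \<in> trajectory M \<pi>"
      using policies_through_nonempty[of s a h M] by (auto simp: policies_through_eq)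
    hence "trajectory M \<pi> \<inter> R u \<noteq> {}" using eR by auto
    hence "0 < card (trajectory M \<pi> \<inter> R u)" by (simp add: card_gt_0_iff)
    also have "\<dots> \<le> card (X u \<inter> R u)" by (rule best[OF u \<pi>(1)])
    finally show ?thesis by auto
  qed
  \<comment> \<open>At the start of the level all these triples have at least \<open>k - 1\<close>
    visits, so a single visit closes one for good.\<close>
  have decrease: "R v \<subseteq> R u - X u" if "u \<in> phase k" "v \<in> phase k" "u < v" for u v
  proof clarify
    fix s a h assume e: "(s, a, h) \<in> R v"
    have u: "start k \<le> u" "1 \<le> u" using in_phase[OF that(1)] by auto
    have "vis (u - 1) h s a \<le> vis (v - 1) h s a" by (rule visits_mono) (use that in auto)
    hence "(s, a, h) \<in> R u" using e by (auto simp: R_def)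
    moreover have "(s, a, h) \<notin> X u"
    proof
      assume "(s, a, h) \<in> X u"
      hence "vis (u - 1) h s a < vis (v - 1) h s a"
        unfolding X_def by (rule visits_played[OF u(2) _ that(3)])
      moreover have "vis (start k - 1) h s a \<le> vis (u - 1) h s a"
        by (rule visits_mono) (use u in auto)
      moreover have "lev (start k) \<le> vis (start k - 1) h s a + 1"
        by (rule level_le) (use e in \<open>auto simp: R_def\<close>)
      ultimately show False using e st(3) by (auto simp: R_def)
    qed
    ultimately show "(s, a, h) \<in> R u - X u" by simp
  qed
  let ?x = "greedy_price (phase k) R X"
  have harm_pos: "0 < (harm (horizon M) :: real)" using H_ge_1 by simp
  have "real (card (phase k)) / harm (horizon M) \<le> min_flow_value M (demand k)"
  proof (rule min_flow_value_greatest[OF wf])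
    fix \<eta> assume \<eta>: "feasible_flow M (demand k) \<eta>"
    have "real (card (phase k)) = sum ?x (triples M)"
      by (rule greedy_price_total[symmetric]) (use R_sub nonempty in auto)
    also have "\<dots> \<le> (\<Sum>(s, a, h)\<in>triples M. ?x (s, a, h) * \<eta> h s a)"
    proof (rule sum_mono, clarify)
      fix s a h assume e: "(s, a, h) \<in> triples M"
      show "?x (s, a, h) \<le> ?x (s, a, h) * \<eta> h s a"
      \<comment> \<open>Only triples that were open at some time carry a price; those have demand 1,
        so the flow through them is at least 1.\<close>
      proof (cases "(s, a, h) \<in> (\<Union>u\<in>phase k. R u)")
        case True
        then obtain u where u: "u \<in> phase k" "(s, a, h) \<in> R u" by auto
        have "vis (start k - 1) h s a \<le> vis (u - 1) h s a"
          by (rule visits_mono) (use in_phase[OF u(1)] in auto)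
        hence "demand k h s a = 1" using u(2) by (auto simp: R_def cover_demand_def Let_def active_triples_def)
        hence "1 \<le> \<eta> h s a" using \<eta> e by (auto simp: feasible_flow_def)
        hence "?x (s, a, h) * 1 \<le> ?x (s, a, h) * \<eta> h s a"
          by (intro mult_left_mono greedy_price_nonneg)
        thus ?thesis by simp
      qed (simp add: greedy_price_outside)
    qed
    also have "\<dots> \<le> harm (horizon M) * flow_value M \<eta>"
    proof (rule flow_weight_le[OF wf])
      show "is_flow M \<eta>" using \<eta> by (simp add: feasible_flow_def)
      fix \<pi> assume \<pi>: "\<pi> \<in> policies M"
      have "(\<Sum>h\<in>stages M. ?x (state_at M \<pi> h, action_at M \<pi> h, h)) = sum ?x (trajectory M \<pi>)"
        by (rule sum_trajectory[symmetric])
      also have "\<dots> \<le> harm (horizon M)"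
        by (rule greedy_price_set_le) (use finR best \<pi> decrease in \<open>auto simp: card_trajectory\<close>)
      finally show "(\<Sum>h\<in>stages M. ?x (state_at M \<pi> h, action_at M \<pi> h, h)) \<le> harm (horizon M)" .
    qed
    finally show "real (card (phase k)) / harm (horizon M) \<le> flow_value M \<eta>"
      using harm_pos by (simp add: pos_divide_le_eq mult.commute)
  qed
  hence "real (card (phase k)) \<le> harm (horizon M) * min_flow_value M (demand k)"
    using harm_pos by (simp add: pos_divide_le_eq mult.commute)
  also have "\<dots> \<le> (ln H + 1) * min_flow_value M (demand k)"
    using H_ge_1 by (intro mult_right_mono harm_le_ln min_flow_value_nonneg[OF wf]) auto
  finally show ?thesis .
qed

end

end

section \<open>Concentration of the reward estimates\<close>

text \<open>Each term is at most twice the corresponding telescoping difference. This makes the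
  union bound over all visit counts cost only a factor 2.\<close>

lemma sum_inverse_squares_le_2:
  "summable (\<lambda>n. 1 / (real (Suc n))\<^sup>2)" "(\<Sum>n. 1 / (real (Suc n))\<^sup>2) \<le> 2"
proof -
  have "(\<lambda>n. 1 / real (Suc n)) \<longlonglongrightarrow> 0"
    using LIMSEQ_inverse_real_of_nat by (simp add: inverse_eq_divide)
  from sums_mult[OF telescope_sums'[OF this], of 2]
  have s: "(\<lambda>n. 2 * (1 / real (Suc n) - 1 / real (Suc (Suc n)))) sums 2" by simp
  have le: "1 / (real (Suc n))\<^sup>2 \<le> 2 * (1 / real (Suc n) - 1 / real (Suc (Suc n)))" for n
  proof -
    have "2 * (1 / real (Suc n) - 1 / real (Suc (Suc n))) = 2 / (real (Suc n) * real (Suc (Suc n)))"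
      by (simp add: field_simps)
    moreover have "real (Suc n) * real (Suc (Suc n)) \<le> 2 * (real (Suc n))\<^sup>2"
      by (simp add: power2_eq_square algebra_simps)
    ultimately show ?thesis by (simp add: field_simps del: of_nat_Suc)
  qed
  show sm: "summable (\<lambda>n. 1 / (real (Suc n))\<^sup>2)"
    by (rule summable_comparison_test'[OF sums_summable[OF s], of 0]) (use le in auto)
  from suminf_le[OF le sm sums_summable[OF s]] sums_unique[OF s]
  show "(\<Sum>n. 1 / (real (Suc n))\<^sup>2) \<le> 2" by simp
qed

locale mdp_interaction =
  fixes M :: "('s::finite, 'a::finite) det_mdp" and P :: "'w measure" and F :: "nat \<Rightarrow> 'w measure"
    and pol :: "nat \<Rightarrow> 'w \<Rightarrow> ('s, 'a) policy" and y :: "nat \<Rightarrow> nat \<Rightarrow> 'w \<Rightarrow> real"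
  assumes wf: "wf_det_mdp M" and interaction: "interaction M P F pol y"
begin

sublocale prob_space P
  using interaction by (simp add: interaction_def)

abbreviation plays :: "'w \<Rightarrow> nat \<Rightarrow> ('s, 'a) policy" where "plays \<omega> \<equiv> \<lambda>t. pol t \<omega>"
abbreviation obs :: "'w \<Rightarrow> nat \<Rightarrow> nat \<Rightarrow> real" where "obs \<omega> \<equiv> \<lambda>t h. y t h \<omega>"

lemma space_F: "space (F t) = space P"
  using interaction by (auto simp: interaction_def filtration_def)

lemma sets_F: "sets (F t) \<subseteq> sets P"
  using interaction by (simp add: interaction_def)

lemma measurable_F_mono: "f \<in> measurable (F t) N \<Longrightarrow> t \<le> u \<Longrightarrow> f \<in> measurable (F u) N"
  using measurable_mono[of N N "F t" "F u"] interaction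
  by (auto simp: interaction_def filtration_def)

lemma measurable_F_P: "f \<in> measurable (F t) N \<Longrightarrow> f \<in> measurable P N"
  using measurable_mono[of N N "F t" P] sets_F space_F by auto

lemma pred_pol:
  assumes "1 \<le> t" "t \<le> Suc u" shows "Measurable.pred (F u) (\<lambda>\<omega>. Q (pol t \<omega>))"
proof -
  have "pol t \<in> measurable (F (t - 1)) (count_space (policies M))"
    using interaction assms by (simp add: interaction_def)
  hence "pol t \<in> measurable (F u) (count_space (policies M))"
    by (rule measurable_F_mono) (use assms in simp)
  moreover have "Q \<in> measurable (count_space (policies M)) (count_space UNIV)" by simp
  ultimately show ?thesis by (rule measurable_compose)
qed

lemma pol_policies:
  assumes "1 \<le> t" "\<omega> \<in> space P" shows "pol t \<omega> \<in> policies M"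
proof -
  have "pol t \<in> measurable (F (t - 1)) (count_space (policies M))"
    using interaction assms by (simp add: interaction_def)
  from measurable_space[OF this] assms show ?thesis by (simp add: space_F)
qed

lemma measurable_obs:
  assumes "1 \<le> t" "t \<le> u" "h \<in> stages M" shows "y t h \<in> borel_measurable (F u)"
  by (rule measurable_F_mono[of _ t]) (use interaction assms in \<open>simp_all add: interaction_def\<close>)

text \<open>Counts depend on the policies alone, and the policy of an episode is known before it
  starts; hence \<open>Suc u\<close> and not \<open>u\<close>. This lead makes the condition that an
  episode is among the first \<open>n\<close> visits predictable.\<close>

lemma measurable_visits:
  assumes "h \<in> stages M" "t \<le> Suc u"
  shows "(\<lambda>\<omega>. visits M (plays \<omega>) t h s a) \<in> measurable (F u) (count_space UNIV)"
  using assms(2)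
proof (induction t)
  case 0
  show ?case by (simp add: visits_def visit_episodes_def)
next
  case (Suc t)
  have "(\<lambda>\<omega>. visits M (plays \<omega>) (Suc t) h s a) = (\<lambda>\<omega>. if (s, a, h) \<in> trajectory M (pol (Suc t) \<omega>)
     then Suc (visits M (plays \<omega>) t h s a) else visits M (plays \<omega>) t h s a)"
    using assms(1) by (auto simp: visits_Suc)
  moreover have IH: "(\<lambda>\<omega>. visits M (plays \<omega>) t h s a) \<in> measurable (F u) (count_space UNIV)"
    using Suc by simp
  moreover have "(\<lambda>\<omega>. Suc (visits M (plays \<omega>) t h s a)) \<in> measurable (F u) (count_space UNIV)"
    by (rule measurable_compose[OF IH]) simp
  moreover have "Measurable.pred (F u) (\<lambda>\<omega>. (s, a, h) \<in> trajectory M (pol (Suc t) \<omega>))"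
    by (rule pred_pol) (use Suc.prems in auto)
  ultimately show ?case by (simp add: measurable_If pred_def)
qed

lemma pred_visits:
  assumes "h \<in> stages M" "t \<le> Suc u"
  shows "Measurable.pred (F u) (\<lambda>\<omega>. Q (visits M (plays \<omega>) t h s a))"
  by (rule measurable_compose[OF measurable_visits[OF assms]]) simp

lemma reward_prob_space:
  assumes "\<pi> \<in> policies M" "h \<in> stages M"
  shows "prob_space (reward M h (state_at M \<pi> h) (action_at M \<pi> h))"
    "sets (reward M h (state_at M \<pi> h) (action_at M \<pi> h)) = sets borel"
proof -
  have "(state_at M \<pi> h, action_at M \<pi> h, h) \<in> triples M"
    using trajectory_subset_triples[OF assms(1)] assms(2) by (auto simp: mem_trajectory)
  with wf show "prob_space (reward M h (state_at M \<pi> h) (action_at M \<pi> h))"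
    "sets (reward M h (state_at M \<pi> h) (action_at M \<pi> h)) = sets borel"
    unfolding wf_det_mdp_def by blast+
qed

section \<open>Integrating a reward against the past\<close>

context
  fixes s a h assumes triple: "(s, a, h) \<in> triples M"
begin

definition hit :: "nat \<Rightarrow> 'w set" where
  "hit t = {\<omega> \<in> space P. (s, a, h) \<in> trajectory M (pol t \<omega>)}"

lemma stage: "h \<in> stages M"
  using triple by (simp add: triples_def)

lemma sets_reward: "sets (reward M h s a) = sets borel" "prob_space (reward M h s a)"
  using wf triple by (auto simp: wf_det_mdp_def)

lemma hit_sets: "1 \<le> t \<Longrightarrow> t \<le> Suc u \<Longrightarrow> hit t \<in> sets (F u)"
  using pred_pol[of t u "\<lambda>\<pi>. (s, a, h) \<in> trajectory M \<pi>"]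
  by (simp add: hit_def pred_def space_F)

text \<open>The protocol factorises for one policy and a box of rewards at all stages. Taking the
  whole line at the other stages leaves the factor of stage \<open>h\<close>, and summing over the
  finitely many policies through the triple removes the dependence on the policy.\<close>

lemma measure_reward:
  assumes t: "1 \<le> t" and G: "G \<in> sets (F (t - 1))" and B: "B \<in> sets borel"
  shows "measure P {\<omega> \<in> G \<inter> hit t. y t h \<omega> \<in> B} = measure P (G \<inter> hit t) * measure (reward M h s a) B"
proof -
  define D where "D \<pi> = {\<omega> \<in> G. pol t \<omega> = \<pi>}" for \<pi>
  define D' where "D' \<pi> = {\<omega> \<in> D \<pi>. y t h \<omega> \<in> B}" for \<pi>
  have GP: "G \<subseteq> space P" using G sets.sets_into_space sets_F by blast
  have D: "D \<pi> \<in> sets P" for \<pi>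
  proof -
    have "D \<pi> = G \<inter> {\<omega> \<in> space (F (t - 1)). pol t \<omega> = \<pi>}" using GP by (auto simp: D_def space_F)
    moreover have "{\<omega> \<in> space (F (t - 1)). pol t \<omega> = \<pi>} \<in> sets (F (t - 1))"
      using pred_pol[of t "t - 1" "\<lambda>x. x = \<pi>"] t by (simp add: pred_def)
    ultimately show ?thesis using G sets_F by auto
  qed
  have yB: "{\<omega> \<in> space P. y t h \<omega> \<in> B} \<in> sets P"
    using measurable_sets[OF measurable_F_P[OF measurable_obs[OF t order_refl stage]] B]
    by (simp add: vimage_def Int_def conj_commute)
  have D': "D' \<pi> \<in> sets P" for \<pi>
  proof -
    have "D' \<pi> = D \<pi> \<inter> {\<omega> \<in> space P. y t h \<omega> \<in> B}" using GP by (auto simp: D'_def D_def)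
    thus ?thesis using D yB by auto
  qed
  let ?T = "policies_through M s a h"
  have one: "measure P (D' \<pi>) = measure P (D \<pi>) * measure (reward M h s a) B" if \<pi>: "\<pi> \<in> ?T" for \<pi>
  proof -
    have pm: "\<pi> \<in> policies M" "state_at M \<pi> h = s" "action_at M \<pi> h = a"
      using \<pi> by (auto simp: policies_through_def)
    define B' where "B' h' = (if h' = h then B else UNIV)" for h'
    have "measure P {\<omega> \<in> G. pol t \<omega> = \<pi> \<and> (\<forall>h'\<in>stages M. y t h' \<omega> \<in> B' h')} =
        measure P {\<omega> \<in> G. pol t \<omega> = \<pi>} *
        (\<Prod>h'\<in>stages M. measure (reward M h' (state_at M \<pi> h') (action_at M \<pi> h')) (B' h'))"
      using interaction t G pm(1) B unfolding interaction_def by (auto simp: B'_def)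
    moreover have "{\<omega> \<in> G. pol t \<omega> = \<pi> \<and> (\<forall>h'\<in>stages M. y t h' \<omega> \<in> B' h')} = D' \<pi>"
      using stage by (auto simp: B'_def D'_def D_def)
    moreover have "(\<Prod>h'\<in>stages M. measure (reward M h' (state_at M \<pi> h') (action_at M \<pi> h')) (B' h'))
      = (\<Prod>h'\<in>stages M. if h' = h then measure (reward M h s a) B else 1)"
    proof (rule prod.cong[OF refl])
      fix h' assume h': "h' \<in> stages M"
      interpret r: prob_space "reward M h' (state_at M \<pi> h') (action_at M \<pi> h')"
        by (rule reward_prob_space[OF pm(1) h'])
      have "space (reward M h' (state_at M \<pi> h') (action_at M \<pi> h')) = UNIV"
        using sets_eq_imp_space_eq[OF reward_prob_space(2)[OF pm(1) h']] by simp
      with r.prob_space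
      show "measure (reward M h' (state_at M \<pi> h') (action_at M \<pi> h')) (B' h')
        = (if h' = h then measure (reward M h s a) B else 1)"
        using pm by (simp add: B'_def)
    qed
    ultimately show ?thesis using stage by (simp add: D_def)
  qed
  have union: "G \<inter> hit t = (\<Union>\<pi>\<in>?T. D \<pi>)" "{\<omega> \<in> G \<inter> hit t. y t h \<omega> \<in> B} = (\<Union>\<pi>\<in>?T. D' \<pi>)"
    using GP pol_policies[OF t] by (auto simp: D_def D'_def hit_def policies_through_eq[OF stage])
  have disj: "disjoint_family_on D ?T" "disjoint_family_on D' ?T"
    by (auto simp: disjoint_family_on_def D_def D'_def)
  have "measure P {\<omega> \<in> G \<inter> hit t. y t h \<omega> \<in> B} = (\<Sum>\<pi>\<in>?T. measure P (D' \<pi>))"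
    unfolding union(2) by (rule finite_measure_finite_Union) (use D' disj in auto)
  also have "\<dots> = (\<Sum>\<pi>\<in>?T. measure P (D \<pi>)) * measure (reward M h s a) B"
    by (simp add: one sum_distrib_right)
  also have "(\<Sum>\<pi>\<in>?T. measure P (D \<pi>)) = measure P (G \<inter> hit t)"
    unfolding union(1) by (rule finite_measure_finite_Union[symmetric]) (use D disj in auto)
  finally show ?thesis .
qed

text \<open>Restricted to the event, the law of the observed reward is a multiple of the reward
  distribution. As an equality of measures this yields the integrals of all nonnegative
  \<open>f\<close> at once.\<close>

lemma nn_integral_reward_set:
  assumes t: "1 \<le> t" and G: "G \<in> sets (F (t - 1))" and f: "f \<in> borel_measurable borel"
  shows "(\<integral>\<^sup>+\<omega>. indicator (G \<inter> hit t) \<omega> * f (y t h \<omega>) \<partial>P)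
    = emeasure P (G \<inter> hit t) * (\<integral>\<^sup>+x. f x \<partial>reward M h s a)"
proof -
  let ?A = "G \<inter> hit t"
  let ?\<mu> = "density P (indicator ?A)"
  have A: "?A \<in> sets P" using G hit_sets[of t "t - 1"] t sets_F by auto
  have y: "y t h \<in> borel_measurable P"
    by (rule measurable_F_P[OF measurable_obs[OF t order_refl stage]])
  interpret r: prob_space "reward M h s a" by (rule sets_reward)
  have "distr ?\<mu> borel (y t h) = scale_measure (emeasure P ?A) (reward M h s a)"
  proof (rule measure_eqI)
    fix B assume "B \<in> sets (distr ?\<mu> borel (y t h))"
    hence B: "B \<in> sets borel" by simp
    have yB: "y t h -` B \<inter> space P \<in> sets P" using measurable_sets[OF y B] .
    have "emeasure (distr ?\<mu> borel (y t h)) B = emeasure ?\<mu> (y t h -` B \<inter> space P)"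
      using y B by (subst emeasure_distr) auto
    also have "\<dots> = (\<integral>\<^sup>+\<omega>. indicator (?A \<inter> (y t h -` B \<inter> space P)) \<omega> \<partial>P)"
      using A yB by (simp add: emeasure_density indicator_inter_arith)
    also have "\<dots> = emeasure P (?A \<inter> (y t h -` B \<inter> space P))"
      using A yB by (intro nn_integral_indicator) auto
    also have "?A \<inter> (y t h -` B \<inter> space P) = {\<omega> \<in> ?A. y t h \<omega> \<in> B}"
      by (auto simp: hit_def)
    also have "emeasure P {\<omega> \<in> ?A. y t h \<omega> \<in> B} = emeasure P ?A * emeasure (reward M h s a) B"
      unfolding emeasure_eq_measure r.emeasure_eq_measure measure_reward[OF t G B]
      by (simp add: ennreal_mult)
    finally show "emeasure (distr ?\<mu> borel (y t h)) B
      = emeasure (scale_measure (emeasure P ?A) (reward M h s a)) B" by simp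
  qed (simp add: sets_reward)
  hence "(\<integral>\<^sup>+x. f x \<partial>distr ?\<mu> borel (y t h)) = emeasure P ?A * (\<integral>\<^sup>+x. f x \<partial>reward M h s a)"
    using f by (simp add: nn_integral_scale_measure measurable_cong_sets[OF sets_reward(1) refl])
  moreover have "(\<integral>\<^sup>+x. f x \<partial>distr ?\<mu> borel (y t h)) = (\<integral>\<^sup>+\<omega>. f (y t h \<omega>) \<partial>?\<mu>)"
    using y f by (intro nn_integral_distr) auto
  moreover have "\<dots> = (\<integral>\<^sup>+\<omega>. indicator ?A \<omega> * f (y t h \<omega>) \<partial>P)"
    using A y f by (intro nn_integral_density) auto
  ultimately show ?thesis by simp
qed

text \<open>The conditional expectation of \<open>f\<close> given the past and a visit, in
  integrated form. It extends from indicators to all nonnegative weights known before the episode by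
  induction over multiples, sums and increasing limits.\<close>

lemma nn_integral_reward:
  assumes t: "1 \<le> t" and W: "W \<in> borel_measurable (F (t - 1))" and f: "f \<in> borel_measurable borel"
  shows "(\<integral>\<^sup>+\<omega>. W \<omega> * (indicator (hit t) \<omega> * f (y t h \<omega>)) \<partial>P)
    = (\<integral>\<^sup>+\<omega>. W \<omega> * indicator (hit t) \<omega> \<partial>P) * (\<integral>\<^sup>+x. f x \<partial>reward M h s a)"
  using W
proof (induction W rule: borel_measurable_induct)
  case (cong W W')
  have "(\<integral>\<^sup>+\<omega>. W \<omega> * (indicator (hit t) \<omega> * f (y t h \<omega>)) \<partial>P)
      = (\<integral>\<^sup>+\<omega>. W' \<omega> * (indicator (hit t) \<omega> * f (y t h \<omega>)) \<partial>P)"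
    "(\<integral>\<^sup>+\<omega>. W \<omega> * indicator (hit t) \<omega> \<partial>P) = (\<integral>\<^sup>+\<omega>. W' \<omega> * indicator (hit t) \<omega> \<partial>P)"
    using cong.hyps(3) by (auto intro!: nn_integral_cong simp: space_F)
  thus ?case using cong by simp
next
  case (set G)
  have A: "G \<inter> hit t \<in> sets P" using set hit_sets[of t "t - 1"] t sets_F by auto
  show ?case
    using nn_integral_reward_set[OF t set f] A
    by (simp add: indicator_inter_arith mult.assoc flip: nn_integral_indicator)
next
  case (mult W c)
  have [measurable]: "W \<in> borel_measurable P" "hit t \<in> sets P" "y t h \<in> borel_measurable P" "f \<in> borel_measurable borel"
    using measurable_F_P[OF mult.hyps(2)] hit_sets[of t "t - 1"] t sets_F f
      measurable_F_P[OF measurable_obs[OF t order_refl stage]] by auto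
  show ?case using mult by (simp add: mult.assoc nn_integral_cmult)
next
  case (add W W')
  have [measurable]: "W \<in> borel_measurable P" "W' \<in> borel_measurable P" "hit t \<in> sets P" "y t h \<in> borel_measurable P" "f \<in> borel_measurable borel"
    using measurable_F_P[OF add.hyps(1)] measurable_F_P[OF add.hyps(3)] hit_sets[of t "t - 1"] t sets_F f
      measurable_F_P[OF measurable_obs[OF t order_refl stage]] by auto
  show ?case using add by (simp add: distrib_right nn_integral_add)
next
  case (seq U)
  have [measurable]: "U i \<in> borel_measurable P" for i using measurable_F_P[OF seq.hyps(1)] .
  have [measurable]: "hit t \<in> sets P" "y t h \<in> borel_measurable P" "f \<in> borel_measurable borel"
    using hit_sets[of t "t - 1"] t sets_F f
      measurable_F_P[OF measurable_obs[OF t order_refl stage]] by auto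
  have inc: "incseq (\<lambda>i \<omega>. U i \<omega> * g \<omega>)" for g :: "'w \<Rightarrow> ennreal"
    using seq.hyps(3) by (auto simp: incseq_def le_fun_def intro!: mult_right_mono)
  have sup: "(\<integral>\<^sup>+\<omega>. (SUP i. U i) \<omega> * g \<omega> \<partial>P) = (SUP i. \<integral>\<^sup>+\<omega>. U i \<omega> * g \<omega> \<partial>P)"
    if [measurable]: "g \<in> borel_measurable P" for g
  proof -
    have "(\<integral>\<^sup>+\<omega>. (SUP i. U i) \<omega> * g \<omega> \<partial>P) = (\<integral>\<^sup>+\<omega>. (SUP i. U i \<omega> * g \<omega>) \<partial>P)"
      by (intro nn_integral_cong) (simp add: SUP_mult_right_ennreal image_comp)
    also have "\<dots> = (SUP i. \<integral>\<^sup>+\<omega>. U i \<omega> * g \<omega> \<partial>P)"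
      by (rule nn_integral_monotone_convergence_SUP[OF inc]) simp
    finally show ?thesis .
  qed
  show ?case
    by (subst (1 2) sup) (simp_all add: seq.IH SUP_mult_right_ennreal)
qed

end

end

section \<open>Exponential supermartingale, tail bounds and union bound\<close>

context mdp_interaction
begin

context
  fixes s a h assumes triple: "(s, a, h) \<in> triples M"
begin

definition deviation :: "nat \<Rightarrow> 'w \<Rightarrow> real" where
  "deviation t \<omega> = (\<Sum>l\<in>visit_episodes M (plays \<omega>) t h s a. y l h \<omega> - mean_reward M h s a)"

text \<open>The count at \<open>l\<close> includes episode \<open>l\<close> itself, so exactly the
  first \<open>n\<close> visits contribute: each gives its centred reward times \<theta>,
  compensated by the sub-Gaussian exponent.\<close>

definition log_martingale :: "real \<Rightarrow> real \<Rightarrow> nat \<Rightarrow> nat \<Rightarrow> 'w \<Rightarrow> real" where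
  "log_martingale \<sigma> \<theta> n t \<omega> = (\<Sum>l\<in>{1..t}.
     if (s, a, h) \<in> trajectory M (pol l \<omega>) \<and> visits M (plays \<omega>) l h s a \<le> n
     then \<theta> * (y l h \<omega> - mean_reward M h s a) - \<theta>\<^sup>2 * \<sigma>\<^sup>2 / 2 else 0)"

lemma pred_trajectory: "1 \<le> l \<Longrightarrow> l \<le> Suc u \<Longrightarrow> Measurable.pred (F u) (\<lambda>\<omega>. (s, a, h) \<in> trajectory M (pol l \<omega>))"
  by (rule pred_pol)

lemma measurable_log_martingale: "log_martingale \<sigma> \<theta> n t \<in> borel_measurable (F t)"
  unfolding log_martingale_def
proof (rule borel_measurable_sum)
  fix l assume "l \<in> {1..t}"
  hence l: "1 \<le> l" "l \<le> t" "l \<le> Suc t" by auto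
  have [measurable]: "Measurable.pred (F t) (\<lambda>\<omega>. (s, a, h) \<in> trajectory M (pol l \<omega>))"
    "Measurable.pred (F t) (\<lambda>\<omega>. visits M (plays \<omega>) l h s a \<le> n)" "y l h \<in> borel_measurable (F t)"
    using pred_trajectory[OF l(1,3)] pred_visits[OF stage[OF triple] l(3), of "\<lambda>k. k \<le> n"]
      measurable_obs[OF l(1,2) stage[OF triple]] by auto
  show "(\<lambda>\<omega>. if (s, a, h) \<in> trajectory M (pol l \<omega>) \<and> visits M (plays \<omega>) l h s a \<le> n
     then \<theta> * (y l h \<omega> - mean_reward M h s a) - \<theta>\<^sup>2 * \<sigma>\<^sup>2 / 2 else 0) \<in> borel_measurable (F t)"
    by measurable
qed

lemma measurable_deviation: "deviation t \<in> borel_measurable (F t)"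
proof -
  have "deviation t = (\<lambda>\<omega>. \<Sum>l\<in>{1..t}. if (s, a, h) \<in> trajectory M (pol l \<omega>)
      then y l h \<omega> - mean_reward M h s a else 0)"
  proof (rule ext)
    fix \<omega>
    show "deviation t \<omega> = (\<Sum>l\<in>{1..t}. if (s, a, h) \<in> trajectory M (pol l \<omega>)
      then y l h \<omega> - mean_reward M h s a else 0)"
      unfolding deviation_def visit_episodes_eq[OF stage[OF triple]] by (rule sum.inter_filter) simp
  qed
  also have "\<dots> \<in> borel_measurable (F t)"
  proof (rule borel_measurable_sum)
    fix l assume "l \<in> {1..t}"
    hence l: "1 \<le> l" "l \<le> t" "l \<le> Suc t" by auto
    have [measurable]: "Measurable.pred (F t) (\<lambda>\<omega>. (s, a, h) \<in> trajectory M (pol l \<omega>))" "y l h \<in> borel_measurable (F t)"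
      using pred_trajectory[OF l(1,3)] measurable_obs[OF l(1,2) stage[OF triple]] by auto
    show "(\<lambda>\<omega>. if (s, a, h) \<in> trajectory M (pol l \<omega>)
      then y l h \<omega> - mean_reward M h s a else 0) \<in> borel_measurable (F t)" by measurable
  qed
  finally show ?thesis .
qed

lemma nn_integral_exp_reward_le:
  assumes "sub_gaussian \<sigma> (reward M h s a)"
  shows "(\<integral>\<^sup>+x. ennreal (exp (\<theta> * (x - mean_reward M h s a) - \<theta>\<^sup>2 * \<sigma>\<^sup>2 / 2)) \<partial>reward M h s a) \<le> 1"
proof -
  let ?D = "reward M h s a" and ?r = "mean_reward M h s a"
  let ?c = "exp (- (\<theta>\<^sup>2 * \<sigma>\<^sup>2 / 2))"
  have int: "integrable ?D (\<lambda>x. exp (\<theta> * (x - ?r)))" "(\<integral>x. exp (\<theta> * (x - ?r)) \<partial>?D) \<le> exp (\<theta>\<^sup>2 * \<sigma>\<^sup>2 / 2)"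
    using assms by (auto simp: sub_gaussian_def mean_reward_def)
  have eq: "exp (\<theta> * (x - ?r) - \<theta>\<^sup>2 * \<sigma>\<^sup>2 / 2) = ?c * exp (\<theta> * (x - ?r))" for x
    by (simp flip: exp_add)
  have "(\<integral>x. ?c * exp (\<theta> * (x - ?r)) \<partial>?D) = ?c * (\<integral>x. exp (\<theta> * (x - ?r)) \<partial>?D)" by simp
  also have "\<dots> \<le> ?c * exp (\<theta>\<^sup>2 * \<sigma>\<^sup>2 / 2)" using int by (intro mult_left_mono) auto
  also have "\<dots> = 1" by (simp flip: exp_add)
  finally have le: "(\<integral>x. ?c * exp (\<theta> * (x - ?r)) \<partial>?D) \<le> 1" .
  have "(\<integral>\<^sup>+x. ennreal (exp (\<theta> * (x - ?r) - \<theta>\<^sup>2 * \<sigma>\<^sup>2 / 2)) \<partial>?D) = ennreal (\<integral>x. ?c * exp (\<theta> * (x - ?r)) \<partial>?D)"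
    unfolding eq by (rule nn_integral_eq_integral) (use int in auto)
  thus ?thesis using ennreal_leI[OF le] by simp
qed

text \<open>Episode \<open>Suc t\<close> changes the exponent only if it makes one of the first
  \<open>n\<close> visits, which is decided by the past. There the weight is multiplied by an
  exponential factor with mean at most 1; elsewhere it stays as it is.\<close>

lemma supermartingale:
  assumes sg: "sub_gaussian \<sigma> (reward M h s a)"
  shows "(\<integral>\<^sup>+\<omega>. ennreal (exp (log_martingale \<sigma> \<theta> n t \<omega>)) \<partial>P) \<le> 1"
proof (induction t)
  case 0
  show ?case by (simp add: log_martingale_def emeasure_space_1)
next
  case (Suc t)
  let ?Z = "\<lambda>\<omega>. ennreal (exp (log_martingale \<sigma> \<theta> n t \<omega>))"
  let ?r = "mean_reward M h s a"
  define f where "f x = ennreal (exp (\<theta> * (x - ?r) - \<theta>\<^sup>2 * \<sigma>\<^sup>2 / 2))" for x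
  define Q where "Q = {\<omega> \<in> space P. visits M (plays \<omega>) (Suc t) h s a \<le> n}"
  let ?V = "hit s a h (Suc t)"
  have Q: "Q \<in> sets (F t)"
    using pred_visits[OF stage[OF triple], of "Suc t" t "\<lambda>k. k \<le> n" s a] by (simp add: Q_def pred_def space_F)
  have V: "?V \<in> sets (F t)" using hit_sets[OF triple, of "Suc t" t] by simp
  have [measurable]: "Q \<in> sets P" "?V \<in> sets P" using Q V sets_F by auto
  have [measurable]: "log_martingale \<sigma> \<theta> n t \<in> borel_measurable P"
    by (rule measurable_F_P[OF measurable_log_martingale])
  have [measurable]: "y (Suc t) h \<in> borel_measurable P"
    by (rule measurable_F_P[OF measurable_obs[OF _ order_refl stage[OF triple]]]) simp
  have f [measurable]: "f \<in> borel_measurable borel" unfolding f_def by measurable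
  have W: "(\<lambda>\<omega>. ?Z \<omega> * indicator Q \<omega>) \<in> borel_measurable (F t)"
    using measurable_log_martingale[of \<sigma> \<theta> n t] Q by measurable
  have split: "ennreal (exp (log_martingale \<sigma> \<theta> n (Suc t) \<omega>))
     = ?Z \<omega> * indicator (- (Q \<inter> ?V)) \<omega> + ?Z \<omega> * indicator Q \<omega> * (indicator ?V \<omega> * f (y (Suc t) h \<omega>))"
    if "\<omega> \<in> space P" for \<omega>
    using that by (auto simp: log_martingale_def Q_def hit_def[OF triple] f_def exp_add ennreal_mult split: split_indicator)
  let ?I = "\<integral>\<^sup>+\<omega>. ?Z \<omega> * indicator (- (Q \<inter> ?V)) \<omega> \<partial>P"
  let ?J = "\<integral>\<^sup>+\<omega>. ?Z \<omega> * indicator Q \<omega> * indicator ?V \<omega> \<partial>P"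
  have "(\<integral>\<^sup>+\<omega>. ?Z \<omega> * indicator Q \<omega> * (indicator ?V \<omega> * f (y (Suc t) h \<omega>)) \<partial>P)
     = ?J * (\<integral>\<^sup>+x. f x \<partial>reward M h s a)"
    by (rule nn_integral_reward[OF triple _ _ f]) (simp_all add: W)
  also have "\<dots> \<le> ?J * 1"
    unfolding f_def by (rule mult_left_mono[OF nn_integral_exp_reward_le[OF sg]]) simp
  finally have J: "(\<integral>\<^sup>+\<omega>. ?Z \<omega> * indicator Q \<omega> * (indicator ?V \<omega> * f (y (Suc t) h \<omega>)) \<partial>P) \<le> ?J"
    by (simp only: mult_1_right)
  have "(\<integral>\<^sup>+\<omega>. ennreal (exp (log_martingale \<sigma> \<theta> n (Suc t) \<omega>)) \<partial>P)
     = (\<integral>\<^sup>+\<omega>. ?Z \<omega> * indicator (- (Q \<inter> ?V)) \<omega> + ?Z \<omega> * indicator Q \<omega> * (indicator ?V \<omega> * f (y (Suc t) h \<omega>)) \<partial>P)"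
    by (intro nn_integral_cong split)
  also have "\<dots> = ?I + (\<integral>\<^sup>+\<omega>. ?Z \<omega> * indicator Q \<omega> * (indicator ?V \<omega> * f (y (Suc t) h \<omega>)) \<partial>P)"
    by (rule nn_integral_add) measurable
  also have "\<dots> \<le> ?I + ?J" by (rule add_left_mono[OF J])
  also have "\<dots> = (\<integral>\<^sup>+\<omega>. ?Z \<omega> * indicator (- (Q \<inter> ?V)) \<omega> + ?Z \<omega> * indicator Q \<omega> * indicator ?V \<omega> \<partial>P)"
    by (rule nn_integral_add[symmetric]) measurable
  also have "\<dots> = (\<integral>\<^sup>+\<omega>. ?Z \<omega> \<partial>P)"
    by (intro nn_integral_cong) (simp split: split_indicator)
  also have "\<dots> \<le> 1" by (rule Suc.IH)
  finally show ?case .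
qed

text \<open>The exponent is frozen after the \<open>n\<close>-th visit, so at any later time it equals the one at a
  time \<open>t\<close> with exactly \<open>n\<close> visits.\<close>

lemma log_martingale_frozen:
  assumes n: "visits M (plays \<omega>) t h s a = n" and t: "t \<le> T"
  shows "log_martingale \<sigma> \<theta> n T \<omega> = \<theta> * deviation t \<omega> - real n * \<theta>\<^sup>2 * \<sigma>\<^sup>2 / 2"
proof -
  let ?hit = "\<lambda>l. (s, a, h) \<in> trajectory M (pol l \<omega>)" and ?vis = "\<lambda>l. visits M (plays \<omega>) l h s a"
  \<comment> \<open>Any visit after \<open>t\<close> has number at least \<open>n + 1\<close> and is
    not counted.\<close>
  have "l \<le> t" if "1 \<le> l" "?hit l" "?vis l \<le> n" for l
  proof (rule ccontr)
    assume "\<not> l \<le> t"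
    then obtain l' where l': "l = Suc l'" "t \<le> l'" by (cases l) auto
    have "?vis l = ?vis l' + 1" using that l' by (simp add: visits_Suc[OF stage[OF triple]])
    moreover have "?vis t \<le> ?vis l'" by (rule visits_mono[OF l'(2)])
    ultimately show False using that n by simp
  qed
  moreover have "?vis l \<le> n" if "l \<le> t" for l using visits_mono[OF that] n by metis
  ultimately have set_eq: "{l \<in> {1..T}. ?hit l \<and> ?vis l \<le> n} = visit_episodes M (plays \<omega>) t h s a"
    using t by (auto simp: visit_episodes_eq[OF stage[OF triple]])
  have "log_martingale \<sigma> \<theta> n T \<omega>
      = (\<Sum>l\<in>{l \<in> {1..T}. ?hit l \<and> ?vis l \<le> n}. \<theta> * (y l h \<omega> - mean_reward M h s a) - \<theta>\<^sup>2 * \<sigma>\<^sup>2 / 2)"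
    unfolding log_martingale_def by (rule sum.inter_filter[symmetric]) simp
  also have "\<dots> = \<theta> * deviation t \<omega> - real n * \<theta>\<^sup>2 * \<sigma>\<^sup>2 / 2"
    unfolding set_eq deviation_def using n
    by (subst sum_subtractf) (simp add: visits_def flip: sum_distrib_left)
  finally show ?thesis .
qed

lemma exceed_sets: "{\<omega> \<in> space P. \<exists>t\<le>T. visits M (plays \<omega>) t h s a = n \<and> c \<le> \<theta> * deviation t \<omega>} \<in> sets P"
proof -
  have [measurable]: "Measurable.pred P (\<lambda>\<omega>. visits M (plays \<omega>) t h s a = n)" "deviation t \<in> borel_measurable P" for t
    using measurable_F_P[OF pred_visits[OF stage[OF triple], of t t "\<lambda>k. k = n" s a]]
      measurable_F_P[OF measurable_deviation] by auto
  show ?thesis by measurable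
qed

lemma exceed_prob:
  assumes sg: "sub_gaussian \<sigma> (reward M h s a)"
  shows "measure P {\<omega> \<in> space P. \<exists>t. visits M (plays \<omega>) t h s a = n \<and> c \<le> \<theta> * deviation t \<omega>}
    \<le> exp (real n * \<theta>\<^sup>2 * \<sigma>\<^sup>2 / 2 - c)"
proof -
  define A where "A T = {\<omega> \<in> space P. \<exists>t\<le>T. visits M (plays \<omega>) t h s a = n \<and> c \<le> \<theta> * deviation t \<omega>}" for T
  let ?c = "real n * \<theta>\<^sup>2 * \<sigma>\<^sup>2 / 2 - c"
  have sets: "A T \<in> sets P" for T unfolding A_def by (rule exceed_sets)
  have bound: "measure P (A T) \<le> exp ?c" for T
  proof -
    let ?Z = "\<lambda>\<omega>. ennreal (exp (log_martingale \<sigma> \<theta> n T \<omega>))"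
    have [measurable]: "log_martingale \<sigma> \<theta> n T \<in> borel_measurable P"
      by (rule measurable_F_P[OF measurable_log_martingale])
    have "A T \<subseteq> {\<omega> \<in> space P. 1 \<le> ennreal (exp ?c) * ?Z \<omega>}"
    proof
      fix \<omega> assume "\<omega> \<in> A T"
      then obtain t where t: "\<omega> \<in> space P" "t \<le> T" "visits M (plays \<omega>) t h s a = n" "c \<le> \<theta> * deviation t \<omega>"
        by (auto simp: A_def)
      have "0 \<le> ?c + log_martingale \<sigma> \<theta> n T \<omega>" using t(4) by (simp add: log_martingale_frozen[OF t(3,2)])
      hence "1 \<le> exp ?c * exp (log_martingale \<sigma> \<theta> n T \<omega>)" by (simp flip: exp_add)
      hence "ennreal 1 \<le> ennreal (exp ?c * exp (log_martingale \<sigma> \<theta> n T \<omega>))" by (rule ennreal_leI)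
      hence "1 \<le> ennreal (exp ?c) * ?Z \<omega>" by (simp add: ennreal_mult)
      with t(1) show "\<omega> \<in> {\<omega> \<in> space P. 1 \<le> ennreal (exp ?c) * ?Z \<omega>}" by simp
    qed
    hence "emeasure P (A T) \<le> emeasure P {\<omega> \<in> space P. 1 \<le> ennreal (exp ?c) * ?Z \<omega>}"
      by (rule emeasure_mono) measurable
    also have "\<dots> \<le> ennreal (exp ?c) * (\<integral>\<^sup>+\<omega>. ?Z \<omega> * indicator (space P) \<omega> \<partial>P)"
      by (rule nn_integral_Markov_inequality) measurable
    also have "(\<integral>\<^sup>+\<omega>. ?Z \<omega> * indicator (space P) \<omega> \<partial>P) = (\<integral>\<^sup>+\<omega>. ?Z \<omega> \<partial>P)"
      by (intro nn_integral_cong) simp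
    also have "ennreal (exp ?c) * (\<integral>\<^sup>+\<omega>. ?Z \<omega> \<partial>P) \<le> ennreal (exp ?c) * 1"
      by (intro mult_left_mono supermartingale sg) simp
    finally show ?thesis by (simp add: emeasure_eq_measure)
  qed
  have inc: "incseq A" by (auto simp: A_def incseq_def intro: order_trans)
  have "(\<lambda>T. measure P (A T)) \<longlonglongrightarrow> measure P (\<Union>T. A T)"
    by (rule finite_Lim_measure_incseq) (use sets inc in auto)
  hence "measure P (\<Union>T. A T) \<le> exp ?c" by (rule LIMSEQ_le_const2) (use bound in auto)
  moreover have "(\<Union>T. A T) = {\<omega> \<in> space P. \<exists>t. visits M (plays \<omega>) t h s a = n \<and> c \<le> \<theta> * deviation t \<omega>}"
    by (auto simp: A_def)
  ultimately show ?thesis by simp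
qed

lemma deviation_sets: "{\<omega> \<in> space P. \<exists>t. visits M (plays \<omega>) t h s a = n \<and> c \<le> \<bar>deviation t \<omega>\<bar>} \<in> sets P"
proof -
  have [measurable]: "Measurable.pred P (\<lambda>\<omega>. visits M (plays \<omega>) t h s a = n)" "deviation t \<in> borel_measurable P" for t
    using measurable_F_P[OF pred_visits[OF stage[OF triple], of t t "\<lambda>k. k = n" s a]]
      measurable_F_P[OF measurable_deviation] by auto
  show ?thesis by measurable
qed

lemma deviation_prob:
  assumes sg: "sub_gaussian \<sigma> (reward M h s a)" and \<sigma>: "0 < \<sigma>" and n: "1 \<le> n" and c: "0 \<le> c"
  shows "measure P {\<omega> \<in> space P. \<exists>t. visits M (plays \<omega>) t h s a = n \<and> c \<le> \<bar>deviation t \<omega>\<bar>}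
    \<le> 2 * exp (- (c\<^sup>2 / (2 * real n * \<sigma>\<^sup>2)))"
proof (cases "c = 0")
  case True
  have "measure P {\<omega> \<in> space P. \<exists>t. visits M (plays \<omega>) t h s a = n \<and> c \<le> \<bar>deviation t \<omega>\<bar>} \<le> 1" by (rule prob_le_1)
  also have "1 \<le> 2 * exp (- (c\<^sup>2 / (2 * real n * \<sigma>\<^sup>2)))" using True by simp
  finally show ?thesis .
next
  case False
  \<comment> \<open>The minimiser of \<open>real n * \<theta>\<^sup>2 * \<sigma>\<^sup>2 / 2 -
    \<theta> * c\<close>; taken with both signs it serves the two tails.\<close>
  define \<theta> where "\<theta> = c / (real n * \<sigma>\<^sup>2)"
  have \<theta>: "0 < \<theta>" using c False n \<sigma> by (simp add: \<theta>_def)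
  let ?E = "\<lambda>\<mu>. {\<omega> \<in> space P. \<exists>t. visits M (plays \<omega>) t h s a = n \<and> \<theta> * c \<le> \<mu> * deviation t \<omega>}"
  have expo: "real n * \<theta>\<^sup>2 * \<sigma>\<^sup>2 / 2 - \<theta> * c = - (c\<^sup>2 / (2 * real n * \<sigma>\<^sup>2))"
    using n \<sigma> by (simp add: \<theta>_def field_simps power2_eq_square)
  have meas: "?E \<mu> \<in> sets P" for \<mu>
  proof -
    have [measurable]: "Measurable.pred P (\<lambda>\<omega>. visits M (plays \<omega>) t h s a = n)" "deviation t \<in> borel_measurable P" for t
      using measurable_F_P[OF pred_visits[OF stage[OF triple], of t t "\<lambda>k. k = n" s a]]
        measurable_F_P[OF measurable_deviation] by auto
    show ?thesis by measurable
  qed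
  have "{\<omega> \<in> space P. \<exists>t. visits M (plays \<omega>) t h s a = n \<and> c \<le> \<bar>deviation t \<omega>\<bar>} \<subseteq> ?E \<theta> \<union> ?E (- \<theta>)"
  proof
    fix \<omega> assume "\<omega> \<in> {\<omega> \<in> space P. \<exists>t. visits M (plays \<omega>) t h s a = n \<and> c \<le> \<bar>deviation t \<omega>\<bar>}"
    then obtain t where t: "\<omega> \<in> space P" "visits M (plays \<omega>) t h s a = n" "c \<le> \<bar>deviation t \<omega>\<bar>" by auto
    have "\<theta> * c \<le> \<theta> * \<bar>deviation t \<omega>\<bar>" using t(3) \<theta> by (intro mult_left_mono) auto
    hence "\<theta> * c \<le> \<theta> * deviation t \<omega> \<or> \<theta> * c \<le> - \<theta> * deviation t \<omega>"
      by (cases "0 \<le> deviation t \<omega>") auto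
    thus "\<omega> \<in> ?E \<theta> \<union> ?E (- \<theta>)" using t(1,2) by blast
  qed
  hence "measure P {\<omega> \<in> space P. \<exists>t. visits M (plays \<omega>) t h s a = n \<and> c \<le> \<bar>deviation t \<omega>\<bar>}
      \<le> measure P (?E \<theta> \<union> ?E (- \<theta>))"
    by (rule finite_measure_mono) (intro sets.Un meas)
  also have "\<dots> \<le> measure P (?E \<theta>) + measure P (?E (- \<theta>))"
    by (rule measure_Un_le[OF meas meas])
  also have "\<dots> \<le> exp (real n * \<theta>\<^sup>2 * \<sigma>\<^sup>2 / 2 - \<theta> * c) + exp (real n * (- \<theta>)\<^sup>2 * \<sigma>\<^sup>2 / 2 - \<theta> * c)"
    by (intro add_mono exceed_prob sg)
  also have "\<dots> = 2 * exp (- (c\<^sup>2 / (2 * real n * \<sigma>\<^sup>2)))" by (simp add: expo)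
  finally show ?thesis .
qed

lemma est_reward_deviation:
  assumes "0 < visits M (plays \<omega>) t h s a"
  shows "est_reward M (plays \<omega>) (obs \<omega>) t h s a - mean_reward M h s a
    = deviation t \<omega> / real (visits M (plays \<omega>) t h s a)"
  using assms by (simp add: est_reward_def deviation_def sum_subtractf visits_def field_simps)

end

text \<open>The logarithm in \<open>threshold\<close> makes the two-sided tail at count
  \<open>n\<close> equal to twice \<open>\<delta> / (4 * n\<^sup>2 * N)\<close>. Summing over
  \<open>n\<close> gives at most \<open>\<delta> / N\<close> for each triple, and the
  \<open>N\<close> triples add up to \<delta>.\<close>

lemma concentrated_prob:
  assumes \<sigma>: "0 < \<sigma>" and \<delta>: "0 < \<delta>" "\<delta> < 1" and sg: "sub_gaussian_rewards M \<sigma>"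
  shows "\<exists>G\<in>sets P. 1 - \<delta> \<le> measure P G \<and>
    (\<forall>\<omega>\<in>G. \<omega> \<in> space P \<and> concentrated_path M \<sigma> \<delta> (plays \<omega>) (obs \<omega>))"
proof -
  define N where "N = real (num_triples M)"
  have N: "1 \<le> N" using num_triples_pos[OF wf] by (simp add: N_def)
  \<comment> \<open>The confidence radius multiplied by \<open>n\<close>, because deviations are
    sums and not means.\<close>
  define c where "c n = sqrt (real n * threshold M \<sigma> \<delta> n)" for n
  define bad where "bad e n = (case e of (s, a, h) \<Rightarrow> {\<omega> \<in> space P. \<exists>t.
      visits M (plays \<omega>) t h s a = Suc n \<and> c (Suc n) \<le> \<bar>deviation s a h t \<omega>\<bar>})" for e n
  have path: "eprl_path M \<sigma> \<delta> (plays \<omega>)" if "\<omega> \<in> space P" for \<omega>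
    by unfold_locales (use wf \<sigma> \<delta> pol_policies that in auto)
  \<comment> \<open>Some outcome is fixed to enter the path locale; the threshold does not depend on
    it.\<close>
  obtain \<omega>0 where \<omega>0: "\<omega>0 \<in> space P" using not_empty by auto
  have thr: "0 \<le> threshold M \<sigma> \<delta> n" for n using eprl_path.threshold_nonneg[OF path[OF \<omega>0]] .
  have bad_sets: "bad e n \<in> sets P" if "e \<in> triples M" for e n
    using deviation_sets that by (auto simp: bad_def split: prod.splits)
  have bad_prob: "measure P (bad e n) \<le> \<delta> / (2 * N) * (1 / (real (Suc n))\<^sup>2)" if e: "e \<in> triples M" for e n
  proof -
    obtain s a h where e': "e = (s, a, h)" by (metis prod_cases3)
    have tr: "(s, a, h) \<in> triples M" using e e' by simp
    have sg': "sub_gaussian \<sigma> (reward M h s a)" using sg tr by (auto simp: sub_gaussian_rewards_def)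
    let ?x = "4 * (real (Suc n))\<^sup>2 * N / \<delta>"
    have x: "0 < ?x" using N \<delta> by (simp del: of_nat_Suc)
    have "(c (Suc n))\<^sup>2 / (2 * real (Suc n) * \<sigma>\<^sup>2) = threshold M \<sigma> \<delta> (Suc n) / (2 * \<sigma>\<^sup>2)"
      using thr[of "Suc n"] by (simp add: c_def del: of_nat_Suc)
    also have "\<dots> = ln ?x" using \<sigma> by (simp add: threshold_def N_def)
    finally have "exp (- ((c (Suc n))\<^sup>2 / (2 * real (Suc n) * \<sigma>\<^sup>2))) = 1 / ?x"
      using x by (simp add: exp_minus inverse_eq_divide del: of_nat_Suc)
    moreover have "measure P (bad e n) \<le> 2 * exp (- ((c (Suc n))\<^sup>2 / (2 * real (Suc n) * \<sigma>\<^sup>2)))"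
      unfolding bad_def e' prod.case
      by (rule deviation_prob[OF tr sg' \<sigma>]) (use thr[of "Suc n"] in \<open>auto simp: c_def\<close>)
    ultimately show ?thesis by (simp add: mult.commute mult.left_commute del: of_nat_Suc)
  qed
  let ?s = "\<lambda>n. \<delta> / (2 * N) * (1 / (real (Suc n))\<^sup>2)"
  have sum_s: "summable ?s" by (intro summable_mult sum_inverse_squares_le_2)
  have bad_union: "measure P (\<Union>n. bad e n) \<le> \<delta> / N" if e: "e \<in> triples M" for e
  proof -
    have sm: "summable (\<lambda>n. measure P (bad e n))"
      by (rule summable_comparison_test'[OF sum_s, of 0]) (use bad_prob[OF e] in auto)
    have "measure P (\<Union>n. bad e n) \<le> (\<Sum>n. measure P (bad e n))"
      by (rule finite_measure_subadditive_countably[OF _ sm]) (use bad_sets[OF e] in auto)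
    also have "\<dots> \<le> (\<Sum>n. ?s n)" by (rule suminf_le[OF bad_prob[OF e] sm sum_s])
    also have "\<dots> = \<delta> / (2 * N) * (\<Sum>n. 1 / (real (Suc n))\<^sup>2)"
      by (rule suminf_mult[OF sum_inverse_squares_le_2(1)])
    also have "\<dots> \<le> \<delta> / (2 * N) * 2"
      using N \<delta> by (intro mult_left_mono sum_inverse_squares_le_2(2)) auto
    finally show ?thesis using N by (simp add: field_simps)
  qed
  define B where "B = (\<Union>e\<in>triples M. \<Union>n. bad e n)"
  have un_sets: "(\<Union>n. bad e n) \<in> sets P" if "e \<in> triples M" for e
    using bad_sets[OF that] by auto
  have B_sets: "B \<in> sets P" unfolding B_def by (rule sets.finite_UN[OF finite_triples un_sets])
  have "measure P B \<le> (\<Sum>e\<in>triples M. measure P (\<Union>n. bad e n))"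
    unfolding B_def by (rule finite_measure_subadditive_finite) (use un_sets in auto)
  also have "\<dots> \<le> (\<Sum>e\<in>triples M. \<delta> / N)" by (rule sum_mono) (rule bad_union)
  also have "\<dots> = N * (\<delta> / N)" by (simp add: N_def num_triples_def)
  also have "\<dots> = \<delta>" using N by simp
  finally have "1 - \<delta> \<le> measure P (space P - B)" using B_sets by (simp add: prob_compl)
  moreover have "concentrated_path M \<sigma> \<delta> (plays \<omega>) (obs \<omega>)" if \<omega>: "\<omega> \<in> space P - B" for \<omega>
  proof -
    interpret p: eprl_path M \<sigma> \<delta> "plays \<omega>" "obs \<omega>" by (rule path) (use \<omega> in simp)
    show ?thesis
    proof
      fix t s a h assume tr: "(s, a, h) \<in> triples M" and pos: "0 < visits M (plays \<omega>) t h s a"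
      let ?n = "visits M (plays \<omega>) t h s a"
      obtain m where m: "?n = Suc m" using pos by (cases ?n) auto
      have "\<omega> \<notin> bad (s, a, h) m" using \<omega> tr by (auto simp: B_def)
      hence dev: "\<bar>deviation s a h t \<omega>\<bar> \<le> c ?n" using \<omega> m by (fastforce simp: bad_def)
      have "\<bar>est_reward M (plays \<omega>) (obs \<omega>) t h s a - mean_reward M h s a\<bar> = \<bar>deviation s a h t \<omega>\<bar> / real ?n"
        using pos by (simp add: est_reward_deviation[OF tr])
      also have "\<dots> \<le> c ?n / real ?n" using dev by (rule divide_right_mono) simp
      also have "\<dots> = p.rate ?n"
      proof -
        have "real ?n = sqrt (real ?n) * sqrt (real ?n)" by simp
        thus ?thesis using pos by (simp add: c_def p.rate_def real_sqrt_mult real_sqrt_divide field_simps)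
      qed
      finally show "\<bar>est_reward M (plays \<omega>) (obs \<omega>) t h s a - mean_reward M h s a\<bar> \<le> p.rate ?n" .
    qed
  qed
  ultimately show ?thesis using B_sets by (intro bexI[of _ "space P - B"]) auto
qed

end

section \<open>Measurability of the sample complexity\<close>

text \<open>Writes the event as a countable union over stopping episodes. Its measurability matters,
  since \<open>measure\<close> is 0 outside the sigma-algebra and monotonicity is applied to this
  event at the end.\<close>

lemma sample_complexity_le_iff:
  "ereal_of_enat (sample_complexity M \<sigma> \<epsilon> \<delta> p y) \<le> ereal c \<longleftrightarrow>
    (\<exists>t\<ge>1. stop_cond M \<sigma> \<epsilon> \<delta> p y t \<and> real t \<le> c)"
proof (cases "\<exists>t\<ge>1. stop_cond M \<sigma> \<epsilon> \<delta> p y t")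
  case True
  define t0 where "t0 = (LEAST t. 1 \<le> t \<and> stop_cond M \<sigma> \<epsilon> \<delta> p y t)"
  have t0: "1 \<le> t0 \<and> stop_cond M \<sigma> \<epsilon> \<delta> p y t0"
    unfolding t0_def by (rule LeastI_ex) (use True in blast)
  have least: "t0 \<le> t" if "1 \<le> t" "stop_cond M \<sigma> \<epsilon> \<delta> p y t" for t
    unfolding t0_def by (rule Least_le) (use that in simp)
  have "sample_complexity M \<sigma> \<epsilon> \<delta> p y = enat t0"
    unfolding sample_complexity_def
    by (rule antisym) (use t0 least in \<open>auto intro!: INF_lower INF_greatest\<close>)
  thus ?thesis using t0 least by (auto intro: order_trans[OF of_nat_mono])
next
  case False
  hence none: "{t. 1 \<le> t \<and> stop_cond M \<sigma> \<epsilon> \<delta> p y t} = {}" by blast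
  have "sample_complexity M \<sigma> \<epsilon> \<delta> p y = \<infinity>"
    unfolding sample_complexity_def none by (simp add: top_enat_def)
  thus ?thesis using False by auto
qed

text \<open>If the algorithm never stopped, every \<open>T\<close> would be at most
  \<open>c\<close>. Bounding all running initial segments thus proves termination as well.\<close>

lemma sample_complexity_leI:
  assumes "\<And>T. 1 \<le> T \<Longrightarrow> enat T \<le> sample_complexity M \<sigma> \<epsilon> \<delta> p y \<Longrightarrow> real T \<le> c"
  shows "ereal_of_enat (sample_complexity M \<sigma> \<epsilon> \<delta> p y) \<le> ereal c"
proof (cases "sample_complexity M \<sigma> \<epsilon> \<delta> p y")
  case (enat T)
  have "1 \<le> T"
  proof (rule ccontr)
    assume "\<not> 1 \<le> T"
    have "enat 1 \<le> sample_complexity M \<sigma> \<epsilon> \<delta> p y" by (simp add: le_sample_complexity_iff)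
    thus False using enat \<open>\<not> 1 \<le> T\<close> by simp
  qed
  from assms[OF this] enat show ?thesis by simp
next
  case infinity
  have "real (Suc (nat \<lceil>c\<rceil>)) \<le> c" by (rule assms) (simp_all add: infinity)
  moreover have "c \<le> real (nat \<lceil>c\<rceil>)" by linarith
  ultimately show ?thesis by simp
qed

context mdp_interaction
begin

lemma measurable_est_reward:
  assumes h: "h \<in> stages M"
  shows "(\<lambda>\<omega>. est_reward M (plays \<omega>) (obs \<omega>) t h s a) \<in> borel_measurable P"
proof -
  have "(\<lambda>\<omega>. \<Sum>l\<in>visit_episodes M (plays \<omega>) t h s a. obs \<omega> l h)
      = (\<lambda>\<omega>. \<Sum>l\<in>{1..t}. if (s, a, h) \<in> trajectory M (pol l \<omega>) then y l h \<omega> else 0)"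
  proof (rule ext)
    fix \<omega>
    show "(\<Sum>l\<in>visit_episodes M (plays \<omega>) t h s a. obs \<omega> l h)
      = (\<Sum>l\<in>{1..t}. if (s, a, h) \<in> trajectory M (pol l \<omega>) then y l h \<omega> else 0)"
      unfolding visit_episodes_eq[OF h] by (rule sum.inter_filter) simp
  qed
  moreover have "(\<lambda>\<omega>. \<Sum>l\<in>{1..t}. if (s, a, h) \<in> trajectory M (pol l \<omega>) then y l h \<omega> else 0) \<in> borel_measurable P"
  proof (rule borel_measurable_sum)
    fix l assume "l \<in> {1..t}"
    hence l: "1 \<le> l" "l \<le> t" "l \<le> Suc t" by auto
    have [measurable]: "Measurable.pred P (\<lambda>\<omega>. (s, a, h) \<in> trajectory M (pol l \<omega>))" "y l h \<in> borel_measurable P"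
      using measurable_F_P[OF pred_pol[OF l(1,3), of "\<lambda>\<pi>. (s, a, h) \<in> trajectory M \<pi>"]]
        measurable_F_P[OF measurable_obs[OF l(1,2) h]] by auto
    show "(\<lambda>\<omega>. if (s, a, h) \<in> trajectory M (pol l \<omega>) then y l h \<omega> else 0) \<in> borel_measurable P" by measurable
  qed
  moreover have "(\<lambda>\<omega>. real (visits M (plays \<omega>) t h s a)) \<in> borel_measurable P"
    by (rule measurable_compose[OF measurable_F_P[OF measurable_visits[OF h, of t t]]]) simp_all
  ultimately show ?thesis unfolding est_reward_def by (simp add: borel_measurable_divide)
qed

lemma measurable_bonus:
  assumes h: "h \<in> stages M"
  shows "(\<lambda>\<omega>. bonus M \<sigma> \<delta> (plays \<omega>) t h s a) \<in> borel_measurable P"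
  unfolding bonus_def Let_def
  by (rule measurable_compose[OF measurable_F_P[OF measurable_visits[OF h, of t t]],
        of "\<lambda>n. if n = 0 then \<infinity> else ereal (sqrt (threshold M \<sigma> \<delta> n / real n))"]) simp_all

lemma measurable_upper_value: "(\<lambda>\<omega>. upper_value M \<sigma> \<delta> (plays \<omega>) (obs \<omega>) t \<pi>) \<in> borel_measurable P"
  unfolding upper_value_def
  by (intro borel_measurable_ereal_sum borel_measurable_ereal_add borel_measurable_ereal
      measurable_est_reward measurable_bonus)

lemma measurable_lower_value: "(\<lambda>\<omega>. lower_value M \<sigma> \<delta> (plays \<omega>) (obs \<omega>) t \<pi>) \<in> borel_measurable P"
  unfolding lower_value_def
  by (intro borel_measurable_ereal_sum borel_measurable_ereal_diff borel_measurable_ereal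
      measurable_est_reward measurable_bonus)

lemma measurable_bonus_sum: "(\<lambda>\<omega>. bonus_sum M \<sigma> \<delta> (plays \<omega>) t \<pi>) \<in> borel_measurable P"
  unfolding bonus_sum_def by (intro borel_measurable_ereal_sum measurable_bonus)

context
  fixes \<sigma> \<delta> :: real
  assumes \<sigma>: "0 < \<sigma>" and \<delta>: "0 < \<delta>" "\<delta> < 1"
begin

lemma path: "\<omega> \<in> space P \<Longrightarrow> eprl_path M \<sigma> \<delta> (plays \<omega>)"
  by unfold_locales (use wf \<sigma> \<delta> pol_policies in auto)

text \<open>Over finite types, membership and emptiness are finite Boolean combinations of the
  events that single actions are active.\<close>

lemma pred_remaining:
  assumes "\<And>h s a. h \<in> stages M \<Longrightarrow> Measurable.pred P (\<lambda>\<omega>. a \<in> active M \<sigma> \<delta> (plays \<omega>) (obs \<omega>) t h s)"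
  shows "Measurable.pred P (\<lambda>\<omega>. \<pi> \<in> remaining_policies M \<sigma> \<delta> (plays \<omega>) (obs \<omega>) t)"
proof -
  have "(\<lambda>\<omega>. \<pi> \<in> remaining_policies M \<sigma> \<delta> (plays \<omega>) (obs \<omega>) t) = (\<lambda>\<omega>. \<pi> \<in> policies M \<and>
     (\<forall>h\<in>stages M. \<forall>s\<in>UNIV. \<pi> h s \<in> active M \<sigma> \<delta> (plays \<omega>) (obs \<omega>) t h s \<or>
       (\<forall>a\<in>UNIV. \<not> a \<in> active M \<sigma> \<delta> (plays \<omega>) (obs \<omega>) t h s)))"
    by (auto simp: remaining_policies_def compatible_policies_def fun_eq_iff)
  moreover have "Measurable.pred P (\<lambda>\<omega>. \<pi> \<in> policies M \<and>
     (\<forall>h\<in>stages M. \<forall>s\<in>UNIV. \<pi> h s \<in> active M \<sigma> \<delta> (plays \<omega>) (obs \<omega>) t h s \<or>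
       (\<forall>a\<in>UNIV. \<not> a \<in> active M \<sigma> \<delta> (plays \<omega>) (obs \<omega>) t h s)))"
    by (intro pred_intros_logic pred_intros_finite assms) simp_all
  ultimately show ?thesis by simp
qed

text \<open>In its witness form, a round of elimination adds finitely many comparisons of confidence
  bounds to the remaining set of the previous round, which the induction hypothesis covers.\<close>

lemma pred_active:
  "h \<in> stages M \<Longrightarrow> Measurable.pred P (\<lambda>\<omega>. a \<in> active M \<sigma> \<delta> (plays \<omega>) (obs \<omega>) t h s)"
proof (induction t arbitrary: h s a)
  case 0
  show ?case by simp
next
  case (Suc t)
  note rem = pred_remaining[of t, OF Suc.IH]
  have le: "Measurable.pred P (\<lambda>\<omega>. lower_value M \<sigma> \<delta> (plays \<omega>) (obs \<omega>) (Suc t) \<pi>'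
      \<le> upper_value M \<sigma> \<delta> (plays \<omega>) (obs \<omega>) (Suc t) \<pi>)" for \<pi> \<pi>'
    using measurable_upper_value[of \<sigma> \<delta> "Suc t" \<pi>] measurable_lower_value[of \<sigma> \<delta> "Suc t" \<pi>'] by measurable
  have "Measurable.pred P (\<lambda>\<omega>. a \<in> active M \<sigma> \<delta> (plays \<omega>) (obs \<omega>) t h s \<and>
     (\<exists>\<pi>\<in>policies_through M s a h. \<pi> \<in> remaining_policies M \<sigma> \<delta> (plays \<omega>) (obs \<omega>) t \<and> (\<forall>\<pi>'\<in>policies M.
        lower_value M \<sigma> \<delta> (plays \<omega>) (obs \<omega>) (Suc t) \<pi>' \<le> upper_value M \<sigma> \<delta> (plays \<omega>) (obs \<omega>) (Suc t) \<pi>)))"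
    by (intro pred_intros_logic pred_intros_finite rem le Suc.IH[OF Suc.prems]) simp_all
  moreover have "(a \<in> active M \<sigma> \<delta> (plays \<omega>) (obs \<omega>) (Suc t) h s) = (a \<in> active M \<sigma> \<delta> (plays \<omega>) (obs \<omega>) t h s \<and>
     (\<exists>\<pi>\<in>policies_through M s a h. \<pi> \<in> remaining_policies M \<sigma> \<delta> (plays \<omega>) (obs \<omega>) t \<and> (\<forall>\<pi>'\<in>policies M.
        lower_value M \<sigma> \<delta> (plays \<omega>) (obs \<omega>) (Suc t) \<pi>' \<le> upper_value M \<sigma> \<delta> (plays \<omega>) (obs \<omega>) (Suc t) \<pi>)))"
    if "\<omega> \<in> space P" for \<omega>
    unfolding eprl_path.active_Suc_iff[OF path[OF that]] by blast
  ultimately show ?case by (subst measurable_cong) assumption+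
qed

lemma pred_stop_cond: "Measurable.pred P (\<lambda>\<omega>. stop_cond M \<sigma> \<epsilon> \<delta> (plays \<omega>) (obs \<omega>) t)"
proof -
  note rem = pred_remaining[of t, OF pred_active]
  have le: "Measurable.pred P (\<lambda>\<omega>. 2 * bonus_sum M \<sigma> \<delta> (plays \<omega>) t \<pi> \<le> ereal \<epsilon>)" for \<pi>
    using measurable_bonus_sum[of \<sigma> \<delta> t \<pi>] by measurable
  have "Measurable.pred P (\<lambda>\<omega>.
     (\<forall>\<pi>\<in>policies M. \<pi> \<in> remaining_policies M \<sigma> \<delta> (plays \<omega>) (obs \<omega>) t \<longrightarrow> 2 * bonus_sum M \<sigma> \<delta> (plays \<omega>) t \<pi> \<le> ereal \<epsilon>) \<or>
     (\<forall>h\<in>stages M. \<forall>s\<in>reachable M h. \<forall>a\<in>UNIV. \<forall>b\<in>UNIV. a \<in> active M \<sigma> \<delta> (plays \<omega>) (obs \<omega>) t h s \<longrightarrow>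
        b \<in> active M \<sigma> \<delta> (plays \<omega>) (obs \<omega>) t h s \<longrightarrow> a = b))"
    by (intro pred_intros_logic pred_intros_finite rem le pred_active) simp_all
  moreover have "stop_cond M \<sigma> \<epsilon> \<delta> (plays \<omega>) (obs \<omega>) t =
     ((\<forall>\<pi>\<in>policies M. \<pi> \<in> remaining_policies M \<sigma> \<delta> (plays \<omega>) (obs \<omega>) t \<longrightarrow> 2 * bonus_sum M \<sigma> \<delta> (plays \<omega>) t \<pi> \<le> ereal \<epsilon>) \<or>
     (\<forall>h\<in>stages M. \<forall>s\<in>reachable M h. \<forall>a\<in>UNIV. \<forall>b\<in>UNIV. a \<in> active M \<sigma> \<delta> (plays \<omega>) (obs \<omega>) t h s \<longrightarrow>
        b \<in> active M \<sigma> \<delta> (plays \<omega>) (obs \<omega>) t h s \<longrightarrow> a = b))"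
    if "\<omega> \<in> space P" for \<omega>
  proof -
    have card: "card (active M \<sigma> \<delta> (plays \<omega>) (obs \<omega>) t h s) \<le> 1 \<longleftrightarrow> (\<forall>a\<in>UNIV. \<forall>b\<in>UNIV.
      a \<in> active M \<sigma> \<delta> (plays \<omega>) (obs \<omega>) t h s \<longrightarrow> b \<in> active M \<sigma> \<delta> (plays \<omega>) (obs \<omega>) t h s \<longrightarrow> a = b)" for h s
      unfolding One_nat_def by (subst card_le_Suc0_iff_eq) auto
    show ?thesis
      unfolding eprl_path.stop_cond_iff[OF path[OF that]] card
      using eprl_path.remaining_subset[OF path[OF that], of "obs \<omega>" t] by blast
  qed
  ultimately show ?thesis by (subst measurable_cong) assumption+
qed

lemma sample_complexity_sets:
  "{\<omega> \<in> space P. ereal_of_enat (sample_complexity M \<sigma> \<epsilon> \<delta> (plays \<omega>) (obs \<omega>)) \<le> ereal c} \<in> sets P"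
proof -
  have [measurable]: "Measurable.pred P (\<lambda>\<omega>. stop_cond M \<sigma> \<epsilon> \<delta> (plays \<omega>) (obs \<omega>) t)" for t
    by (rule pred_stop_cond)
  show ?thesis unfolding sample_complexity_le_iff by measurable
qed

end

end

section \<open>The sample complexity of EPRL\<close>

text \<open>Both rules play a policy of maximal bonus in even episodes; this common part drives the
  bound.\<close>

lemma (in eprl_path) sample_complexity_le_worst_case:
  assumes \<epsilon>: "0 < \<epsilon>" and rule: "static_max_coverage M \<sigma> \<epsilon> \<delta> p y \<or> max_coverage M \<sigma> \<epsilon> \<delta> p y"
  defines "B \<equiv> real CARD('s) * real CARD('a) * H"
  shows "ereal_of_enat (sample_complexity M \<sigma> \<epsilon> \<delta> p y) \<le> ereal (256 * \<sigma>\<^sup>2 * B * H / \<epsilon>\<^sup>2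
     * (ln (4 * B / \<delta>) + 4 * ln (512 * \<sigma>\<^sup>2 * B * H * ln (4 * B / \<delta>) / \<epsilon>\<^sup>2)) + 8 * B + 2)"
proof (rule sample_complexity_leI)
  fix T assume T: "1 \<le> T" "enat T \<le> sample_complexity M \<sigma> \<epsilon> \<delta> p y"
  have running: "\<not> stop_cond M \<sigma> \<epsilon> \<delta> p y t" if "1 \<le> t" "t < T" for t
    using T(2) that by (simp add: le_sample_complexity_iff)
  have "max_bonus_choice M \<sigma> \<delta> p y t" if "1 \<le> t" "t \<le> T" "even t" for t
  proof -
    have "enat t \<le> sample_complexity M \<sigma> \<epsilon> \<delta> p y" using that(2) T(2) by (meson enat_ord_simps(1) order_trans)
    thus ?thesis using rule that(1,3) unfolding static_max_coverage_def max_coverage_def Let_def by metis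
  qed
  from episodes_le_worst_case[OF T(1) \<epsilon> running this]
  show "real T \<le> 256 * \<sigma>\<^sup>2 * B * H / \<epsilon>\<^sup>2
     * (ln (4 * B / \<delta>) + 4 * ln (512 * \<sigma>\<^sup>2 * B * H * ln (4 * B / \<delta>) / \<epsilon>\<^sup>2)) + 8 * B + 2"
    unfolding B_def .
qed

lemma (in concentrated_path) sample_complexity_le_flow:
  assumes \<epsilon>: "0 < \<epsilon>"
    and rule: "static_max_coverage M \<sigma> \<epsilon> \<delta> p y \<and> C = 1 \<or> max_coverage M \<sigma> \<epsilon> \<delta> p y \<and> C = ln H + 1"
  shows "ereal_of_enat (sample_complexity M \<sigma> \<epsilon> \<delta> p y) \<le> ereal (2 * C
    * (Max ((\<lambda>(s, a, h). ln (lower_bound_fun M \<sigma> \<epsilon> \<delta> h s a)) ` triples M) + 1)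
    * min_flow_value M (lower_bound_fun M \<sigma> \<epsilon> \<delta>))"
proof (rule sample_complexity_leI)
  fix T assume T: "1 \<le> T" "enat T \<le> sample_complexity M \<sigma> \<epsilon> \<delta> p y"
  have running: "\<not> stop_cond M \<sigma> \<epsilon> \<delta> p y t" if "1 \<le> t" "t < T" for t
    using T(2) that by (simp add: le_sample_complexity_iff)
  have C: "0 \<le> C" using rule H_ge_1 by auto
  show "real T \<le> 2 * C
    * (Max ((\<lambda>(s, a, h). ln (lower_bound_fun M \<sigma> \<epsilon> \<delta> h s a)) ` triples M) + 1)
    * min_flow_value M (lower_bound_fun M \<sigma> \<epsilon> \<delta>)"
  proof (rule episodes_le_flow[OF T(1) \<epsilon> running C])
    fix k t assume t: "1 \<le> t" "t \<le> T" "lev t = k"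
    from rule show "real (card (phase T k)) \<le> C * min_flow_value M (cover_demand M \<sigma> \<delta> p y k)"
    proof (elim disjE conjE)
      assume "static_max_coverage M \<sigma> \<epsilon> \<delta> p y" "C = 1"
      thus ?thesis using static_phase_le[OF T(1) \<epsilon> running _ t] by simp
    next
      assume "max_coverage M \<sigma> \<epsilon> \<delta> p y" "C = ln H + 1"
      thus ?thesis using greedy_phase_le[OF T(1) \<epsilon> running _ t] by simp
    qed
  qed
qed

theorem theorem8:
  fixes M :: "('s::finite, 'a::finite) det_mdp"
    and P :: "'w measure"
    and F :: "nat \<Rightarrow> 'w measure"
    and pol :: "nat \<Rightarrow> 'w \<Rightarrow> ('s, 'a) policy"
    and y :: "nat \<Rightarrow> nat \<Rightarrow> 'w \<Rightarrow> real"
    and \<sigma> \<epsilon> \<delta> C :: real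
  defines "\<tau> \<equiv> \<lambda>\<omega>. sample_complexity M \<sigma> \<epsilon> \<delta> (\<lambda>t. pol t \<omega>) (\<lambda>t h. y t h \<omega>)"
    and "g \<equiv> lower_bound_fun M \<sigma> \<epsilon> \<delta>"
    and "H \<equiv> real (horizon M)"
    and "S \<equiv> real CARD('s)"
    and "A \<equiv> real CARD('a)"
  assumes "wf_det_mdp M"
    and "0 < \<sigma>" and "sub_gaussian_rewards M \<sigma>"
    and "0 < \<epsilon>" and "0 < \<delta>" and "\<delta> < 1"
    and "interaction M P F pol y"
    and "(\<forall>\<omega>\<in>space P. static_max_coverage M \<sigma> \<epsilon> \<delta> (\<lambda>t. pol t \<omega>) (\<lambda>t h. y t h \<omega>)) \<and> C = 1
       \<or> (\<forall>\<omega>\<in>space P. max_coverage M \<sigma> \<epsilon> \<delta> (\<lambda>t. pol t \<omega>) (\<lambda>t h. y t h \<omega>)) \<and> C = ln H + 1"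
  shows "measure P {\<omega> \<in> space P. ereal_of_enat (\<tau> \<omega>) \<le>
           ereal (2 * C * (Max ((\<lambda>(s, a, h). ln (g h s a)) ` triples M) + 1) * min_flow_value M g)}
         \<ge> 1 - \<delta>
      \<and> measure P {\<omega> \<in> space P. ereal_of_enat (\<tau> \<omega>) \<le>
           ereal (256 * \<sigma>\<^sup>2 * S * A * H\<^sup>2 / \<epsilon>\<^sup>2
                    * (ln (4 * S * A * H / \<delta>)
                       + 4 * ln (512 * \<sigma>\<^sup>2 * S * A * H\<^sup>2 * ln (4 * S * A * H / \<delta>) / \<epsilon>\<^sup>2))
                  + 8 * S * A * H + 2)}
         \<ge> 1 - \<delta>"
proof
  interpret mdp_interaction M P F pol y by unfold_locales (fact assms)+
  note rule = assms(13)[folded H_def]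
  note sets = sample_complexity_sets[OF \<open>0 < \<sigma>\<close> \<open>0 < \<delta>\<close> \<open>\<delta> < 1\<close>]
  let ?U = "2 * C * (Max ((\<lambda>(s, a, h). ln (g h s a)) ` triples M) + 1) * min_flow_value M g"
  obtain G where G: "G \<in> sets P" "1 - \<delta> \<le> measure P G"
    "\<And>\<omega>. \<omega> \<in> G \<Longrightarrow> \<omega> \<in> space P \<and> concentrated_path M \<sigma> \<delta> (plays \<omega>) (obs \<omega>)"
    using concentrated_prob[OF \<open>0 < \<sigma>\<close> \<open>0 < \<delta>\<close> \<open>\<delta> < 1\<close> \<open>sub_gaussian_rewards M \<sigma>\<close>] by blast
  have "G \<subseteq> {\<omega> \<in> space P. ereal_of_enat (\<tau> \<omega>) \<le> ereal ?U}"
  proof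
    fix \<omega> assume "\<omega> \<in> G"
    hence \<omega>: "\<omega> \<in> space P" "concentrated_path M \<sigma> \<delta> (plays \<omega>) (obs \<omega>)" using G(3) by auto
    have "static_max_coverage M \<sigma> \<epsilon> \<delta> (plays \<omega>) (obs \<omega>) \<and> C = 1 \<or>
        max_coverage M \<sigma> \<epsilon> \<delta> (plays \<omega>) (obs \<omega>) \<and> C = ln (real (horizon M)) + 1"
      using rule \<omega>(1) unfolding H_def by blast
    from concentrated_path.sample_complexity_le_flow[OF \<omega>(2) \<open>0 < \<epsilon>\<close> this] \<omega>(1)
    show "\<omega> \<in> {\<omega> \<in> space P. ereal_of_enat (\<tau> \<omega>) \<le> ereal ?U}" by (simp add: \<tau>_def g_def)
  qed
  hence "measure P G \<le> measure P {\<omega> \<in> space P. ereal_of_enat (\<tau> \<omega>) \<le> ereal ?U}"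
    by (rule finite_measure_mono) (simp only: \<tau>_def sets)
  with G(2) show "1 - \<delta> \<le> measure P {\<omega> \<in> space P. ereal_of_enat (\<tau> \<omega>) \<le> ereal ?U}" by linarith
  let ?V = "256 * \<sigma>\<^sup>2 * S * A * H\<^sup>2 / \<epsilon>\<^sup>2 * (ln (4 * S * A * H / \<delta>)
    + 4 * ln (512 * \<sigma>\<^sup>2 * S * A * H\<^sup>2 * ln (4 * S * A * H / \<delta>) / \<epsilon>\<^sup>2)) + 8 * S * A * H + 2"
  have "{\<omega> \<in> space P. ereal_of_enat (\<tau> \<omega>) \<le> ereal ?V} = space P"
  proof (intro equalityI subsetI)
    fix \<omega> assume \<omega>: "\<omega> \<in> space P"
    have "static_max_coverage M \<sigma> \<epsilon> \<delta> (plays \<omega>) (obs \<omega>) \<or> max_coverage M \<sigma> \<epsilon> \<delta> (plays \<omega>) (obs \<omega>)"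
      using rule \<omega> by blast
    from eprl_path.sample_complexity_le_worst_case[OF path[OF \<open>0 < \<sigma>\<close> \<open>0 < \<delta>\<close> \<open>\<delta> < 1\<close> \<omega>] \<open>0 < \<epsilon>\<close> this]
    show "\<omega> \<in> {\<omega> \<in> space P. ereal_of_enat (\<tau> \<omega>) \<le> ereal ?V}"
      using \<omega> by (simp add: \<tau>_def S_def A_def H_def power2_eq_square mult.assoc)
  qed simp
  thus "1 - \<delta> \<le> measure P {\<omega> \<in> space P. ereal_of_enat (\<tau> \<omega>) \<le> ereal ?V}"
    using \<open>0 < \<delta>\<close> by (simp add: prob_space)
qed

end
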